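(* Let $H=\langle u_1,\dots,u_k\rangle$ be a finitely generated subgroup of $F_2$. Suppose that $H$ is the fixed point group of an automorphism $\phi$ of $F_2$. Let $\Omega_1$ be the set of all chains of type (C1) or (C2) of length less than or equal to $4|H|+4$, and let $\Omega_2$ be the set of all compositions of $\delta_i$'s ($i=1,2,3,4$) of length less than or equal to $(2^{4|H|+4}+1)|H|$. Put \[ \Omega=\{\beta\delta'\psi' \mid \psi'\in\Omega_1,\ \delta'\in\Omega_2,\ \beta \text{ is a Whitehead automorphism of } F_2 \text{ of type (W1)}\}. \] Then there exists $\psi\in\Omega$ of which $H$ is the fixed point group.
   Context: $F_2$ is the free group with basis $\{a,b\}$; $|w|$ denotes the length of the reduced word representing $w\in F_2$. For a subgroup $H=\langle u_1,\dots,u_k\rangle$ given by the generators $u_1,\dots,u_k$, put $|H|:=\max_{1\le i\le k}|u_i|$. A subgroup $H$ of $F_2$ is the fixed point group of an automorphism $\phi$ if $H$ is precisely the set of elements of $F_2$ fixed by $\phi$. Compositions act on the left. A Whitehead automorphism of type (W1) is an automorphism of $F_2$ that permutes the elements of $\{a,b,a^{-1},b^{-1}\}$. Let $\sigma,\tau$ be the automorphisms of $F_2$ with $\sigma(a)=ab,\ \sigma(b)=b$ and $\tau(a)=a,\ \tau(b)=ba$. A chain of type (C1) is a composition $\tau^{m_r}\sigma^{l_r}\cdots\tau^{m_1}\sigma^{l_1}$, and a chain of type (C2) is a composition $\tau^{-m_r}\sigma^{-l_r}\cdots\tau^{-m_1}\sigma^{-l_1}$, with $r\in\mathbb{N}$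 and all $l_i,m_i\ge 0$; the length of such a chain is $\sum_{i}(m_i+l_i)$. The automorphisms $\delta_1,\dots,\delta_4$ of $F_2$ are: $\delta_1(a)=b^{-1}ab,\ \delta_1(b)=b$; $\delta_2(a)=bab^{-1},\ \delta_2(b)=b$; $\delta_3(a)=a,\ \delta_3(b)=a^{-1}ba$; $\delta_4(a)=a,\ \delta_4(b)=aba^{-1}$. The length of a composition of $\delta_i$'s is its number of factors (the empty composition, the identity, having length $0$). *)

theory Defs
  imports "HOL-Algebra.Generated_Groups" "HOL-Algebra.Bij"
begin

section \<open>The free group with basis a, b\<close>

datatype gen = Gen_A | Gen_B

text \<open>A letter is a generator with a flag; the flag \<open>True\<close> marks the inverse of the generator.\<close>

type_synonym letter = "gen \<times> bool"

definition inv_letter :: "letter \<Rightarrow> letter" where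
  "inv_letter l = (fst l, \<not> snd l)"

definition reduced :: "letter list \<Rightarrow> bool" where
  "reduced w \<longleftrightarrow> successively (\<lambda>x y. y \<noteq> inv_letter x) w"

definition push :: "letter \<Rightarrow> letter list \<Rightarrow> letter list" where
  "push x w = (if w \<noteq> [] \<and> hd w = inv_letter x then tl w else x # w)"

lemma inv_letter_inv_letter [simp]: "inv_letter (inv_letter x) = x"
  by (simp add: inv_letter_def)

lemma inv_letter_neq [simp]: "inv_letter x \<noteq> x" "x \<noteq> inv_letter x"
  by (auto simp: inv_letter_def prod_eq_iff)

lemma reduced_Nil [simp]: "reduced []"
  by (simp add: reduced_def)

lemma reduced_Cons: "reduced (x # w) \<longleftrightarrow> (w = [] \<or> hd w \<noteq> inv_letter x) \<and> reduced w"
  by (auto simp: reduced_def successively_Cons)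

lemma reduced_push: "reduced w \<Longrightarrow> reduced (push x w)"
  by (cases w) (auto simp: push_def reduced_Cons)

lemma push_push_inv: "reduced w \<Longrightarrow> push x (push (inv_letter x) w) = w"
  by (cases w) (auto simp: push_def reduced_Cons neq_Nil_conv)

lemma reduced_foldr_push: "reduced w \<Longrightarrow> reduced (foldr push u w)"
  by (induction u) (auto simp: reduced_push)

lemma foldr_push_push:
  "reduced v \<Longrightarrow> reduced w \<Longrightarrow> foldr push (push x v) w = push x (foldr push v w)"
proof (cases "v \<noteq> [] \<and> hd v = inv_letter x")
  case True
  assume *: "reduced v" "reduced w"
  from True obtain v' where v: "v = inv_letter x # v'" by (cases v) auto
  with * have "reduced (foldr push v' w)" by (simp add: reduced_foldr_push)
  moreover have "push x v = v'" using v by (simp add: push_def)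
  ultimately show ?thesis using v by (simp add: push_push_inv)
qed (auto simp: push_def[of x v])

lemma foldr_push_assoc:
  assumes "reduced v" "reduced w"
  shows "foldr push (foldr push u v) w = foldr push u (foldr push v w)"
  using assms by (induction u) (auto simp: foldr_push_push reduced_foldr_push)

lemma foldr_push_Nil: "reduced u \<Longrightarrow> foldr push u [] = u"
  by (induction u) (auto simp: reduced_Cons push_def)

lemma foldr_push_inv:
  "reduced w \<Longrightarrow> foldr push (rev (map inv_letter u)) (foldr push u w) = w"
proof (induction u arbitrary: w)
  case (Cons x u)
  have "push (inv_letter x) (push x (foldr push u w)) = foldr push u w"
    using push_push_inv[of "foldr push u w" "inv_letter x"] Cons.prems
    by (simp add: reduced_foldr_push)
  then show ?case using Cons by simp
qed simp

lemma reduced_inv: "reduced w \<Longrightarrow> reduced (rev (map inv_letter w))"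
  unfolding reduced_def successively_rev successively_map
  by (erule successively_mono) (metis inv_letter_inv_letter)

typedef free2 = "{w. reduced w}" morphisms reduced_word Abs_free2
  by (rule exI[of _ "[]"]) simp

setup_lifting type_definition_free2

lift_definition mult2 :: "free2 \<Rightarrow> free2 \<Rightarrow> free2" is "foldr push"
  by (rule reduced_foldr_push)

lift_definition one2 :: free2 is "[]"
  by simp

definition F2 :: "free2 monoid" where
  "F2 = \<lparr>carrier = UNIV, mult = mult2, one = one2\<rparr>"

lemma carrier_F2 [simp]: "carrier F2 = UNIV"
  by (simp add: F2_def)

lemma mult2_assoc: "mult2 (mult2 x y) z = mult2 x (mult2 y z)"
  by transfer (rule foldr_push_assoc)

lemma mult2_one_left: "mult2 one2 x = x"
  by transfer simp

lemma mult2_left_inverse: "\<exists>y. mult2 y x = one2"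
proof transfer
  fix x assume x: "reduced x"
  have "foldr push (rev (map inv_letter x)) x = []"
    using foldr_push_inv[of "[]" x] x by (simp add: foldr_push_Nil)
  then show "\<exists>y\<in>Collect reduced. foldr push y x = []"
    using reduced_inv[OF x] by blast
qed

lemma group_F2: "group F2"
  by (rule groupI)
    (use mult2_left_inverse in \<open>auto simp: F2_def mult2_assoc mult2_one_left\<close>)

interpretation F2: group F2
  by (rule group_F2)

lift_definition gen_a :: free2 is "[(Gen_A, False)]"
  by (simp add: reduced_Cons)

lift_definition gen_b :: free2 is "[(Gen_B, False)]"
  by (simp add: reduced_Cons)

definition len :: "free2 \<Rightarrow> nat" where
  "len w = length (reduced_word w)"

section \<open>Endomorphisms given by the images of a and b\<close>

fun letter_val :: "free2 \<Rightarrow> free2 \<Rightarrow> letter \<Rightarrow> free2" where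
  "letter_val x y (Gen_A, e) = (if e then inv\<^bsub>F2\<^esub> x else x)"
| "letter_val x y (Gen_B, e) = (if e then inv\<^bsub>F2\<^esub> y else y)"

definition endo :: "free2 \<Rightarrow> free2 \<Rightarrow> free2 \<Rightarrow> free2" where
  "endo x y w = foldr (\<lambda>l v. letter_val x y l \<otimes>\<^bsub>F2\<^esub> v) (reduced_word w) \<one>\<^bsub>F2\<^esub>"

lemma letter_val_inv: "letter_val x y (inv_letter l) = inv\<^bsub>F2\<^esub> (letter_val x y l)"
  by (cases "(x, y, l)" rule: letter_val.cases) (auto simp: inv_letter_def)

lemma foldr_letter_val_push:
  "foldr (\<lambda>l v. letter_val x y l \<otimes>\<^bsub>F2\<^esub> v) (push l w) u
     = letter_val x y l \<otimes>\<^bsub>F2\<^esub> foldr (\<lambda>l v. letter_val x y l \<otimes>\<^bsub>F2\<^esub> v) w u"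
  by (cases w) (auto simp: push_def letter_val_inv F2.m_assoc[symmetric])

lemma endo_hom: "endo x y \<in> hom F2 F2"
proof (rule homI)
  fix u v
  let ?f = "foldr (\<lambda>l v. letter_val x y l \<otimes>\<^bsub>F2\<^esub> v)"
  have 1: "?f (foldr push p q) z = ?f p (?f q z)" for p q z
    by (induction p) (auto simp: foldr_letter_val_push)
  have 2: "?f p z = ?f p \<one>\<^bsub>F2\<^esub> \<otimes>\<^bsub>F2\<^esub> z" for p z
    by (induction p) (auto simp: F2.m_assoc)
  have "reduced_word (u \<otimes>\<^bsub>F2\<^esub> v) = foldr push (reduced_word u) (reduced_word v)"
    by (simp add: F2_def mult2.rep_eq)
  then show "endo x y (u \<otimes>\<^bsub>F2\<^esub> v) = endo x y u \<otimes>\<^bsub>F2\<^esub> endo x y v"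
    using 1 2 by (metis endo_def)
qed simp

lemma endo_a [simp]: "endo x y gen_a = x" and endo_b [simp]: "endo x y gen_b = y"
  by (simp_all add: endo_def gen_a.rep_eq gen_b.rep_eq)

lemma endo_unique:
  assumes f: "f \<in> hom F2 F2"
  shows "f = endo (f gen_a) (f gen_b)"
proof
  fix w
  interpret f: group_hom F2 F2 f
    by unfold_locales (rule f)
  have single: "Abs_free2 [l] = letter_val gen_a gen_b l" for l
  proof -
    have "mult2 (Abs_free2 [(Gen_A, True)]) gen_a = one2" "mult2 (Abs_free2 [(Gen_B, True)]) gen_b = one2"
      by (simp_all add: reduced_word_inject[symmetric] mult2.rep_eq one2.rep_eq gen_a.rep_eq gen_b.rep_eq
          Abs_free2_inverse reduced_Cons push_def inv_letter_def)
    then have "inv\<^bsub>F2\<^esub> gen_a = Abs_free2 [(Gen_A, True)]" "inv\<^bsub>F2\<^esub> gen_b = Abs_free2 [(Gen_B, True)]"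
      using F2.inv_equality[of _ gen_a] F2.inv_equality[of _ gen_b] by (simp_all add: F2_def)
    then show ?thesis
      by (cases "(gen_a, gen_b, l)" rule: letter_val.cases) (auto simp: gen_a_def gen_b_def)
  qed
  have fl: "f (letter_val gen_a gen_b l) = letter_val (f gen_a) (f gen_b) l" for l
    by (cases "(gen_a, gen_b, l)" rule: letter_val.cases) auto
  have "reduced u \<Longrightarrow> f (Abs_free2 u)
          = foldr (\<lambda>l v. letter_val (f gen_a) (f gen_b) l \<otimes>\<^bsub>F2\<^esub> v) u \<one>\<^bsub>F2\<^esub>" for u
  proof (induction u)
    case Nil
    have "Abs_free2 [] = \<one>\<^bsub>F2\<^esub>" by (simp add: F2_def one2_def)
    then show ?case by simp
  next
    case (Cons l u)
    then have u: "reduced u" "reduced [l]" by (auto simp: reduced_Cons)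
    have "Abs_free2 (l # u) = Abs_free2 [l] \<otimes>\<^bsub>F2\<^esub> Abs_free2 u"
      using Cons.prems u
      by (auto simp: F2_def reduced_word_inject[symmetric] mult2.rep_eq Abs_free2_inverse
          push_def reduced_Cons)
    then show ?case using Cons u by (simp add: single fl)
  qed
  from this[of "reduced_word w"] show "f w = endo (f gen_a) (f gen_b) w"
    using reduced_word[of w] by (simp add: endo_def reduced_word_inverse)
qed

section \<open>Automorphisms\<close>

definition sigma :: "free2 \<Rightarrow> free2" where
  "sigma = endo (gen_a \<otimes>\<^bsub>F2\<^esub> gen_b) gen_b"

definition tau :: "free2 \<Rightarrow> free2" where
  "tau = endo gen_a (gen_b \<otimes>\<^bsub>F2\<^esub> gen_a)"

definition delta1 :: "free2 \<Rightarrow> free2" where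
  "delta1 = endo (inv\<^bsub>F2\<^esub> gen_b \<otimes>\<^bsub>F2\<^esub> gen_a \<otimes>\<^bsub>F2\<^esub> gen_b) gen_b"

definition delta2 :: "free2 \<Rightarrow> free2" where
  "delta2 = endo (gen_b \<otimes>\<^bsub>F2\<^esub> gen_a \<otimes>\<^bsub>F2\<^esub> inv\<^bsub>F2\<^esub> gen_b) gen_b"

definition delta3 :: "free2 \<Rightarrow> free2" where
  "delta3 = endo gen_a (inv\<^bsub>F2\<^esub> gen_a \<otimes>\<^bsub>F2\<^esub> gen_b \<otimes>\<^bsub>F2\<^esub> gen_a)"

definition delta4 :: "free2 \<Rightarrow> free2" where
  "delta4 = endo gen_a (gen_a \<otimes>\<^bsub>F2\<^esub> gen_b \<otimes>\<^bsub>F2\<^esub> inv\<^bsub>F2\<^esub> gen_a)"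

lemma auto_F2_iff: "f \<in> auto F2 \<longleftrightarrow> f \<in> hom F2 F2 \<and> bij f"
  by (auto simp: auto_def Bij_def)

lemma endo_comp_id:
  assumes "endo x y z = gen_a" "endo x y w = gen_b"
  shows "endo x y \<circ> endo z w = id"
proof -
  have "endo x y \<circ> endo z w \<in> hom F2 F2" "id \<in> hom F2 F2"
    using endo_hom[of x y] endo_hom[of z w] by (auto simp: hom_def)
  then show ?thesis
    using endo_unique[of "endo x y \<circ> endo z w"] endo_unique[of id] assms by simp
qed

lemma endo_auto:
  assumes "endo x y z = gen_a" "endo x y w = gen_b" "endo z w x = gen_a" "endo z w y = gen_b"
  shows "endo x y \<in> auto F2"
  unfolding auto_F2_iff
  using endo_hom endo_comp_id[of x y z w] endo_comp_id[of z w x y] assms o_bij by blast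

lemma endo_mult [simp]: "endo x y (u \<otimes>\<^bsub>F2\<^esub> v) = endo x y u \<otimes>\<^bsub>F2\<^esub> endo x y v"
  using endo_hom[of x y] by (auto simp: hom_def)

lemma endo_inv [simp]: "endo x y (inv\<^bsub>F2\<^esub> u) = inv\<^bsub>F2\<^esub> (endo x y u)"
proof -
  interpret group_hom F2 F2 "endo x y"
    by unfold_locales (rule endo_hom)
  show ?thesis by simp
qed

lemma inv_mult_cancel [simp]:
  "inv\<^bsub>F2\<^esub> u \<otimes>\<^bsub>F2\<^esub> (u \<otimes>\<^bsub>F2\<^esub> v) = v" "u \<otimes>\<^bsub>F2\<^esub> (inv\<^bsub>F2\<^esub> u \<otimes>\<^bsub>F2\<^esub> v) = v"
  by (simp_all add: F2.m_assoc[symmetric])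

lemma sigma_auto: "sigma \<in> auto F2"
  unfolding sigma_def
  by (rule endo_auto[where z = "gen_a \<otimes>\<^bsub>F2\<^esub> inv\<^bsub>F2\<^esub> gen_b" and w = gen_b]) (simp_all add: F2.m_assoc)

lemma tau_auto: "tau \<in> auto F2"
  unfolding tau_def
  by (rule endo_auto[where z = gen_a and w = "gen_b \<otimes>\<^bsub>F2\<^esub> inv\<^bsub>F2\<^esub> gen_a"]) (simp_all add: F2.m_assoc)

lemma delta_auto: "delta1 \<in> auto F2" "delta2 \<in> auto F2" "delta3 \<in> auto F2" "delta4 \<in> auto F2"
  unfolding delta1_def delta2_def delta3_def delta4_def
     apply (rule endo_auto[where z = "gen_b \<otimes>\<^bsub>F2\<^esub> gen_a \<otimes>\<^bsub>F2\<^esub> inv\<^bsub>F2\<^esub> gen_b" and w = gen_b];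
      simp add: F2.m_assoc)
    apply (rule endo_auto[where z = "inv\<^bsub>F2\<^esub> gen_b \<otimes>\<^bsub>F2\<^esub> gen_a \<otimes>\<^bsub>F2\<^esub> gen_b" and w = gen_b];
      simp add: F2.m_assoc)
   apply (rule endo_auto[where w = "gen_a \<otimes>\<^bsub>F2\<^esub> gen_b \<otimes>\<^bsub>F2\<^esub> inv\<^bsub>F2\<^esub> gen_a" and z = gen_a];
      simp add: F2.m_assoc)
  apply (rule endo_auto[where w = "inv\<^bsub>F2\<^esub> gen_a \<otimes>\<^bsub>F2\<^esub> gen_b \<otimes>\<^bsub>F2\<^esub> gen_a" and z = gen_a];
      simp add: F2.m_assoc)
  done

definition whitehead_W1 :: "(free2 \<Rightarrow> free2) set" where
  "whitehead_W1 = {f \<in> auto F2.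
     bij_betw f {gen_a, gen_b, inv\<^bsub>F2\<^esub> gen_a, inv\<^bsub>F2\<^esub> gen_b} {gen_a, gen_b, inv\<^bsub>F2\<^esub> gen_a, inv\<^bsub>F2\<^esub> gen_b}}"

text \<open>
  The list \<open>[(l\<^sub>1, m\<^sub>1), \<dots>, (l\<^sub>r, m\<^sub>r)]\<close> encodes the composition
  \<open>t\<^bsup>m\<^sub>r\<^esup> s\<^bsup>l\<^sub>r\<^esup> \<dots> t\<^bsup>m\<^sub>1\<^esup> s\<^bsup>l\<^sub>1\<^esup>\<close> in which \<open>s\<^bsup>l\<^sub>1\<^esup>\<close> is applied first.
\<close>

fun chain :: "(free2 \<Rightarrow> free2) \<Rightarrow> (free2 \<Rightarrow> free2) \<Rightarrow> (nat \<times> nat) list \<Rightarrow> free2 \<Rightarrow> free2" where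
  "chain s t [] = id"
| "chain s t ((l, m) # es) = chain s t es \<circ> (t ^^ m) \<circ> (s ^^ l)"

definition chain_length :: "(nat \<times> nat) list \<Rightarrow> nat" where
  "chain_length es = (\<Sum>(l, m)\<leftarrow>es. m + l)"

text \<open>
  The inverse maps are written \<open>inv_into UNIV\<close> because \<open>inv\<close> is the group inverse here.
\<close>

definition chains_C1 :: "nat \<Rightarrow> (free2 \<Rightarrow> free2) set" where
  "chains_C1 n = {chain sigma tau es | es. chain_length es \<le> n}"

definition chains_C2 :: "nat \<Rightarrow> (free2 \<Rightarrow> free2) set" where
  "chains_C2 n = {chain (inv_into UNIV sigma) (inv_into UNIV tau) es | es. chain_length es \<le> n}"

definition delta_compositions :: "nat \<Rightarrow> (free2 \<Rightarrow> free2) set" where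
  "delta_compositions n =
     {foldr (\<circ>) ds id | ds. set ds \<subseteq> {delta1, delta2, delta3, delta4} \<and> length ds \<le> n}"

section \<open>Fixed point groups\<close>

definition is_fixed_point_group :: "free2 set \<Rightarrow> (free2 \<Rightarrow> free2) \<Rightarrow> bool" where
  "is_fixed_point_group H f \<longleftrightarrow> f \<in> auto F2 \<and> H = {x. f x = x}"

text \<open>
  The norm of a subgroup depends on the given generators \<open>u\<^sub>1, \<dots>, u\<^sub>k\<close>. Inserting \<open>0\<close> only matters
  for \<open>k = 0\<close>, where the maximum over the empty set is read as \<open>0\<close>.
\<close>

definition gens_norm :: "free2 list \<Rightarrow> nat" where
  "gens_norm us = Max (insert 0 (len ` set us))"

definition Omega1 :: "nat \<Rightarrow> (free2 \<Rightarrow> free2) set" where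
  "Omega1 h = chains_C1 (4 * h + 4) \<union> chains_C2 (4 * h + 4)"

definition Omega2 :: "nat \<Rightarrow> (free2 \<Rightarrow> free2) set" where
  "Omega2 h = delta_compositions ((2 ^ (4 * h + 4) + 1) * h)"

definition Omega :: "nat \<Rightarrow> (free2 \<Rightarrow> free2) set" where
  "Omega h = {\<beta> \<circ> \<delta> \<circ> \<psi> | \<beta> \<delta> \<psi>. \<psi> \<in> Omega1 h \<and> \<delta> \<in> Omega2 h \<and> \<beta> \<in> whitehead_W1}"

end

theory Submission
  imports Defs
begin

text \<open>
  If $H$ is abelian it is trivial, the fixed subgroup of $a \mapsto a^{-1}, b \mapsto b^{-1}$, or the
  centralizer of a generator $u$, the fixed subgroup of conjugation by $u$. Suppose that $H$ is not
  abelian and that $\phi \neq 1$. Up to conjugacy in the outer automorphism group, $\phi$ is a word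
  in nonnegative powers of $\sigma$ and $\tau$, possibly composed with a letter permutation, or of
  finite order. Elements of finite outer order act on Sanov's congruence subgroup of $SL_2(\mathbb{Z})$
  as conjugation by a nonscalar matrix, so their fixed elements commute, apart from a reflection,
  which is treated by hand. A word in which both $\sigma$ and $\tau$ occur fixes only conjugates of
  powers of the commutator of $a$ and $b$, which again leaves an abelian fixed subgroup. What remains
  is $\phi = \alpha \sigma^m \alpha^{-1}$, and then $H$ is also the fixed subgroup of
  $\theta = \alpha \sigma^{\pm 1} \alpha^{-1}$.

  Write $\alpha$ as a letter permutation times a positive word $\gamma$ modulo inner automorphisms and
  modulo the centralizer of the outer class of $\sigma$. Every element of $H$ is homologous to a
  multiple of $\alpha(b)$, and the homology class of $\gamma(b)$ grows with the length of $\gamma$, so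
  this length is less than $|H|$. This bounds the chain representing $\theta = c \, \iota_v \chi$, where
  $c$ permutes letters, $\iota_v$ is conjugation by $v$ and $\chi$ is a chain. Finally $\iota_v$ carries
  two noncommuting short elements $\chi(u_1), \chi(u_2)$ to short elements; if $v$ were long, two
  different prefixes of $v$ would produce the same pair of conjugates, and $u_1, u_2$ would commute.
\<close>

section \<open>Additive notation\<close>

text \<open>The fixed subgroup is not an invariant of the outer class, while normal forms are found
  only up to inner automorphisms. Hence every class is treated with all its representatives at once:
  \<open>elliptic\<close> quantifies over them, and \<open>twist_nonabelian\<close> upgrades
  equality of outer classes to a conjugacy of automorphisms. Passing from exponent \<open>m\<close>
  to 1 or -1 is what makes a bound by \<open>gens_norm us\<close> possible: \<open>m\<close> depends
  on \<phi> and is unbounded, but all nonzero powers of a twist have the same fixed elements. A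
  chain may use one sign only, whereas \<alpha> sigma \<alpha>^-1 mixes both; the letter rotation
  \<open>auR\<close>, which exchanges positive and negative twists, repairs this at the cost of a
  factor of type (W1). The chain obtained has length at most max 1 (2 (|H| - 1)), well within 4 |H|
  + 4. The constant 2^(4 |H| + 4) = 16 * 16^|H| has to absorb the number of pairs of elements of
  length at most |H|, which is estimated by (2 * 4^|H|)^2.\<close>

instantiation free2 :: group_add
begin

definition "0 = \<one>\<^bsub>F2\<^esub>"
definition "x + y = x \<otimes>\<^bsub>F2\<^esub> y" for x y :: free2
definition "- x = inv\<^bsub>F2\<^esub> x" for x :: free2
definition "x - y = x \<otimes>\<^bsub>F2\<^esub> inv\<^bsub>F2\<^esub> y" for x y :: free2

instance
  by standard (auto simp: zero_free2_def plus_free2_def uminus_free2_def minus_free2_def F2.m_assoc)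

end

lemma F2_additive [simp]:
  "x \<otimes>\<^bsub>F2\<^esub> y = x + y" "inv\<^bsub>F2\<^esub> x = - x" "\<one>\<^bsub>F2\<^esub> = (0::free2)"
  by (simp_all add: zero_free2_def plus_free2_def uminus_free2_def)

lemma add_minus_cancel' [simp]: "x + (- x + y) = (y::'a::group_add)" "- x + (x + y) = y"
  by (simp_all add: add.assoc[symmetric])

text \<open>In a nonabelian additive group the sums \<open>x + - y\<close> are easier to reassociate than differences.\<close>

declare add_uminus_conv_diff [simp del]

lemmas grp = add.assoc minus_add diff_conv_add_uminus

definition ghom :: "(free2 \<Rightarrow> free2) \<Rightarrow> bool" where
  "ghom f \<longleftrightarrow> (\<forall>x y. f (x + y) = f x + f y)"

lemma ghom_iff: "f \<in> hom F2 F2 \<longleftrightarrow> ghom f"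
  by (simp add: hom_def ghom_def)

lemma auto_iff: "f \<in> auto F2 \<longleftrightarrow> ghom f \<and> bij f"
  by (simp add: auto_F2_iff ghom_iff)

lemma ghom_add: "ghom f \<Longrightarrow> f (x + y) = f x + f y"
  by (simp add: ghom_def)

lemma ghom_0: "ghom f \<Longrightarrow> f 0 = 0"
  using ghom_add[of f 0 0] by (metis add.right_neutral add_left_cancel)

lemma ghom_minus: "ghom f \<Longrightarrow> f (- x) = - f x"
  using ghom_add[of f "- x" x] by (simp add: ghom_0 eq_neg_iff_add_eq_0)

lemma ghom_diff: "ghom f \<Longrightarrow> f (x - y) = f x - f y"
  using ghom_add[of f x "- y"] by (simp add: ghom_minus diff_conv_add_uminus)

lemmas ghom_simps = ghom_add ghom_0 ghom_minus ghom_diff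

lemma ghom_comp: "ghom f \<Longrightarrow> ghom g \<Longrightarrow> ghom (f \<circ> g)"
  by (simp add: ghom_def)

lemma ghom_id [simp]: "ghom id"
  by (simp add: ghom_def)

lemma ghom_endo [simp]: "ghom (endo x y)"
  using endo_hom ghom_iff by blast

lemma ghom_eqI:
  assumes "ghom f" "ghom g" "f gen_a = g gen_a" "f gen_b = g gen_b"
  shows "f = g"
  using assms endo_unique[of f] endo_unique[of g] by (simp add: ghom_iff)

section \<open>Words\<close>

definition lt :: "letter \<Rightarrow> free2" where
  "lt l = Abs_free2 [l]"

definition ev :: "letter list \<Rightarrow> free2" where
  "ev u = sum_list (map lt u)"

definition inv_word :: "letter list \<Rightarrow> letter list" where
  "inv_word u = rev (map inv_letter u)"

abbreviation rw :: "free2 \<Rightarrow> letter list" where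
  "rw \<equiv> reduced_word"

lemma reduced_rw [simp]: "reduced (rw x)"
  using reduced_word by simp

lemma rw_0 [simp]: "rw 0 = []"
  by (simp add: zero_free2_def F2_def one2.rep_eq)

lemma rw_add: "rw (x + y) = foldr push (rw x) (rw y)"
  by (simp add: plus_free2_def F2_def mult2.rep_eq)

lemma rw_lt [simp]: "rw (lt l) = [l]"
  by (simp add: lt_def Abs_free2_inverse reduced_Cons)

lemma ev_simps [simp]: "ev [] = 0" "ev (l # u) = lt l + ev u" "ev (u @ v) = ev u + ev v"
  by (simp_all add: ev_def)

lemma rw_ev: "rw (ev u) = foldr push u []"
  by (induction u) (simp_all add: rw_add)

lemma rw_ev_reduced [simp]: "reduced u \<Longrightarrow> rw (ev u) = u"
  by (simp add: rw_ev foldr_push_Nil)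

lemma ev_rw [simp]: "ev (rw x) = x"
  by (simp add: reduced_word_inject[symmetric])

lemma ev_inject: "reduced u \<Longrightarrow> reduced v \<Longrightarrow> ev u = ev v \<longleftrightarrow> u = v"
  by (metis rw_ev_reduced)

lemma lt_inv_letter [simp]: "lt (inv_letter l) = - lt l"
proof -
  have "rw (lt (inv_letter l) + lt l) = rw 0"
    by (simp add: rw_add push_def)
  then have "lt (inv_letter l) + lt l = 0"
    by (simp only: reduced_word_inject)
  then show ?thesis
    by (simp only: eq_neg_iff_add_eq_0)
qed

lemma gen_lt: "gen_a = lt (Gen_A, False)" "gen_b = lt (Gen_B, False)"
  by (simp_all add: gen_a_def gen_b_def lt_def)

lemma lt_True [simp]: "lt (g, True) = - lt (g, False)"
  using lt_inv_letter[of "(g, False)"] by (simp add: inv_letter_def)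

lemma lt_gen: "lt (Gen_A, e) = (if e then - gen_a else gen_a)"
  "lt (Gen_B, e) = (if e then - gen_b else gen_b)"
  by (simp_all add: gen_lt)

lemma lt_inject [simp]: "lt l = lt m \<longleftrightarrow> l = m"
  by (metis list.inject rw_lt)

lemma lt_neq_0 [simp]: "lt l \<noteq> 0" "0 \<noteq> lt l"
  by (metis list.distinct(1) rw_0 rw_lt)+

lemma inv_word_simps [simp]:
  "inv_word [] = []" "inv_word (l # u) = inv_word u @ [inv_letter l]"
  "inv_word (u @ v) = inv_word v @ inv_word u" "length (inv_word u) = length u"
  "inv_word (inv_word u) = u" "inv_word u = [] \<longleftrightarrow> u = []"
  by (simp_all add: inv_word_def rev_map comp_def)

lemma ev_inv_word [simp]: "ev (inv_word u) = - ev u"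
  by (induction u) (simp_all add: minus_add)

lemma reduced_inv_word [simp]: "reduced (inv_word u) \<longleftrightarrow> reduced u"
  using reduced_inv[of u] reduced_inv[of "inv_word u"] inv_word_simps(5) by (auto simp: inv_word_def)

lemma hd_inv_word: "u \<noteq> [] \<Longrightarrow> hd (inv_word u) = inv_letter (last u)"
  by (simp add: inv_word_def hd_rev last_map)

lemma last_inv_word: "u \<noteq> [] \<Longrightarrow> last (inv_word u) = inv_letter (hd u)"
  by (simp add: inv_word_def last_rev hd_map)

lemma rw_minus: "rw (- x) = inv_word (rw x)"
  by (metis ev_inv_word ev_rw reduced_inv_word reduced_rw rw_ev_reduced)

lemma reduced_append:
  "reduced (u @ v) \<longleftrightarrow> reduced u \<and> reduced v \<and> (u = [] \<or> v = [] \<or> hd v \<noteq> inv_letter (last u))"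
  by (auto simp: reduced_def successively_append_iff)

lemma inv_letter_eq_iff [simp]: "inv_letter l = inv_letter m \<longleftrightarrow> l = m"
  by (metis inv_letter_inv_letter)

section \<open>Length and Gromov product\<close>

lemma len_0 [simp]: "len 0 = 0"
  by (simp add: len_def)

lemma len_lt [simp]: "len (lt l) = 1"
  by (simp add: len_def)

lemma len_eq_0 [simp]: "len x = 0 \<longleftrightarrow> x = 0"
  by (metis ev_rw ev_simps(1) len_0 len_def length_0_conv)

lemma len_minus [simp]: "len (- x) = len x"
  by (simp add: len_def rw_minus)

lemma len_ev_reduced: "reduced u \<Longrightarrow> len (ev u) = length u"
  by (simp add: len_def)

lemma length_foldr_push: "length (foldr push u v) \<le> length u + length v"
  by (induction u) (auto simp: push_def)

lemma len_add_le: "len (x + y) \<le> len x + len y"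
  by (simp add: len_def rw_add length_foldr_push)

lemma len_ev_le: "len (ev u) \<le> length u"
  using length_foldr_push[of u "[]"] by (simp add: len_def rw_ev)

fun lcp :: "'a list \<Rightarrow> 'a list \<Rightarrow> 'a list" where
  "lcp (x # xs) (y # ys) = (if x = y then x # lcp xs ys else [])"
| "lcp _ _ = []"

lemma lcp_commute: "lcp u v = lcp v u"
  by (induction u v rule: lcp.induct) auto

lemma lcp_decomp:
  "\<exists>u' v'. u = lcp u v @ u' \<and> v = lcp u v @ v' \<and> (u' = [] \<or> v' = [] \<or> hd u' \<noteq> hd v')"
proof (induction u v rule: lcp.induct)
  case (1 x xs y ys)
  then show ?case by (cases "x = y") auto
qed auto

text \<open>Up to the shorter of the two overlaps \<open>u\<close> and \<open>w\<close> both agree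
  with \<open>v\<close>, hence with each other. For \<open>gp\<close> this is the 0-hyperbolicity of
  the Cayley tree.\<close>

lemma lcp_ultra: "min (length (lcp u v)) (length (lcp v w)) \<le> length (lcp u w)"
proof (induction u v arbitrary: w rule: lcp.induct)
  case (1 x xs y ys)
  show ?case
  proof (cases w)
    case (Cons z zs)
    then show ?thesis using 1[of zs] by auto
  qed simp
qed auto

text \<open>The Gromov product based at the identity of the Cayley tree.\<close>

definition gp :: "free2 \<Rightarrow> free2 \<Rightarrow> nat" where
  "gp x y = length (lcp (rw x) (rw y))"

lemma gp_commute: "gp x y = gp y x"
  by (simp add: gp_def lcp_commute)

lemma gp_ultra: "min (gp x y) (gp y z) \<le> gp x z"
  unfolding gp_def by (rule lcp_ultra)

lemma gp_le: "gp x y \<le> len x" "gp x y \<le> len y"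
  using lcp_decomp[of "rw x" "rw y"] unfolding gp_def len_def by (metis length_append le_add1)+

text \<open>Cancellation stops exactly at the end of the common prefix \<open>s\<close>, because the
  first letters of \<open>u\<close> and \<open>v\<close> differ.\<close>

lemma rw_cancel:
  assumes "rw x = s @ u" "rw y = s @ v" "u = [] \<or> v = [] \<or> hd u \<noteq> hd v"
  shows "rw (- x + y) = inv_word u @ v"
proof -
  have r: "reduced u" "reduced v"
    using reduced_rw[of x] reduced_rw[of y] assms by (auto simp: reduced_append)
  have "x = ev s + ev u" "y = ev s + ev v"
    using arg_cong[OF assms(1), of ev] arg_cong[OF assms(2), of ev] by simp_all
  then have "- x + y = ev (inv_word u @ v)"
    by (simp add: grp)
  moreover have "reduced (inv_word u @ v)"
    using r assms(3) by (auto simp: reduced_append last_inv_word)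
  ultimately show ?thesis by (simp only: rw_ev_reduced)
qed

lemma len_gp: "len (- x + y) + 2 * gp x y = len x + len y"
proof -
  obtain u v where *: "rw x = lcp (rw x) (rw y) @ u" "rw y = lcp (rw x) (rw y) @ v"
    "u = [] \<or> v = [] \<or> hd u \<noteq> hd v"
    using lcp_decomp by blast
  have "length (rw x) = gp x y + length u" "length (rw y) = gp x y + length v"
    unfolding gp_def using *(1,2) by (metis length_append)+
  then show ?thesis
    using rw_cancel[OF *] by (simp add: len_def)
qed

lemma lcp_append [simp]: "lcp s (s @ t) = s" "lcp (s @ t) s = s"
  by (induction s) auto

text \<open>\<open>q\<close> is the vertex at distance \<open>k\<close> from 0 on the geodesic to
  \<open>x\<close>.\<close>

lemma prefix_exists:
  assumes "k \<le> len x"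
  shows "\<exists>q. len q = k \<and> gp q x = k"
proof -
  obtain s t where st: "rw x = s @ t" "length s = k"
    using assms by (metis append_take_drop_id len_def length_take min.absorb2)
  then have "reduced s"
    by (metis reduced_append reduced_rw)
  then have "len (ev s) = k" "gp (ev s) x = k"
    using st by (simp_all add: gp_def len_ev_reduced)
  then show ?thesis by blast
qed

section \<open>Powers, conjugation, centralizers\<close>

definition nsc :: "nat \<Rightarrow> 'a::group_add \<Rightarrow> 'a" where
  "nsc n x = ((+) x ^^ n) 0"

lemma nsc_simps [simp]: "nsc 0 x = 0" "nsc (Suc n) x = x + nsc n x"
  by (simp_all add: nsc_def)

lemma nsc_add: "nsc (m + n) x = nsc m x + nsc n x"
  by (induction m) (simp_all add: add.assoc)

lemma nsc_Suc_right: "nsc (Suc n) x = nsc n x + x"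
  using nsc_add[of n 1 x] by simp

lemma nsc_mult: "nsc (m * n) x = nsc m (nsc n x)"
  by (induction m) (simp_all add: nsc_add)

lemma nsc_nsc: "nsc m (nsc n x) = nsc n (nsc m x)"
  by (metis mult.commute nsc_mult)

lemma nsc_minus: "nsc n (- x) = - nsc n x"
proof (induction n)
  case (Suc n)
  have "nsc (Suc n) (- x) = - (nsc n x + x)" using Suc by (simp add: minus_add)
  then show ?case by (simp only: nsc_Suc_right)
qed simp

lemma ghom_nsc: "ghom f \<Longrightarrow> f (nsc n x) = nsc n (f x)"
  by (induction n) (simp_all add: ghom_simps)

lemma ev_concat_replicate: "ev (concat (replicate n u)) = nsc n (ev u)"
  by (induction n) simp_all

definition comm :: "'a::group_add \<Rightarrow> 'a \<Rightarrow> bool" where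
  "comm x y \<longleftrightarrow> x + y = y + x"

lemma comm_sym: "comm x y \<Longrightarrow> comm y x"
  by (simp add: comm_def)

lemma comm_refl [simp]: "comm x x"
  by (simp add: comm_def)

lemma comm_0 [simp]: "comm 0 x" "comm x 0"
  by (simp_all add: comm_def)

lemma comm_minus_iff [simp]: "comm (- x) y \<longleftrightarrow> comm x y" "comm x (- y) \<longleftrightarrow> comm x y"
proof -
  have *: "comm (- x) y" if "comm x y" for x y :: 'a
  proof -
    have "- x + (y + x) + - x = - x + (x + y) + - x"
      using that by (simp add: comm_def)
    then show ?thesis by (simp add: comm_def add.assoc)
  qed
  show "comm (- x) y \<longleftrightarrow> comm x y" "comm x (- y) \<longleftrightarrow> comm x y"
    using * by (metis minus_minus, metis comm_sym minus_minus)
qed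

lemma comm_add: "comm x z \<Longrightarrow> comm y z \<Longrightarrow> comm (x + y) z"
  unfolding comm_def by (metis add.assoc)

lemma comm_nsc: "comm x y \<Longrightarrow> comm (nsc n x) y"
  by (induction n) (simp_all add: comm_add)

lemma nsc_add_comm: "comm x y \<Longrightarrow> nsc n (x + y) = nsc n x + nsc n y"
proof (induction n)
  case (Suc n)
  have "y + nsc n x = nsc n x + y"
    using comm_nsc[OF Suc.prems] by (simp add: comm_def)
  then have "y + (nsc n x + nsc n y) = nsc n x + (y + nsc n y)"
    by (simp add: add.assoc[symmetric])
  then show ?case using Suc by (simp add: add.assoc)
qed simp

definition cj :: "'a::group_add \<Rightarrow> 'a \<Rightarrow> 'a" where
  "cj g x = g + x + - g"

lemma cj_simps [simp]: "cj 0 x = x" "cj g 0 = 0" "cj g (cj h x) = cj (g + h) x"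
  "cj g (- x) = - cj g x" "cj g x = 0 \<longleftrightarrow> x = 0" "cj g g = g"
     apply (simp_all add: cj_def grp)
  by (metis add.assoc add.right_neutral add_0 add_minus_cancel'(2) right_minus)

lemma cj_add: "cj g (x + y) = cj g x + cj g y"
  by (simp add: cj_def grp)

lemma cj_inject [simp]: "cj g x = cj g y \<longleftrightarrow> x = y"
  by (metis add.left_inverse cj_simps(1,3))

lemma cj_eq_iff: "cj g x = y \<longleftrightarrow> x = cj (- g) y"
  by (metis add.left_inverse cj_inject cj_simps(1,3))

lemma cj_nsc: "cj g (nsc n x) = nsc n (cj g x)"
  by (induction n) (simp_all add: cj_add)

lemma cj_comm_iff: "cj g x = x \<longleftrightarrow> comm g x"
proof -
  have "cj g x + g = g + x"
    by (simp add: cj_def add.assoc)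
  then show ?thesis
    unfolding comm_def by (metis add_right_cancel)
qed

lemma comm_cj_iff [simp]: "comm (cj g x) (cj g y) \<longleftrightarrow> comm x y"
  by (metis cj_add cj_inject comm_def)

lemma ghom_cj_map: "ghom f \<Longrightarrow> f (cj g x) = cj (f g) (f x)"
  by (simp add: cj_def ghom_simps)

lemma ghom_cj [simp]: "ghom (cj g)"
  by (simp add: ghom_def cj_add)

lemma bij_cj [simp]: "bij (cj (g::free2))"
  by (rule o_bij[of "cj (- g)"]) (simp_all add: fun_eq_iff)

section \<open>Cyclically reduced words, commuting elements and centralizers\<close>

lemma len_append_less:
  assumes "reduced p" "reduced q" "\<not> reduced (p @ q)"
  shows "len (ev (p @ q)) < length p + length q"
proof -
  have "p \<noteq> []" "q \<noteq> []" "hd q = inv_letter (last p)"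
    using assms by (auto simp: reduced_append)
  then obtain p' l q' where "p = p' @ [l]" "q = inv_letter l # q'"
    by (metis append_butlast_last_id list.collapse)
  then have "ev (p @ q) = ev (p' @ q')" "length (p' @ q') < length p + length q"
    by (simp_all add: add.assoc)
  then show ?thesis
    using len_ev_le[of "p' @ q'"] by simp
qed

text \<open>The common value of the two products has length \<open>length p + length q\<close>, so
  \<open>q @ p\<close> loses no letters either; both lists are then reduced words of one
  element.\<close>

lemma comm_words:
  assumes "reduced p" "reduced q" "comm (ev p) (ev q)" "reduced (p @ q)"
  shows "p @ q = q @ p"
proof -
  have eq: "ev (p @ q) = ev (q @ p)"
    using assms(3) by (simp add: comm_def)
  moreover have "reduced (q @ p)"
    using len_append_less[OF assms(2,1)] len_ev_reduced[OF assms(4)] eq by fastforce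
  ultimately show ?thesis
    using assms(4) ev_inject by blast
qed

text \<open>Cyclic reducedness: nothing cancels between consecutive copies of \<open>u\<close>, so
  all powers of \<open>u\<close> are reduced as written.\<close>

definition cred :: "letter list \<Rightarrow> bool" where
  "cred u \<longleftrightarrow> reduced (u @ u)"

lemma cred_reduced: "cred u \<Longrightarrow> reduced u"
  by (simp add: cred_def reduced_append)

lemma cred_Nil [simp]: "cred []"
  by (simp add: cred_def)

lemma cred_iff: "cred u \<longleftrightarrow> reduced u \<and> (u = [] \<or> hd u \<noteq> inv_letter (last u))"
  by (auto simp: cred_def reduced_append)

lemma reduced_concat_replicate: "cred u \<Longrightarrow> reduced (concat (replicate n u))"
proof (induction n)
  case (Suc n)
  then show ?case
    by (cases n) (auto simp: cred_def reduced_append hd_append)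
qed simp

text \<open>Strip matching outer letters until the core is cyclically reduced. The length equation
  says that nothing cancels in g u g^-1; it later bounds the length of conjugators.\<close>

lemma cyclic_decomp:
  "\<exists>g u. x = cj g (ev u) \<and> cred u \<and> len x = 2 * len g + length u"
proof (induction "len x" arbitrary: x rule: less_induct)
  case less
  define w where "w = rw x"
  have x: "x = ev w" and w: "reduced w" and lx: "len x = length w"
    by (simp_all add: w_def len_def)
  show ?case
  proof (cases "cred w")
    case True
    then show ?thesis using x lx by (intro exI[of _ 0] exI[of _ w]) simp
  next
    case False
    then have w1: "w \<noteq> []" "hd w = inv_letter (last w)"
      using w by (auto simp: cred_iff)
    obtain l w1 where wl: "w = w1 @ [l]"
      using w1(1) by (metis append_butlast_last_id)
    with w1 have "w1 \<noteq> []" by auto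
    then obtain w2 where "w1 = inv_letter l # w2"
      using w1(2) wl by (cases w1) auto
    with wl have w2: "w = inv_letter l # w2 @ [l]" by simp
    then have "reduced w2"
      using w by (auto simp: reduced_append reduced_Cons)
    then have l2: "len (ev w2) = length w2" by (rule len_ev_reduced)
    then obtain g u where gu: "ev w2 = cj g (ev u)" "cred u" "length w2 = 2 * len g + length u"
      using less[of "ev w2"] w2 lx by auto
    have x': "x = cj (lt (inv_letter l) + g) (ev u)"
      unfolding x w2 cj_simps(3)[symmetric] gu(1)[symmetric] by (simp add: cj_def add.assoc)
    \<comment> \<open>Subadditivity gives one inequality. The new conjugator is at most one letter
      longer than \<open>g\<close>, so counting the letters of \<open>w\<close> gives the
      other.\<close>
    have "len x \<le> 2 * len (lt (inv_letter l) + g) + length u"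
      unfolding x' cj_def
      using len_add_le[of "lt (inv_letter l) + g + ev u" "- (lt (inv_letter l) + g)"]
        len_add_le[of "lt (inv_letter l) + g" "ev u"] len_ev_le[of u] by simp
    moreover have "len (lt (inv_letter l) + g) \<le> Suc (len g)"
      using len_add_le[of "lt (inv_letter l)" g] len_lt[of "inv_letter l"] by (simp del: lt_inv_letter)
    ultimately have "len x = 2 * len (lt (inv_letter l) + g) + length u"
      using lx w2 gu(3) by simp
    then show ?thesis using x' gu(2) by blast
  qed
qed

lemma torsion_free:
  assumes "n > 0" "nsc n x = 0"
  shows "x = (0::free2)"
proof -
  obtain g u where x: "x = cj g (ev u)" "cred u"
    using cyclic_decomp by blast
  then have "ev (concat (replicate n u)) = 0"
    using assms(2) by (simp add: ev_concat_replicate flip: cj_nsc)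
  then have "concat (replicate n u) = []"
    by (metis reduced_concat_replicate rw_0 rw_ev_reduced x(2))
  then show ?thesis
    using assms(1) x(1) by simp
qed

text \<open>If \<open>X\<close> cancels against \<open>u\<close>, then \<open>inv_word X\<close>
  starts with \<open>hd u\<close>, which does not cancel against \<open>last u\<close> since
  \<open>u\<close> is cyclically reduced. So \<open>X\<close> or its inverse yields a reduced
  concatenation, to which \<open>comm_words\<close> applies.\<close>

lemma comm_cred:
  assumes u: "cred u" "u \<noteq> []" and c: "comm x (ev u)"
  shows "\<exists>X. X @ u = u @ X \<and> (x = ev X \<or> x = - ev X)"
proof -
  define X where "X = rw x"
  have X: "reduced X" "x = ev X" by (simp_all add: X_def)
  have ru: "reduced u" using u(1) by (rule cred_reduced)
  show ?thesis
  proof (cases "reduced (X @ u)")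
    case True
    then show ?thesis
      using comm_words[OF X(1) ru] c X(2) by blast
  next
    case False
    then have "X \<noteq> []" "hd u = inv_letter (last X)"
      using X(1) ru by (auto simp: reduced_append)
    then have "reduced (u @ inv_word X)"
      using u X(1) ru by (auto simp: reduced_append hd_inv_word cred_iff)
    moreover have "comm (ev u) (ev (inv_word X))"
      using c X(2) by (simp add: comm_sym)
    ultimately have "u @ inv_word X = inv_word X @ u"
      using comm_words[OF ru, of "inv_word X"] X(1) by simp
    then show ?thesis
      using X(2) by (intro exI[of _ "inv_word X"]) simp
  qed
qed

text \<open>Both \<open>x @ y\<close> and \<open>y @ x\<close> are prefixes, of equal length, of a
  high power of \<open>u\<close>.\<close>

lemma append_commute_trans:
  assumes "x @ u = u @ x" "y @ u = u @ y" "u \<noteq> []"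
  shows "x @ y = y @ x"
proof -
  have pw: "z @ concat (replicate n u) = concat (replicate n u) @ z" if "z @ u = u @ z" for z n
    using that by (induction n) (simp, metis append.assoc concat.simps(2) replicate_Suc)
  define U where "U = concat (replicate (length (x @ y)) u)"
  have "length (x @ y) \<le> length U"
    using assms(3) by (cases u) (simp_all add: U_def length_concat sum_list_replicate)
  moreover have "x @ y @ U = U @ x @ y" "y @ x @ U = U @ y @ x"
    using pw[OF assms(1), of "length (x @ y)"] pw[OF assms(2), of "length (x @ y)"]
    unfolding U_def[symmetric] by (metis append.assoc)+
  then have "take (length (x @ y)) (x @ y @ U) = take (length (x @ y)) (U @ x @ y)"
    "take (length (x @ y)) (y @ x @ U) = take (length (x @ y)) (U @ y @ x)"
    by presburger+
  ultimately have "x @ y = take (length (x @ y)) U" and "y @ x = take (length (x @ y)) U"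
    by (simp_all add: add.commute min.absorb2)
  then show ?thesis by metis
qed

text \<open>Centralizers of nontrivial elements are abelian. Conjugating \<open>u\<close> to a
  cyclically reduced word turns commutation in the group into commutation of lists. Nearly every
  commutation result below ends here.\<close>

theorem comm_trans:
  assumes "comm x u" "comm y u" "u \<noteq> (0::free2)"
  shows "comm x y"
proof -
  obtain g v where u: "u = cj g (ev v)" "cred v"
    using cyclic_decomp by blast
  have v: "v \<noteq> []" using u(1) assms(3) by auto
  have "comm (cj (- g) x) (ev v)" "comm (cj (- g) y) (ev v)"
    using assms(1,2) u(1) by (metis add.left_inverse cj_simps(1,3) comm_cj_iff)+
  then obtain X Y where XY: "X @ v = v @ X" "cj (- g) x = ev X \<or> cj (- g) x = - ev X"
    "Y @ v = v @ Y" "cj (- g) y = ev Y \<or> cj (- g) y = - ev Y"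
    using comm_cred[OF u(2) v] by metis
  then have "X @ Y = Y @ X"
    using append_commute_trans v by blast
  then have "comm (ev X) (ev Y)"
    by (metis comm_def ev_simps(3))
  then have "comm (cj (- g) x) (cj (- g) y)"
    using XY by (auto simp del: comm_cj_iff)
  then show ?thesis by simp
qed

lemma comm_common_power:
  assumes "comm x u" "u \<noteq> (0::free2)"
  shows "\<exists>m>0. \<exists>n. nsc m x = nsc n u \<or> nsc m x = - nsc n u"
proof -
  obtain g v where u: "u = cj g (ev v)" "cred v"
    using cyclic_decomp by blast
  have v: "v \<noteq> []" using u(1) assms(2) by auto
  define y where "y = cj (- g) x"
  have x: "x = cj g y" by (simp add: y_def)
  have "comm y (ev v)"
    using assms(1) u(1) x by simp
  then obtain X where X: "X @ v = v @ X" "y = ev X \<or> y = - ev X"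
    using comm_cred[OF u(2) v] by metis
  obtain m n zs where z: "concat (replicate m zs) = X" "concat (replicate n zs) = v"
    using comm_append_are_replicate[OF X(1)] by blast
  have "n > 0" using z(2) v by (cases n) auto
  have "nsc n (ev X) = nsc m (ev v)"
    using z by (metis ev_concat_replicate nsc_nsc)
  then have "nsc n y = nsc m (ev v) \<or> nsc n y = - nsc m (ev v)"
    using X(2) by (auto simp: nsc_minus)
  then have "nsc n x = nsc m u \<or> nsc n x = - nsc m u"
    unfolding x u(1) by (metis cj_nsc cj_simps(4))
  then show ?thesis using \<open>n > 0\<close> by blast
qed

text \<open>\<open>f x\<close> and \<open>x\<close> both centralize \<open>u\<close>, so they
  commute with each other; some positive powers of them agree, so their difference is torsion and
  vanishes.\<close>

lemma fixes_centralizer: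
  assumes f: "ghom f" "f u = u" "u \<noteq> 0" and c: "comm x u"
  shows "f x = x"
proof -
  obtain m n where m: "m > 0" "nsc m x = nsc n u \<or> nsc m x = - nsc n u"
    using comm_common_power[OF c f(3)] by blast
  have "nsc m (f x) = f (nsc m x)"
    by (simp add: ghom_nsc f(1))
  also have "\<dots> = nsc m x"
    using m(2) f by (metis ghom_minus ghom_nsc)
  finally have e: "nsc m (f x) = nsc m x" .
  have "comm (f x) u"
    using c f by (metis comm_def ghom_add)
  then have "comm (f x) (- x)"
    using comm_trans[OF _ c f(3)] by simp
  then have "nsc m (f x + - x) = 0"
    by (simp add: nsc_add_comm e nsc_minus)
  then have "f x + - x = 0"
    using m(1) torsion_free by blast
  then show ?thesis by (simp add: eq_neg_iff_add_eq_0[symmetric])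
qed

lemma fixes_root:
  assumes "ghom f" "n > 0" "f (nsc n x) = nsc n x"
  shows "f x = x"
proof (cases "nsc n x = 0")
  case True
  then have "x = 0" using torsion_free assms(2) by blast
  then show ?thesis using assms(1) by (simp add: ghom_0)
next
  case False
  then show ?thesis
    using fixes_centralizer[OF assms(1,3) False, of x] comm_sym[OF comm_nsc[of x x n]] by simp
qed

section \<open>Automorphisms and Nielsen reduction\<close>

definition aut :: "(free2 \<Rightarrow> free2) \<Rightarrow> bool" where
  "aut f \<longleftrightarrow> ghom f \<and> bij f"

lemma aut_iff: "f \<in> auto F2 \<longleftrightarrow> aut f"
  by (simp add: auto_iff aut_def)

lemma aut_ghom: "aut f \<Longrightarrow> ghom f"
  by (simp add: aut_def)

lemma aut_comp: "aut f \<Longrightarrow> aut g \<Longrightarrow> aut (f \<circ> g)"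
  by (simp add: aut_def ghom_comp bij_comp)

lemma aut_id [simp]: "aut id"
  by (simp add: aut_def)

lemma aut_cj [simp]: "aut (cj w)"
  by (simp add: aut_def)

lemma aut_inject: "aut f \<Longrightarrow> f x = f y \<longleftrightarrow> x = y"
  by (meson aut_def bij_is_inj inj_eq)

lemma aut_0_iff: "aut f \<Longrightarrow> f x = 0 \<longleftrightarrow> x = 0"
  by (metis aut_def aut_inject ghom_0)

lemma aut_inverse:
  assumes "aut f"
  obtains g where "aut g" "f \<circ> g = id" "g \<circ> f = id"
proof
  let ?g = "inv_into UNIV f"
  have b: "bij f" and h: "ghom f" using assms by (auto simp: aut_def)
  show fg: "f \<circ> ?g = id" "?g \<circ> f = id"
    using b by (simp_all add: bij_is_inj bij_is_surj surj_iff[symmetric])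
  have "?g (x + y) = ?g x + ?g y" for x y
  proof -
    have "f (?g x + ?g y) = x + y"
      using h b by (simp add: ghom_add bij_is_surj surj_f_inv_f)
    then show ?thesis
      using b by (metis bij_inv_eq_iff)
  qed
  then show "aut ?g"
    using b by (simp add: aut_def ghom_def bij_imp_bij_inv)
qed

lemma autI: "ghom f \<Longrightarrow> ghom g \<Longrightarrow> f \<circ> g = id \<Longrightarrow> g \<circ> f = id \<Longrightarrow> aut f"
  by (auto simp: aut_def intro: o_bij)

lemma ghom_comp_cj: "ghom f \<Longrightarrow> f \<circ> cj w = cj (f w) \<circ> f"
  by (simp add: fun_eq_iff ghom_cj_map)

subsection \<open>Equality up to inner automorphisms\<close>

definition oeq :: "(free2 \<Rightarrow> free2) \<Rightarrow> (free2 \<Rightarrow> free2) \<Rightarrow> bool" (infix "\<approx>" 50) where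
  "f \<approx> g \<longleftrightarrow> (\<exists>w. f = cj w \<circ> g)"

lemma oeqI: "f = cj w \<circ> g \<Longrightarrow> f \<approx> g"
  by (auto simp: oeq_def)

lemma oeq_refl [simp]: "f \<approx> f"
  by (rule oeqI[of _ 0]) (simp add: fun_eq_iff)

lemma oeq_sym:
  assumes "f \<approx> g"
  shows "g \<approx> f"
proof -
  obtain w where "f = cj w \<circ> g" using assms by (auto simp: oeq_def)
  then have "g = cj (- w) \<circ> f" by (simp add: fun_eq_iff)
  then show ?thesis by (rule oeqI)
qed

lemma oeq_trans [trans]:
  assumes "f \<approx> g" "g \<approx> h"
  shows "f \<approx> h"
proof -
  obtain v w where "f = cj v \<circ> g" "g = cj w \<circ> h" using assms by (auto simp: oeq_def)
  then have "f = cj (v + w) \<circ> h" by (simp add: fun_eq_iff)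
  then show ?thesis by (rule oeqI)
qed

lemma oeq_comp:
  assumes "f \<approx> f'" "g \<approx> g'" "ghom f'"
  shows "f \<circ> g \<approx> f' \<circ> g'"
proof -
  obtain v w where "f = cj v \<circ> f'" "g = cj w \<circ> g'"
    using assms by (auto simp: oeq_def)
  then have "f \<circ> g = cj (v + f' w) \<circ> (f' \<circ> g')"
    using assms(3) by (simp add: fun_eq_iff ghom_cj_map)
  then show ?thesis by (rule oeqI)
qed

lemma oeq_endoI:
  assumes "ghom f" "ghom g" "f gen_a = cj w (g gen_a)" "f gen_b = cj w (g gen_b)"
  shows "f \<approx> g"
  by (rule oeqI[of _ w], rule ghom_eqI) (use assms in \<open>auto simp: ghom_comp\<close>)

lemma aut_oeq: "f \<approx> g \<Longrightarrow> aut g \<Longrightarrow> aut f"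
  by (auto simp: oeq_def aut_comp)

subsection \<open>Nielsen reduction\<close>

text \<open>Neither move $y \mapsto y z^{\pm 1}$ shortens the pair $(y, z)$, even after a simultaneous conjugation.\<close>

definition mv :: "free2 \<Rightarrow> free2 \<Rightarrow> bool" where
  "mv z y \<longleftrightarrow> (\<forall>q. len z + len y \<le> len (cj q z) + len (cj q (y + z))
     \<and> len z + len y \<le> len (cj q z) + len (cj q (y + - z)))"

lemma mv_minus1 [simp]: "mv (- z) y \<longleftrightarrow> mv z y"
  by (auto simp: mv_def)

text \<open>Up to inversion \<open>- y + z\<close> is the conjugate of \<open>y + - z\<close> by
  \<open>- z\<close>, and shifting the base point \<open>q\<close> by \<open>z\<close> or
  \<open>- z\<close> leaves \<open>cj q z\<close> unchanged. So the two moves are merely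
  exchanged.\<close>

lemma mv_minus2_imp: "mv z y \<Longrightarrow> mv z (- y)"
proof -
  assume mv: "mv z y"
  have 1: "len (cj q (- y + z)) = len (cj (q + - z) (y + - z))" for q
  proof -
    have "cj q (- y + z) = - cj (q + - z) (y + - z)"
      by (simp add: cj_def grp)
    then show ?thesis by simp
  qed
  have 2: "len (cj q (- y + - z)) = len (cj (q + z) (y + z))" for q
  proof -
    have "cj q (- y + - z) = - cj (q + z) (y + z)"
      by (simp add: cj_def grp)
    then show ?thesis by simp
  qed
  have 3: "cj (q + z) z = cj q z" "cj (q + - z) z = cj q z" for q
    by (simp_all add: cj_def grp)
  show "mv z (- y)"
    unfolding mv_def 1 2 using mv unfolding mv_def by (metis 3 len_minus)
qed

lemma mv_minus2 [simp]: "mv z (- y) \<longleftrightarrow> mv z y"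
  using mv_minus2_imp[of z y] mv_minus2_imp[of z "- y"] by auto

lemma len_add_gp: "len (x + y) + 2 * gp (- x) y = len x + len y"
  using len_gp[of "- x" y] by simp

text \<open>The base points 0 and \<open>z\<close> in \<open>mv\<close> say that adding
  \<open>z\<close> to \<open>y\<close> on the right or on the left does not shorten
  \<open>y\<close>, so at most half of \<open>z\<close> cancels.\<close>

lemma mv_gp:
  assumes "mv z y"
  shows "2 * gp (- y) z \<le> len z" "2 * gp (- z) y \<le> len z"
proof -
  have "len y \<le> len (y + z)"
    using assms[unfolded mv_def, rule_format, of 0] by simp
  moreover have "cj z (y + z) = z + y" by (simp add: cj_def grp)
  then have "len y \<le> len (z + y)"
    using assms[unfolded mv_def, rule_format, of z] by simp
  ultimately show "2 * gp (- y) z \<le> len z" "2 * gp (- z) y \<le> len z"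
    using len_add_gp[of y z] len_add_gp[of z y] by simp_all
qed

lemma lcp_nth: "i < length (lcp u v) \<Longrightarrow> u ! i = v ! i"
  by (induction u v arbitrary: i rule: lcp.induct) (auto simp: nth_Cons split: nat.splits if_splits)

text \<open>An overlap of half the length would make the middle letter its own inverse, or make the
  two middle letters cancel.\<close>

lemma gp_minus_self:
  assumes "x \<noteq> 0"
  shows "2 * gp (- x) x < len x"
proof (rule ccontr)
  assume "\<not> ?thesis"
  then have k: "len x \<le> 2 * gp (- x) x" by simp
  let ?w = "rw x"
  have n: "length ?w = len x" "length ?w > 0"
    using assms len_eq_0[of x] by (simp_all add: len_def)
  have eq: "inv_letter (?w ! (len x - 1 - i)) = ?w ! i" if "2 * i < len x" for i
  proof -
    have "i < gp (- x) x" using that k by simp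
    then have "inv_word ?w ! i = ?w ! i"
      unfolding gp_def rw_minus by (rule lcp_nth)
    then show ?thesis
      using that n by (simp add: inv_word_def rev_nth)
  qed
  show False
  proof (cases "even (len x)")
    case True
    then obtain m where m: "len x = 2 * Suc m"
      using n by (metis evenE gr0_implies_Suc mult_0_right neq0_conv)
    then have "inv_letter (?w ! Suc m) = ?w ! m"
      using eq[of m] by simp
    moreover have "?w ! Suc m \<noteq> inv_letter (?w ! m)"
      using reduced_rw[of x] n m unfolding reduced_def successively_conv_nth by auto
    ultimately show False by (metis inv_letter_inv_letter)
  next
    case False
    then obtain m where "len x = 2 * m + 1" by (metis oddE)
    then show False using eq[of m] by simp
  qed
qed

text \<open>In a tie both halves of \<open>z\<close> cancel against \<open>y\<close>:
  multiplicatively y = q m r and z = r^-1 q^-1 with \<open>q\<close> and \<open>r\<close> of length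
  \<open>k\<close>. Conjugating by \<open>- q\<close> turns y z into m and does not lengthen
  \<open>z\<close>, so the pair gets shorter. This is why \<open>mv\<close> allows a simultaneous
  conjugation; no ordering of words is needed to break ties.\<close>

lemma mv_no_tie:
  assumes mv: "mv z y" and z: "z \<noteq> 0" and le: "len z \<le> len y"
    and t: "2 * gp (- y) z = len z" "2 * gp (- z) y = len z"
  shows False
proof -
  define k where "k = gp (- z) y"
  have lz: "len z = 2 * k" using t by (simp add: k_def)
  obtain q where q: "len q = k" "gp q (- z) = k"
    using prefix_exists[of k "- z"] lz by auto
  have zq: "len (z + q) = k"
    using len_add_gp[of z q] q lz by (simp add: gp_commute)
  have "k \<le> gp q y"
    using gp_ultra[of q "- z" y] q by (simp add: k_def)
  then have qy: "gp q y = k" using gp_le(1)[of q y] q by simp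
  have y1: "len (- q + y) + k = len y"
    using len_gp[of q y] q qy by simp
  have "len (- q + y + - y) = k" using q by (simp add: add.assoc)
  then have a: "gp (- (- q + y)) (- y) + k = len y"
    using len_add_gp[of "- q + y" "- y"] y1 lz le by simp
  have "len (- z + (z + q)) = k" using q by simp
  then have b: "gp z (z + q) = k"
    using len_gp[of z "z + q"] zq lz by simp
  have c: "gp (- y) z = k" using t lz by simp
  have "k \<le> gp (- y) (z + q)"
    using gp_ultra[of "- y" z "z + q"] b c by simp
  then have d: "k \<le> gp (- (- q + y)) (z + q)"
    using gp_ultra[of "- (- q + y)" "- y" "z + q"] a le lz by simp
  have "len (- q + y + (z + q)) + 2 * k \<le> len (- q + y) + k"
    using len_add_gp[of "- q + y" "z + q"] d zq by simp
  moreover have "cj (- q) (y + z) = - q + y + (z + q)"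
    by (simp add: cj_def add.assoc)
  ultimately have "len (cj (- q) (y + z)) + 2 * k \<le> len y"
    using y1 by simp
  moreover have "len (cj (- q) z) \<le> len z"
    using len_add_le[of "- q" "z + q"] q zq lz by (simp add: cj_def add.assoc)
  moreover have "len z + len y \<le> len (cj (- q) z) + len (cj (- q) (y + z))"
    using mv by (simp add: mv_def)
  ultimately have "k = 0" by simp
  then show False using z lz by simp
qed

text \<open>Nielsen's argument: in the image of a reduced word every factor keeps at least one
  letter uncancelled.\<close>

lemma mv_growth:
  assumes f: "ghom f" and mv: "mv (f gen_a) (f gen_b)" "mv (f gen_b) (f gen_a)"
    and nz: "f gen_a \<noteq> 0" "f gen_b \<noteq> 0"
  shows "len x \<le> len (f x)"
proof -
  define g where "g l = f (lt l)" for l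
  have ginv: "g (inv_letter l) = - g l" for l
    using f by (simp add: g_def ghom_simps)
  have gnz: "g l \<noteq> 0" for l
    using nz f by (cases l; cases "fst l") (auto simp: g_def lt_gen ghom_simps)
  have gpos: "0 < len (g l)" for l
    by (metis gnz len_eq_0 gr0I)
  have mvg: "mv (g l) (g m)" if "fst l \<noteq> fst m" for l m
    using that mv f
    by (cases l; cases m; cases "fst l"; cases "fst m") (auto simp: g_def lt_gen ghom_simps)
  \<comment> \<open>The amount of cancellation in \<open>g l + g m\<close>.\<close>
  define \<kappa> where "\<kappa> l m = gp (- g l) (g m)" for l m
  have same: "m = l" if "fst l = fst m" "m \<noteq> inv_letter l" for l m
    using that by (auto simp: inv_letter_def prod_eq_iff)
  have strict: "2 * \<kappa> l l < len (g l)" for l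
    unfolding \<kappa>_def using gp_minus_self gnz by blast
  have k1: "2 * \<kappa> l m \<le> len (g l) \<and> 2 * \<kappa> l m \<le> len (g m)" if "m \<noteq> inv_letter l" for l m
  proof (cases "fst l = fst m")
    case True
    then show ?thesis using strict[of l] same that by fastforce
  next
    case False
    then show ?thesis
      using mv_gp[OF mvg[of l m]] mv_gp[OF mvg[of m l]] unfolding \<kappa>_def by simp
  qed
  \<comment> \<open>No factor is consumed entirely from both sides. By \<open>k1\<close> this would
    need a tie at exactly half of \<open>g m\<close> on each side. If \<open>p\<close> is inverse to
    \<open>l\<close>, the tree inequality makes \<open>g m\<close> overlap its own inverse by half;
    otherwise \<open>p = l\<close> and \<open>mv_no_tie\<close> applies.\<close>
  have k2: "\<kappa> l m + \<kappa> m p < len (g m)" if lm: "m \<noteq> inv_letter l" and mp: "p \<noteq> inv_letter m" for l m p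
  proof (rule ccontr)
    assume "\<not> ?thesis"
    then have e: "2 * \<kappa> l m = len (g m)" "2 * \<kappa> m p = len (g m)"
      using k1[OF lm] k1[OF mp] by linarith+
    have ne: "fst l \<noteq> fst m" "fst m \<noteq> fst p"
      using e same[OF _ lm] same[OF _ mp] strict[of l] strict[of m] by (metis less_irrefl)+
    show False
    proof (cases "p = inv_letter l")
      case True
      have "min (gp (- g m) (- g l)) (gp (- g l) (g m)) \<le> gp (- g m) (g m)"
        by (rule gp_ultra)
      then have "len (g m) \<le> 2 * gp (- g m) (g m)"
        using e by (simp add: \<kappa>_def True ginv)
      then show False using strict[of m] by (simp add: \<kappa>_def)
    next
      case False
      have "fst l = fst p" using ne by (metis (full_types) gen.exhaust)
      then have "p = l" using False same by metis
      moreover have "len (g m) \<le> len (g l)" using k1[OF lm] e by simp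
      ultimately show False
        using mv_no_tie[OF mvg[of m l]] ne e gnz by (simp add: \<kappa>_def)
    qed
  qed
  \<comment> \<open>Invariant: the image still ends in all of \<open>g l\<close> except what the
    preceding factor cancelled, and its length pays one letter for each letter read, besides the
    cancellation with any admissible next letter \<open>m\<close>.\<close>
  have main: "gp (- f (ev (w @ [l]))) (- g l) + (if w = [] then 0 else \<kappa> (last w) l) = len (g l)
    \<and> (\<forall>m. m \<noteq> inv_letter l \<longrightarrow> Suc (length w) + \<kappa> l m \<le> len (f (ev (w @ [l]))))"
    if "reduced (w @ [l])" for w l
    using that
  proof (induction w arbitrary: l rule: rev_induct)
    case Nil
    have "gp (- g l) (- g l) = len (g l)"
      using len_gp[of "- g l" "- g l"] by simp
    moreover have "Suc (\<kappa> l m) \<le> len (g l)" if "m \<noteq> inv_letter l" for m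
      using k1[OF that] gpos[of l] by linarith
    ultimately show ?case by (auto simp: g_def)
  next
    case (snoc k w)
    have red: "reduced (w @ [k])" "l \<noteq> inv_letter k"
      using snoc.prems reduced_append[of "w @ [k]" "[l]"] by auto
    define U where "U = f (ev (w @ [k]))"
    define V where "V = f (ev ((w @ [k]) @ [l]))"
    have V: "V = U + g l" using f by (simp add: U_def V_def g_def ghom_simps add.assoc)
    have IH1: "gp (- U) (- g k) + (if w = [] then 0 else \<kappa> (last w) k) = len (g k)"
      and IH2: "Suc (length w) + \<kappa> k l \<le> len U"
      using conjunct1[OF snoc.IH[OF red(1)]] conjunct2[OF snoc.IH[OF red(1)], rule_format, OF red(2)]
      unfolding U_def by blast+
    have "\<kappa> k l < gp (- U) (- g k)"
    proof (cases "w = []")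
      case True
      then show ?thesis using IH1 k1[OF red(2)] gpos[of k] by simp
    next
      case False
      then have "k \<noteq> inv_letter (last w)" using red(1) by (auto simp: reduced_append)
      then show ?thesis using IH1 k2[OF _ red(2)] False by fastforce
    qed
    then have "gp (- U) (g l) = \<kappa> k l"
      using gp_ultra[of "- U" "- g k" "g l"] gp_ultra[of "- g k" "- U" "g l"]
      by (simp add: \<kappa>_def gp_commute)
    then have LV: "len V + 2 * \<kappa> k l = len U + len (g l)"
      using len_add_gp[of U "g l"] V by simp
    have "V + - g l = U" by (simp add: V add.assoc)
    then have "gp (- V) (- g l) + \<kappa> k l = len (g l)"
      using len_add_gp[of V "- g l"] LV by simp
    moreover have "Suc (length (w @ [k])) + \<kappa> l m \<le> len V" if "m \<noteq> inv_letter l" for m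
      using k2[OF red(2) that] LV IH2 by simp
    ultimately show ?case by (simp add: V_def)
  qed
  show ?thesis
  proof (cases "rw x" rule: rev_cases)
    case Nil
    then show ?thesis by (simp add: len_def)
  next
    case (snoc w l)
    then have "reduced (w @ [l])" "x = ev (w @ [l])"
      by (metis reduced_rw, metis ev_rw)
    then show ?thesis
      using main[of w l] snoc by (fastforce simp: len_def dest: spec[of _ l])
  qed
qed

definition letter_auto :: "(free2 \<Rightarrow> free2) \<Rightarrow> bool" where
  "letter_auto f \<longleftrightarrow> aut f \<and> (\<forall>l. \<exists>m. f (lt l) = lt m)"

definition sigma_inv :: "free2 \<Rightarrow> free2" where
  "sigma_inv = endo (gen_a + - gen_b) gen_b"

definition tau_inv :: "free2 \<Rightarrow> free2" where
  "tau_inv = endo gen_a (gen_b + - gen_a)"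

lemma twist_gens [simp]:
  "sigma gen_a = gen_a + gen_b" "sigma gen_b = gen_b"
  "sigma_inv gen_a = gen_a + - gen_b" "sigma_inv gen_b = gen_b"
  "tau gen_a = gen_a" "tau gen_b = gen_b + gen_a"
  "tau_inv gen_a = gen_a" "tau_inv gen_b = gen_b + - gen_a"
  by (simp_all add: sigma_def sigma_inv_def tau_def tau_inv_def)

lemma endo_plus [simp]: "endo x y (u + v) = endo x y u + endo x y v" "endo x y (- u) = - endo x y u"
  "endo x y 0 = 0"
  by (simp_all add: ghom_simps)

lemma twist_inverses [simp]:
  "sigma \<circ> sigma_inv = id" "sigma_inv \<circ> sigma = id" "tau \<circ> tau_inv = id" "tau_inv \<circ> tau = id"
  by (rule ghom_eqI; simp add: ghom_comp sigma_def sigma_inv_def tau_def tau_inv_def grp)+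

lemma ghom_twists [simp]: "ghom sigma" "ghom sigma_inv" "ghom tau" "ghom tau_inv"
  by (simp_all add: sigma_def sigma_inv_def tau_def tau_inv_def)

lemma aut_twists [simp]: "aut sigma" "aut sigma_inv" "aut tau" "aut tau_inv"
  using autI[OF _ _ twist_inverses(1,2)] autI[OF _ _ twist_inverses(2,1)]
    autI[OF _ _ twist_inverses(3,4)] autI[OF _ _ twist_inverses(4,3)] by simp_all

inductive_set nielsen :: "(free2 \<Rightarrow> free2) set" where
  base: "letter_auto f \<Longrightarrow> f \<in> nielsen"
| step: "f \<in> nielsen \<Longrightarrow> g \<in> {sigma, sigma_inv, tau, tau_inv} \<Longrightarrow> f \<circ> g \<in> nielsen"

text \<open>By \<open>mv_growth\<close> the preimage of a letter is a letter; this injection of the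
  finite set of letters into itself is onto.\<close>

lemma minimal_letter_auto:
  assumes f: "aut f" and mv: "mv (f gen_a) (f gen_b)" "mv (f gen_b) (f gen_a)"
  shows "letter_auto f"
proof -
  have nz: "f gen_a \<noteq> 0" "f gen_b \<noteq> 0"
    using f by (simp_all add: aut_0_iff gen_lt)
  have "\<exists>m. f (lt m) = lt l" for l
  proof -
    obtain x where x: "f x = lt l"
      using f by (metis aut_def bij_pointE)
    then have "len x \<le> 1"
      using mv_growth[OF aut_ghom[OF f] mv nz, of x] by simp
    moreover have "x \<noteq> 0" using x f by (auto simp: aut_def ghom_0)
    then have "len x \<noteq> 0" by simp
    ultimately have "len x = 1" by linarith
    then obtain m where "rw x = [m]"
      by (auto simp: len_def length_Suc_conv)
    then have "x = lt m" by (metis add.right_neutral ev_rw ev_simps(1,2))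
    then show ?thesis using x by blast
  qed
  then obtain h where h: "f (lt (h l)) = lt l" for l by metis
  have "inj h" by (rule injI) (metis h lt_inject)
  moreover have "finite (UNIV :: letter set)"
  proof -
    have "(UNIV :: letter set) = {Gen_A, Gen_B} \<times> UNIV"
      by (auto intro: gen.exhaust)
    then show ?thesis by (metis finite.emptyI finite.insertI finite_cartesian_product finite_code)
  qed
  ultimately have "surj h"
    by (simp add: finite_UNIV_inj_surj)
  then show ?thesis
    unfolding letter_auto_def using f h by (metis surjD)
qed

text \<open>Descent on the total length of the images of the basis: a violated \<open>mv\<close>
  names a twist and a base point \<open>q\<close> that shorten the pair, and conjugating by
  \<open>q\<close> stays in the outer class.\<close>

theorem nielsen_generation:
  assumes "aut f"
  shows "\<exists>g \<in> nielsen. f \<approx> g"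
  using assms
proof (induction "len (f gen_a) + len (f gen_b)" arbitrary: f rule: less_induct)
  case less
  have f: "ghom f" using less.prems by (rule aut_ghom)
  have reduce: "\<exists>g \<in> nielsen. f \<approx> g"
    if lt: "len (cj q (f (\<nu> gen_a))) + len (cj q (f (\<nu> gen_b))) < len (f gen_a) + len (f gen_b)"
      and \<nu>: "\<nu> \<circ> \<mu> = id" "aut \<nu>" "\<mu> \<in> {sigma, sigma_inv, tau, tau_inv}" for q \<nu> \<mu>
  proof -
    have "aut (cj q \<circ> f \<circ> \<nu>)" using less.prems \<nu>(2) by (simp add: aut_comp)
    then obtain g where g: "g \<in> nielsen" "cj q \<circ> f \<circ> \<nu> \<approx> g"
      using less.hyps[of "cj q \<circ> f \<circ> \<nu>"] lt by auto
    then obtain w where w: "cj q \<circ> f \<circ> \<nu> = cj w \<circ> g" by (auto simp: oeq_def)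
    have "f = cj (- q) \<circ> (cj q \<circ> f \<circ> (\<nu> \<circ> \<mu>))" by (simp add: \<nu>(1) fun_eq_iff)
    also have "\<dots> = cj (- q) \<circ> (cj q \<circ> f \<circ> \<nu>) \<circ> \<mu>" by (simp add: comp_assoc)
    also have "\<dots> = cj (- q + w) \<circ> (g \<circ> \<mu>)" unfolding w by (simp add: fun_eq_iff)
    finally have "f \<approx> g \<circ> \<mu>" by (rule oeqI)
    then show ?thesis using g(1) \<nu>(3) nielsen.step by blast
  qed
  show ?case
  proof (cases "mv (f gen_a) (f gen_b) \<and> mv (f gen_b) (f gen_a)")
    case True
    then show ?thesis
      using minimal_letter_auto[OF less.prems] nielsen.base oeq_refl by blast
  next
    case False
    then consider q where "len (cj q (f gen_a)) + len (cj q (f gen_b + f gen_a)) < len (f gen_a) + len (f gen_b)"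
      | q where "len (cj q (f gen_a)) + len (cj q (f gen_b + - f gen_a)) < len (f gen_a) + len (f gen_b)"
      | q where "len (cj q (f gen_b)) + len (cj q (f gen_a + f gen_b)) < len (f gen_a) + len (f gen_b)"
      | q where "len (cj q (f gen_b)) + len (cj q (f gen_a + - f gen_b)) < len (f gen_a) + len (f gen_b)"
      unfolding mv_def not_le[symmetric] by (metis add.commute)
    then show ?thesis
    proof cases
      case 1
      then show ?thesis using reduce[of q tau tau_inv] f by (simp add: ghom_simps add.commute)
    next
      case 2
      then show ?thesis using reduce[of q tau_inv tau] f by (simp add: ghom_simps add.commute)
    next
      case 3
      then show ?thesis using reduce[of q sigma sigma_inv] f by (simp add: ghom_simps add.commute)
    next
      case 4
      then show ?thesis using reduce[of q sigma_inv sigma] f by (simp add: ghom_simps add.commute)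
    qed
  qed
qed

section \<open>Outer classes\<close>

text \<open>On homology these four maps are -1, the swap, the reflection of the first coordinate and
  a rotation of order four. As -1 is central, \<open>auJ\<close> can be moved through everything up
  to inner automorphisms.\<close>

definition auJ :: "free2 \<Rightarrow> free2" where "auJ = endo (- gen_a) (- gen_b)"
definition auS :: "free2 \<Rightarrow> free2" where "auS = endo gen_b gen_a"
definition auD :: "free2 \<Rightarrow> free2" where "auD = endo (- gen_a) gen_b"
definition auR :: "free2 \<Rightarrow> free2" where "auR = endo gen_b (- gen_a)"

lemma letter_gens [simp]:
  "auJ gen_a = - gen_a" "auJ gen_b = - gen_b" "auS gen_a = gen_b" "auS gen_b = gen_a"
  "auD gen_a = - gen_a" "auD gen_b = gen_b" "auR gen_a = gen_b" "auR gen_b = - gen_a"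
  by (simp_all add: auJ_def auS_def auD_def auR_def)

lemma ghom_letters [simp]: "ghom auJ" "ghom auS" "ghom auD" "ghom auR"
  by (simp_all add: auJ_def auS_def auD_def auR_def)

lemma letter_squares: "auJ \<circ> auJ = id" "auS \<circ> auS = id" "auD \<circ> auD = id" "auR \<circ> auR = auJ"
  by (rule ghom_eqI; simp add: ghom_comp ghom_simps)+

lemma letter_relations:
  "auD \<circ> auR = auS" "auR \<circ> auJ = auJ \<circ> auR" "auS \<circ> auJ = auJ \<circ> auS" "auD \<circ> auJ = auJ \<circ> auD"
  by (rule ghom_eqI; simp add: ghom_comp ghom_simps)+

lemma auR_fourth: "auR \<circ> (auJ \<circ> auR) = id" "auJ \<circ> auR \<circ> auR = id"
  by (rule ghom_eqI; simp add: ghom_comp ghom_simps)+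

lemma aut_letters [simp]: "aut auJ" "aut auS" "aut auD" "aut auR"
  using autI[OF _ _ letter_squares(1,1)] autI[OF _ _ letter_squares(2,2)]
    autI[OF _ _ letter_squares(3,3)] autI[OF _ _ auR_fourth] by (simp_all add: ghom_comp)

lemma letter_auto_cases:
  assumes "letter_auto f"
  shows "f \<in> {id, auJ, auS, auJ \<circ> auS, auD, auJ \<circ> auD, auR, auJ \<circ> auR}"
proof -
  have f: "aut f" and "ghom f" using assms by (simp_all add: letter_auto_def aut_ghom)
  obtain l m where lm: "f gen_a = lt l" "f gen_b = lt m"
    using assms by (metis letter_auto_def gen_lt)
  have "fst l \<noteq> fst m"
  proof
    assume "fst l = fst m"
    then have "l = m \<or> l = inv_letter m" by (auto simp: inv_letter_def prod_eq_iff)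
    then have "f gen_a = f gen_b \<or> f gen_a = f (- gen_b)"
      using lm \<open>ghom f\<close> by (auto simp: ghom_simps)
    then have "gen_a = gen_b \<or> gen_a = - gen_b"
      using f by (simp add: aut_inject)
    then show False
      by (auto simp: gen_lt simp flip: lt_True)
  qed
  then have "(fst l = Gen_A \<and> fst m = Gen_B) \<or> (fst l = Gen_B \<and> fst m = Gen_A)"
    by (cases "fst l"; cases "fst m") auto
  note lm this
  then consider "f gen_a = gen_a" "f gen_b = gen_b" | "f gen_a = gen_a" "f gen_b = - gen_b"
    | "f gen_a = - gen_a" "f gen_b = gen_b" | "f gen_a = - gen_a" "f gen_b = - gen_b"
    | "f gen_a = gen_b" "f gen_b = gen_a" | "f gen_a = gen_b" "f gen_b = - gen_a"
    | "f gen_a = - gen_b" "f gen_b = gen_a" | "f gen_a = - gen_b" "f gen_b = - gen_a"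
    by (cases l; cases m) (auto simp: lt_gen split: if_splits)
  then show ?thesis
  proof cases
    case 1
    then have "f = id" by (intro ghom_eqI \<open>ghom f\<close>) simp_all
    then show ?thesis by simp
  next
    case 2
    then have "f = auJ \<circ> auD" by (intro ghom_eqI \<open>ghom f\<close>) (simp_all add: ghom_comp ghom_simps)
    then show ?thesis by simp
  next
    case 3
    then have "f = auD" by (intro ghom_eqI \<open>ghom f\<close>) simp_all
    then show ?thesis by simp
  next
    case 4
    then have "f = auJ" by (intro ghom_eqI \<open>ghom f\<close>) simp_all
    then show ?thesis by simp
  next
    case 5
    then have "f = auS" by (intro ghom_eqI \<open>ghom f\<close>) simp_all
    then show ?thesis by simp
  next
    case 6
    then have "f = auR" by (intro ghom_eqI \<open>ghom f\<close>) simp_all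
    then show ?thesis by simp
  next
    case 7
    then have "f = auJ \<circ> auR" by (intro ghom_eqI \<open>ghom f\<close>) (simp_all add: ghom_comp ghom_simps)
    then show ?thesis by simp
  next
    case 8
    then have "f = auJ \<circ> auS" by (intro ghom_eqI \<open>ghom f\<close>) (simp_all add: ghom_comp ghom_simps)
    then show ?thesis by simp
  qed
qed

lemma letter_auto_aut: "letter_auto f \<Longrightarrow> aut f"
  by (simp add: letter_auto_def)

lemma letter_auto_comp: "letter_auto f \<Longrightarrow> letter_auto g \<Longrightarrow> letter_auto (f \<circ> g)"
  unfolding letter_auto_def by (metis aut_comp comp_apply)

lemma letter_auto_gens: "aut f \<Longrightarrow> f gen_a = lt l \<Longrightarrow> f gen_b = lt m \<Longrightarrow> letter_auto f"
proof -
  assume f: "aut f" "f gen_a = lt l" "f gen_b = lt m"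
  have "f (lt (Gen_A, e)) = lt (if e then inv_letter l else l)"
    "f (lt (Gen_B, e)) = lt (if e then inv_letter m else m)" for e
    using f by (simp_all add: lt_gen aut_ghom ghom_simps)
  then show ?thesis
    unfolding letter_auto_def using f(1) by (metis gen.exhaust surj_pair)
qed

lemma letter_auto_letters [simp]:
  "letter_auto id" "letter_auto auJ" "letter_auto auS" "letter_auto auD" "letter_auto auR"
proof -
  show "letter_auto id" by (auto simp: letter_auto_def)
  show "letter_auto auJ" by (rule letter_auto_gens[of _ "(Gen_A, True)" "(Gen_B, True)"]) (simp_all add: lt_gen del: lt_True)
  show "letter_auto auS" by (rule letter_auto_gens[of _ "(Gen_B, False)" "(Gen_A, False)"]) (simp_all add: lt_gen del: lt_True)
  show "letter_auto auD" by (rule letter_auto_gens[of _ "(Gen_A, True)" "(Gen_B, False)"]) (simp_all add: lt_gen del: lt_True)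
  show "letter_auto auR" by (rule letter_auto_gens[of _ "(Gen_B, False)" "(Gen_A, True)"]) (simp_all add: lt_gen del: lt_True)
qed

primrec tw :: "bool \<Rightarrow> free2 \<Rightarrow> free2" where
  "tw True = sigma" | "tw False = tau"

primrec twi :: "bool \<Rightarrow> free2 \<Rightarrow> free2" where
  "twi True = sigma_inv" | "twi False = tau_inv"

lemma tw_props [simp]: "aut (tw x)" "aut (twi x)" "ghom (tw x)" "ghom (twi x)"
  "tw x \<circ> twi x = id" "twi x \<circ> tw x = id"
  by (cases x; simp)+

primrec pch :: "bool list \<Rightarrow> free2 \<Rightarrow> free2" where
  "pch [] = id"
| "pch (x # xs) = tw x \<circ> pch xs"

lemma pch_append: "pch (xs @ ys) = pch xs \<circ> pch ys"
  by (induction xs) (simp_all add: comp_assoc)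

lemma aut_pch [simp]: "aut (pch xs)" "ghom (pch xs)"
  by (induction xs) (simp_all add: aut_comp ghom_comp)

lemma oeq_left: "g \<approx> g' \<Longrightarrow> ghom f \<Longrightarrow> f \<circ> g \<approx> f \<circ> g'"
  using oeq_comp by simp

lemma oeq_eq: "f = g \<Longrightarrow> f \<approx> g"
  by simp

lemma oeq_right: "f \<approx> f' \<Longrightarrow> f \<circ> g \<approx> f' \<circ> g"
  by (auto simp: oeq_def comp_assoc)

lemma tw_auJ: "auJ \<circ> tw x \<approx> tw x \<circ> auJ"
  by (cases x; rule oeq_endoI[where w = "if x then gen_b else gen_a"])
    (simp_all add: ghom_comp ghom_simps cj_def grp)

lemma tw_auS: "tw x \<circ> auS \<approx> auS \<circ> tw (\<not> x)"
  by (cases x; rule oeq_endoI[where w = 0]) (simp_all add: ghom_comp ghom_simps)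

lemma tw_auD: "tw x \<circ> auD \<approx> auD \<circ> twi x"
  by (cases x; rule oeq_endoI[where w = "if x then - gen_b else 0"])
    (simp_all add: ghom_comp ghom_simps cj_def grp)

lemma tw_auR: "tw x \<circ> auR \<approx> auR \<circ> twi (\<not> x)"
  by (cases x; rule oeq_endoI[where w = "if x then - gen_b else 0"])
    (simp_all add: ghom_comp ghom_simps cj_def grp)

definition auRJ :: "bool \<Rightarrow> free2 \<Rightarrow> free2" where
  "auRJ x = (if x then auJ \<circ> auR else auR)"

text \<open>The relation behind the reduction of mixed words to positive ones.\<close>

lemma twi_tw: "twi x \<circ> tw (\<not> x) \<approx> auRJ x \<circ> tw x"
  by (cases x; rule oeq_endoI[where w = "if x then gen_b else gen_a"])
    (simp_all add: auRJ_def ghom_comp ghom_simps cj_def grp)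

lemma letter_auto_RJ [simp]: "letter_auto (auRJ x)"
  by (simp add: auRJ_def letter_auto_comp)

subsection \<open>Every automorphism is positive up to letters\<close>

lemma tw_letter:
  assumes "letter_auto b"
  shows "\<exists>y. tw x \<circ> b \<approx> b \<circ> tw y \<or> tw x \<circ> b \<approx> b \<circ> twi y"
proof -
  have J: "\<exists>y. tw x \<circ> (auJ \<circ> b) \<approx> (auJ \<circ> b) \<circ> tw y \<or> tw x \<circ> (auJ \<circ> b) \<approx> (auJ \<circ> b) \<circ> twi y"
    if "\<exists>y. tw x \<circ> b \<approx> b \<circ> tw y \<or> tw x \<circ> b \<approx> b \<circ> twi y" for b
  proof -
    have "tw x \<circ> auJ \<circ> b \<approx> auJ \<circ> tw x \<circ> b"
      by (rule oeq_right, rule oeq_sym, rule tw_auJ)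
    moreover have "auJ \<circ> (tw x \<circ> b) \<approx> auJ \<circ> (b \<circ> g)" if "tw x \<circ> b \<approx> b \<circ> g" for g
      using that by (simp add: oeq_left)
    ultimately show ?thesis using that by (metis comp_assoc oeq_trans)
  qed
  have 1: "\<exists>y. tw x \<circ> b \<approx> b \<circ> tw y \<or> tw x \<circ> b \<approx> b \<circ> twi y" if "b \<in> {id, auS, auD, auR}" for b
    using that tw_auS[of x] tw_auD[of x] tw_auR[of x] by (metis comp_id id_comp insertE oeq_refl singletonD)
  show ?thesis
    using letter_auto_cases[OF assms] 1 J[OF 1] J[OF 1[of id]] by auto
qed

lemma twi_letter:
  assumes "letter_auto b"
  shows "\<exists>y. twi x \<circ> b \<approx> b \<circ> tw y \<or> twi x \<circ> b \<approx> b \<circ> twi y"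
proof -
  have hb: "ghom b" using letter_auto_aut[OF assms] aut_ghom by blast
  have *: "twi x \<circ> b \<approx> b \<circ> h" if "tw x \<circ> b \<approx> b \<circ> g" "g \<circ> h = id" for g h
  proof -
    have "b \<approx> b \<circ> g \<circ> h" using that(2) by (intro oeq_eq) (simp add: comp_assoc)
    also have "b \<circ> g \<circ> h \<approx> tw x \<circ> b \<circ> h"
      using that(1) by (rule oeq_right[OF oeq_sym])
    finally have "twi x \<circ> b \<approx> twi x \<circ> (tw x \<circ> b \<circ> h)" by (rule oeq_left) simp
    also have "twi x \<circ> (tw x \<circ> b \<circ> h) \<approx> (twi x \<circ> tw x) \<circ> (b \<circ> h)" by (intro oeq_eq) (simp only: comp_assoc)
    also have "\<dots> \<approx> b \<circ> h" by simp
    finally show ?thesis .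
  qed
  show ?thesis
    using tw_letter[OF assms, of x] *[OF _ tw_props(5)] *[OF _ tw_props(6)] by blast
qed

lemma twi_auD: "twi x \<circ> auD \<approx> auD \<circ> tw x"
proof -
  have "twi x \<circ> auD \<approx> auD \<circ> (auD \<circ> twi x) \<circ> auD"
    using letter_squares(3) by (intro oeq_eq) (simp add: fun_eq_iff)
  also have "\<dots> \<approx> auD \<circ> (tw x \<circ> auD) \<circ> auD"
    by (intro oeq_right oeq_left oeq_sym[OF tw_auD]) simp
  also have "\<dots> \<approx> auD \<circ> tw x"
    using letter_squares(3) by (intro oeq_eq) (simp add: fun_eq_iff)
  finally show ?thesis .
qed

lemma twi_eq_D: "twi x \<approx> auD \<circ> tw x \<circ> auD"
proof -
  have "twi x \<approx> twi x \<circ> auD \<circ> auD" using letter_squares(3) by (intro oeq_eq) (simp add: fun_eq_iff)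
  also have "\<dots> \<approx> auD \<circ> tw x \<circ> auD" by (rule oeq_right[OF twi_auD])
  finally show ?thesis .
qed

definition dpow :: "bool \<Rightarrow> free2 \<Rightarrow> free2" where
  "dpow d = (if d then auD else id)"

text \<open>An inverse twist cancels against an equal first twist; against the other twist the
  relation \<open>twi_tw\<close> replaces it by a letter map and a positive twist. Only an empty
  word changes the exponent of the reflection.\<close>

lemma twi_pch:
  "\<exists>b zs d'. letter_auto b \<and> twi x \<circ> pch xs \<circ> dpow d \<approx> b \<circ> pch zs \<circ> dpow d'"
proof (cases xs)
  case Nil
  show ?thesis
  proof (cases d)
    case True
    then show ?thesis using twi_auD[of x] Nil
      by (intro exI[of _ auD] exI[of _ "[x]"] exI[of _ False]) (simp add: dpow_def)
  next
    case False
    then show ?thesis using twi_eq_D[of x] Nil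
      by (intro exI[of _ auD] exI[of _ "[x]"] exI[of _ True]) (simp add: dpow_def)
  qed
next
  case (Cons y ys)
  show ?thesis
  proof (cases "y = x")
    case True
    have "twi x \<circ> pch xs \<circ> dpow d = (twi x \<circ> tw x) \<circ> (pch ys \<circ> dpow d)"
      by (simp only: Cons True pch.simps comp_assoc)
    then show ?thesis by (intro exI[of _ id] exI[of _ ys] exI[of _ d]) simp
  next
    case False
    then have y: "y = (\<not> x)" by simp
    have "twi x \<circ> pch xs \<circ> dpow d \<approx> (twi x \<circ> tw (\<not> x)) \<circ> (pch ys \<circ> dpow d)"
      by (intro oeq_eq) (simp add: Cons y comp_assoc)
    also have "\<dots> \<approx> (auRJ x \<circ> tw x) \<circ> (pch ys \<circ> dpow d)"
      by (rule oeq_right[OF twi_tw])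
    also have "\<dots> \<approx> auRJ x \<circ> pch (x # ys) \<circ> dpow d" by (intro oeq_eq) (simp add: comp_assoc)
    finally show ?thesis by (intro exI[of _ "auRJ x"] exI[of _ "x # ys"] exI[of _ d]) simp
  qed
qed

definition posform :: "(free2 \<Rightarrow> free2) \<Rightarrow> bool" where
  "posform f \<longleftrightarrow> (\<exists>b xs d. letter_auto b \<and> f \<approx> b \<circ> pch xs \<circ> dpow d)"

lemma posform_left:
  assumes "posform f" "g \<in> {sigma, sigma_inv, tau, tau_inv} \<or> letter_auto g"
  shows "posform (g \<circ> f)"
proof -
  obtain b xs d where b: "letter_auto b" and f: "f \<approx> b \<circ> pch xs \<circ> dpow d"
    using assms(1) by (auto simp: posform_def)
  have hb: "ghom b" using letter_auto_aut[OF b] aut_ghom by blast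
  have hg: "ghom g" using assms(2) letter_auto_aut[of g] aut_ghom by auto
  show ?thesis
  proof (cases "letter_auto g")
    case True
    have "g \<circ> f \<approx> g \<circ> (b \<circ> pch xs \<circ> dpow d)" using f hg by (rule oeq_left)
    also have "\<dots> \<approx> (g \<circ> b) \<circ> pch xs \<circ> dpow d" by (intro oeq_eq) (simp add: comp_assoc)
    finally show ?thesis unfolding posform_def using letter_auto_comp[OF True b] by blast
  next
    case False
    then obtain x where "g = tw x \<or> g = twi x"
      using assms(2) tw.simps twi.simps by (metis insertE singletonD)
    then obtain y where y: "g \<circ> b \<approx> b \<circ> tw y \<or> g \<circ> b \<approx> b \<circ> twi y"
      using tw_letter[OF b, of x] twi_letter[OF b, of x] by blast
    have 1: "g \<circ> f \<approx> b \<circ> (h \<circ> pch xs \<circ> dpow d)" if "g \<circ> b \<approx> b \<circ> h" for h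
    proof -
      have "g \<circ> f \<approx> g \<circ> (b \<circ> pch xs \<circ> dpow d)" using f hg by (rule oeq_left)
      also have "\<dots> \<approx> (g \<circ> b) \<circ> (pch xs \<circ> dpow d)" by (intro oeq_eq) (simp add: comp_assoc)
      also have "\<dots> \<approx> (b \<circ> h) \<circ> (pch xs \<circ> dpow d)" using that by (rule oeq_right)
      also have "\<dots> \<approx> b \<circ> (h \<circ> pch xs \<circ> dpow d)" by (intro oeq_eq) (simp add: comp_assoc)
      finally show ?thesis .
    qed
    from y show ?thesis
    proof
      assume "g \<circ> b \<approx> b \<circ> tw y"
      from 1[OF this] have "g \<circ> f \<approx> b \<circ> pch (y # xs) \<circ> dpow d" by (simp add: comp_assoc)
      then show ?thesis unfolding posform_def using b by blast
    next
      assume g: "g \<circ> b \<approx> b \<circ> twi y"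
      obtain c zs d' where c: "letter_auto c" "twi y \<circ> pch xs \<circ> dpow d \<approx> c \<circ> pch zs \<circ> dpow d'"
        using twi_pch by blast
      have "g \<circ> f \<approx> b \<circ> (c \<circ> pch zs \<circ> dpow d')"
        using 1[OF g] oeq_left[OF c(2) hb] oeq_trans by blast
      then have "g \<circ> f \<approx> (b \<circ> c) \<circ> pch zs \<circ> dpow d'" by (simp add: comp_assoc)
      then show ?thesis unfolding posform_def using letter_auto_comp[OF b c(1)] by blast
    qed
  qed
qed

theorem posform_aut:
  assumes "aut f"
  shows "posform f"
proof -
  obtain g where g: "g \<in> nielsen" "f \<approx> g"
    using nielsen_generation[OF assms] by blast
  have "\<exists>b gs. letter_auto b \<and> set gs \<subseteq> {sigma, sigma_inv, tau, tau_inv} \<and> g = b \<circ> foldr (\<circ>) gs id"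
    using g(1)
  proof induction
    case (base f)
    then show ?case by (intro exI[of _ f] exI[of _ "[]"]) simp
  next
    case (step f h)
    then obtain b gs where b: "letter_auto b" "set gs \<subseteq> {sigma, sigma_inv, tau, tau_inv}"
      "f = b \<circ> foldr (\<circ>) gs id" by blast
    have "foldr (\<circ>) (gs @ [h]) id = foldr (\<circ>) gs id \<circ> h"
      by (induction gs) (simp_all add: comp_assoc)
    then have "f \<circ> h = b \<circ> foldr (\<circ>) (gs @ [h]) id"
      by (simp only: b(3) comp_assoc)
    moreover have "set (gs @ [h]) \<subseteq> {sigma, sigma_inv, tau, tau_inv}"
      using b(2) step.hyps(2) by simp
    ultimately show ?case using b(1) by blast
  qed
  then obtain b gs where b: "letter_auto b" "set gs \<subseteq> {sigma, sigma_inv, tau, tau_inv}"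
    "g = b \<circ> foldr (\<circ>) gs id" by blast
  have "posform (foldr (\<circ>) gs id)"
    using b(2)
  proof (induction gs)
    case Nil
    have "id \<approx> id \<circ> pch [] \<circ> dpow False" by (simp add: dpow_def)
    then have "posform id" unfolding posform_def using letter_auto_letters(1) by blast
    moreover have "foldr (\<circ>) [] id = (id :: free2 \<Rightarrow> free2)" by (simp add: fun_eq_iff)
    ultimately show ?case by (simp only:)
  next
    case (Cons h gs)
    have "posform (foldr (\<circ>) gs id)"
      by (rule Cons.IH) (use Cons.prems in simp)
    moreover have "h \<in> {sigma, sigma_inv, tau, tau_inv}" using Cons.prems by simp
    ultimately have "posform (h \<circ> foldr (\<circ>) gs id)" using posform_left by blast
    moreover have "foldr (\<circ>) (h # gs) id = h \<circ> foldr (\<circ>) gs id" by (simp add: fun_eq_iff)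
    ultimately show ?case by (simp only:)
  qed
  then have "posform g" using posform_left b by blast
  then show ?thesis
    unfolding posform_def using g(2) oeq_trans by blast
qed

subsection \<open>Conjugacy in the outer automorphism group\<close>

definition ocj :: "(free2 \<Rightarrow> free2) \<Rightarrow> (free2 \<Rightarrow> free2) \<Rightarrow> bool" where
  "ocj f g \<longleftrightarrow> (\<exists>\<alpha>. aut \<alpha> \<and> \<alpha> \<circ> f \<approx> g \<circ> \<alpha>)"

lemma ocjI: "aut \<alpha> \<Longrightarrow> \<alpha> \<circ> f \<approx> g \<circ> \<alpha> \<Longrightarrow> ocj f g"
  by (auto simp: ocj_def)

lemma oeq_ocj: "f \<approx> g \<Longrightarrow> ocj f g"
  by (rule ocjI[of id]) simp_all

lemma ocj_trans [trans]:
  assumes "ocj f g" "ocj g h"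
  shows "ocj f h"
proof -
  obtain \<alpha> \<beta> where 1: "aut \<alpha>" "\<alpha> \<circ> f \<approx> g \<circ> \<alpha>" and 2: "aut \<beta>" "\<beta> \<circ> g \<approx> h \<circ> \<beta>"
    using assms by (auto simp: ocj_def)
  have "\<beta> \<circ> (\<alpha> \<circ> f) \<approx> \<beta> \<circ> (g \<circ> \<alpha>)"
    using 1 2 by (intro oeq_left) (simp_all add: aut_ghom)
  also have "\<dots> \<approx> (\<beta> \<circ> g) \<circ> \<alpha>" by (intro oeq_eq) (simp add: comp_assoc)
  also have "\<dots> \<approx> (h \<circ> \<beta>) \<circ> \<alpha>" using 2 by (intro oeq_right)
  finally have "\<beta> \<circ> (\<alpha> \<circ> f) \<approx> (h \<circ> \<beta>) \<circ> \<alpha>" .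
  then show ?thesis
    using 1 2 by (intro ocjI[of "\<beta> \<circ> \<alpha>"]) (simp_all add: aut_comp comp_assoc)
qed

lemma ocj_oeq_trans [trans]: "ocj f g \<Longrightarrow> g \<approx> h \<Longrightarrow> ocj f h" "f \<approx> g \<Longrightarrow> ocj g h \<Longrightarrow> ocj f h"
  using ocj_trans oeq_ocj by blast+

lemma ocj_rotate: "aut g \<Longrightarrow> ocj (f \<circ> g) (g \<circ> f)"
  by (rule ocjI[of g]) (simp_all add: comp_assoc)

definition jpow :: "bool \<Rightarrow> free2 \<Rightarrow> free2" where
  "jpow j = (if j then auJ else id)"

lemma jpow_props [simp]: "aut (jpow j)" "ghom (jpow j)" "letter_auto (jpow j)"
  by (simp_all add: jpow_def)

lemma jpow_jpow: "jpow i \<circ> jpow j = jpow (i \<noteq> j)"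
  using letter_squares(1) by (auto simp: jpow_def)

lemma tw_jpow: "tw x \<circ> jpow j \<approx> jpow j \<circ> tw x"
  using oeq_sym[OF tw_auJ] by (simp add: jpow_def)

text \<open>Representatives for conjugacy in the outer group: positive words up to sign, of
  determinant 1 or (with \<open>auS\<close>) -1, and certain classes of finite order. With
  \<open>auR\<close> a single twist can survive, which gives the elements of order 3 and 6.\<close>

definition cnormal :: "(free2 \<Rightarrow> free2) \<Rightarrow> bool" where
  "cnormal g \<longleftrightarrow> (\<exists>j xs. g = jpow j \<circ> pch xs \<or> g = jpow j \<circ> auS \<circ> pch xs) \<or>
     (\<exists>j. g = jpow j \<circ> auD \<or> g = jpow j \<circ> auR \<or> (\<exists>x. g = jpow j \<circ> auR \<circ> tw x))"

lemma D_rotate: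
  "ocj (jpow j \<circ> auD \<circ> pch (xs @ [y])) (jpow j \<circ> auD \<circ> twi y \<circ> pch xs)"
proof -
  have "jpow j \<circ> auD \<circ> pch (xs @ [y]) \<approx> (jpow j \<circ> auD \<circ> pch xs) \<circ> tw y"
    by (intro oeq_eq) (simp add: pch_append comp_assoc)
  also have "ocj \<dots> (tw y \<circ> (jpow j \<circ> auD \<circ> pch xs))" by (rule ocj_rotate) simp
  also have "tw y \<circ> (jpow j \<circ> auD \<circ> pch xs) \<approx> (tw y \<circ> jpow j) \<circ> (auD \<circ> pch xs)"
    by (intro oeq_eq) (simp add: comp_assoc)
  also have "ocj \<dots> ((jpow j \<circ> tw y) \<circ> (auD \<circ> pch xs))" by (intro oeq_ocj oeq_right tw_jpow)
  also have "(jpow j \<circ> tw y) \<circ> (auD \<circ> pch xs) \<approx> jpow j \<circ> ((tw y \<circ> auD) \<circ> pch xs)"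
    by (intro oeq_eq) (simp add: comp_assoc)
  also have "ocj \<dots> (jpow j \<circ> ((auD \<circ> twi y) \<circ> pch xs))"
    by (intro oeq_ocj oeq_left oeq_right tw_auD) simp
  finally show ?thesis by (simp add: comp_assoc)
qed

lemma R_rotate:
  "ocj (jpow j \<circ> auR \<circ> pch (xs @ [y])) (jpow j \<circ> auR \<circ> twi (\<not> y) \<circ> pch xs)"
proof -
  have "jpow j \<circ> auR \<circ> pch (xs @ [y]) \<approx> (jpow j \<circ> auR \<circ> pch xs) \<circ> tw y"
    by (intro oeq_eq) (simp add: pch_append comp_assoc)
  also have "ocj \<dots> (tw y \<circ> (jpow j \<circ> auR \<circ> pch xs))" by (rule ocj_rotate) simp
  also have "tw y \<circ> (jpow j \<circ> auR \<circ> pch xs) \<approx> (tw y \<circ> jpow j) \<circ> (auR \<circ> pch xs)"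
    by (intro oeq_eq) (simp add: comp_assoc)
  also have "ocj \<dots> ((jpow j \<circ> tw y) \<circ> (auR \<circ> pch xs))" by (intro oeq_ocj oeq_right tw_jpow)
  also have "(jpow j \<circ> tw y) \<circ> (auR \<circ> pch xs) \<approx> jpow j \<circ> ((tw y \<circ> auR) \<circ> pch xs)"
    by (intro oeq_eq) (simp add: comp_assoc)
  also have "ocj \<dots> (jpow j \<circ> ((auR \<circ> twi (\<not> y)) \<circ> pch xs))"
    by (intro oeq_ocj oeq_left oeq_right tw_auR) simp
  finally show ?thesis by (simp add: comp_assoc)
qed

lemma D_RJ: "auD \<circ> auRJ x = jpow x \<circ> auS"
  using letter_relations by (auto simp: auRJ_def jpow_def fun_eq_iff)

lemma R_RJ: "auR \<circ> auRJ x = jpow (\<not> x)"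
  using letter_squares(4) auR_fourth by (auto simp: auRJ_def jpow_def)

text \<open>Conjugation brings the last twist to the front, and moving it through \<open>auD\<close>
  inverts it. It then cancels against an equal first twist, or \<open>twi_tw\<close> turns the
  reflection into \<open>auS\<close> and leaves a positive word.\<close>

lemma D_cnormal: "\<exists>g. cnormal g \<and> ocj (jpow j \<circ> auD \<circ> pch xs) g"
proof (induction "length xs" arbitrary: xs rule: less_induct)
  case less
  show ?case
  proof (cases xs rule: rev_cases)
    case Nil
    have "cnormal (jpow j \<circ> auD)" by (auto simp: cnormal_def)
    then show ?thesis using Nil oeq_ocj oeq_refl by auto
  next
    case (snoc zs y)
    have S: "jpow j \<circ> auD \<circ> twi (\<not> x) \<circ> tw x \<circ> h \<approx> jpow (j \<noteq> (\<not> x)) \<circ> auS \<circ> tw (\<not> x) \<circ> h" for x h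
    proof -
      have "jpow j \<circ> auD \<circ> twi (\<not> x) \<circ> tw x \<circ> h \<approx> (jpow j \<circ> auD) \<circ> ((twi (\<not> x) \<circ> tw x) \<circ> h)"
        by (intro oeq_eq) (simp add: comp_assoc)
      also have "\<dots> \<approx> (jpow j \<circ> auD) \<circ> ((auRJ (\<not> x) \<circ> tw (\<not> x)) \<circ> h)"
        using twi_tw[of "\<not> x"] by (intro oeq_left oeq_right) (simp_all add: ghom_comp)
      also have "\<dots> \<approx> jpow j \<circ> (auD \<circ> auRJ (\<not> x)) \<circ> (tw (\<not> x) \<circ> h)" by (intro oeq_eq) (simp add: comp_assoc)
      also have "\<dots> \<approx> (jpow j \<circ> jpow (\<not> x)) \<circ> auS \<circ> tw (\<not> x) \<circ> h"
        by (intro oeq_eq) (simp only: D_RJ comp_assoc)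
      finally show ?thesis by (simp only: jpow_jpow)
    qed
    show ?thesis
    proof (cases zs)
      case Nil
      \<comment> \<open>A single twist has no partner to react with, so the conjugation is by the
        other twist.\<close>
      have "tw (\<not> y) \<circ> (jpow j \<circ> auD \<circ> pch xs) \<approx> (tw (\<not> y) \<circ> jpow j) \<circ> (auD \<circ> tw y)"
        by (intro oeq_eq) (simp add: snoc Nil comp_assoc)
      also have "\<dots> \<approx> (jpow j \<circ> tw (\<not> y)) \<circ> (auD \<circ> tw y)"
        by (intro oeq_right tw_jpow)
      also have "\<dots> \<approx> jpow j \<circ> ((tw (\<not> y) \<circ> auD) \<circ> tw y)" by (intro oeq_eq) (simp add: comp_assoc)
      also have "\<dots> \<approx> jpow j \<circ> ((auD \<circ> twi (\<not> y)) \<circ> tw y)"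
        by (intro oeq_left oeq_right tw_auD) simp
      also have "\<dots> \<approx> jpow (j \<noteq> (\<not> y)) \<circ> auS \<circ> pch [] \<circ> tw (\<not> y)"
        using S[of y id] by (simp add: comp_assoc)
      finally have "ocj (jpow j \<circ> auD \<circ> pch xs) (jpow (j \<noteq> (\<not> y)) \<circ> auS \<circ> pch [])"
        by (intro ocjI[of "tw (\<not> y)"]) simp_all
      then show ?thesis unfolding cnormal_def by blast
    next
      case (Cons x ws)
      show ?thesis
      proof (cases "x = y")
        case True
        have "jpow j \<circ> auD \<circ> twi y \<circ> pch zs = jpow j \<circ> auD \<circ> (twi y \<circ> tw y) \<circ> pch ws"
          using Cons True by (simp only: comp_assoc pch.simps)
        then have "ocj (jpow j \<circ> auD \<circ> pch xs) (jpow j \<circ> auD \<circ> pch ws)"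
          using D_rotate[of j zs y] snoc by simp
        then show ?thesis using less[of ws] snoc Cons ocj_trans by fastforce
      next
        case False
        then have y: "y = (\<not> x)" by simp
        have "ocj (jpow j \<circ> auD \<circ> pch xs) (jpow j \<circ> auD \<circ> twi (\<not> x) \<circ> tw x \<circ> pch ws)"
          using D_rotate[of j zs y] snoc Cons y by (simp add: comp_assoc)
        also have "ocj \<dots> (jpow (j \<noteq> (\<not> x)) \<circ> auS \<circ> pch ((\<not> x) # ws))"
          using oeq_ocj[OF S[of x "pch ws"]] by (simp add: comp_assoc)
        finally show ?thesis unfolding cnormal_def by blast
      qed
    qed
  qed
qed

text \<open>As for the reflection, but moving a twist through \<open>auR\<close> also exchanges the
  two kinds of twist; when \<open>twi_tw\<close> applies, the two rotations multiply to a power of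
  \<open>auJ\<close>.\<close>

lemma R_cnormal: "\<exists>g. cnormal g \<and> ocj (jpow j \<circ> auR \<circ> pch xs) g"
proof (induction "length xs" arbitrary: xs rule: less_induct)
  case less
  show ?case
  proof (cases xs rule: rev_cases)
    case Nil
    have "cnormal (jpow j \<circ> auR)" by (auto simp: cnormal_def)
    then show ?thesis using Nil oeq_ocj oeq_refl by auto
  next
    case (snoc zs y)
    show ?thesis
    proof (cases zs)
      case Nil
      have "cnormal (jpow j \<circ> auR \<circ> tw y)" by (auto simp: cnormal_def)
      then show ?thesis using snoc Nil oeq_ocj[OF oeq_refl] by auto
    next
      case (Cons x ws)
      show ?thesis
      proof (cases "x = (\<not> y)")
        case True
        have "jpow j \<circ> auR \<circ> twi (\<not> y) \<circ> pch zs = jpow j \<circ> auR \<circ> (twi (\<not> y) \<circ> tw (\<not> y)) \<circ> pch ws"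
          using Cons True by (simp only: comp_assoc pch.simps)
        then have "ocj (jpow j \<circ> auR \<circ> pch xs) (jpow j \<circ> auR \<circ> pch ws)"
          using R_rotate[of j zs y] snoc by simp
        then show ?thesis using less[of ws] snoc Cons ocj_trans by fastforce
      next
        case False
        then have x: "x = y" by simp
        have "ocj (jpow j \<circ> auR \<circ> pch xs) ((jpow j \<circ> auR) \<circ> ((twi (\<not> y) \<circ> tw (\<not> \<not> y)) \<circ> pch ws))"
          using R_rotate[of j zs y] snoc Cons x by (simp add: comp_assoc)
        also have "ocj \<dots> ((jpow j \<circ> auR) \<circ> ((auRJ (\<not> y) \<circ> tw (\<not> y)) \<circ> pch ws))"
          by (intro oeq_ocj oeq_left oeq_right twi_tw) (simp add: ghom_comp)
        also have "(jpow j \<circ> auR) \<circ> ((auRJ (\<not> y) \<circ> tw (\<not> y)) \<circ> pch ws)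
            \<approx> jpow j \<circ> (auR \<circ> auRJ (\<not> y)) \<circ> pch ((\<not> y) # ws)" by (intro oeq_eq) (simp add: comp_assoc)
        also have "\<dots> \<approx> jpow (j \<noteq> y) \<circ> pch ((\<not> y) # ws)"
          by (intro oeq_eq) (simp add: R_RJ jpow_jpow)
        finally show ?thesis unfolding cnormal_def by blast
      qed
    qed
  qed
qed

theorem cnormal_ocj:
  assumes "aut f"
  shows "\<exists>g. cnormal g \<and> ocj f g"
proof -
  obtain b xs d where b: "letter_auto b" "f \<approx> b \<circ> pch xs \<circ> dpow d"
    using posform_aut[OF assms] by (auto simp: posform_def)
  have "\<exists>c. letter_auto c \<and> ocj f (c \<circ> pch xs)"
  proof (cases d)
    case True
    have "ocj f (b \<circ> pch xs \<circ> auD)" using b True by (simp add: dpow_def oeq_ocj)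
    also have "ocj \<dots> (auD \<circ> (b \<circ> pch xs))" by (rule ocj_rotate) simp
    finally show ?thesis using letter_auto_comp[OF letter_auto_letters(4) b(1)] by (metis comp_assoc)
  next
    case False
    then show ?thesis using b oeq_ocj by (auto simp: dpow_def)
  qed
  then obtain c where c: "letter_auto c" "ocj f (c \<circ> pch xs)" by blast
  have "c \<in> {jpow j | j. True} \<or> c \<in> {jpow j \<circ> auS | j. True} \<or> c \<in> {jpow j \<circ> auD | j. True}
      \<or> c \<in> {jpow j \<circ> auR | j. True}"
    using letter_auto_cases[OF c(1)] by (auto simp: jpow_def intro: exI[of _ True] exI[of _ False])
  then have "\<exists>g. cnormal g \<and> ocj (c \<circ> pch xs) g"
  proof (elim disjE)
    assume "c \<in> {jpow j | j. True}"
    then have "cnormal (c \<circ> pch xs)" unfolding cnormal_def by blast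
    then show ?thesis using oeq_ocj oeq_refl by blast
  next
    assume "c \<in> {jpow j \<circ> auS | j. True}"
    then have "cnormal (c \<circ> pch xs)" unfolding cnormal_def by blast
    then show ?thesis using oeq_ocj oeq_refl by blast
  qed (use D_cnormal R_cnormal in blast)+
  then show ?thesis using c(2) ocj_trans by blast
qed

section \<open>Cyclic words\<close>

definition conjugate :: "free2 \<Rightarrow> free2 \<Rightarrow> bool" where
  "conjugate x y \<longleftrightarrow> (\<exists>g. y = cj g x)"

lemma conjugate_refl [simp]: "conjugate x x"
  unfolding conjugate_def by (rule exI[of _ 0]) simp

lemma conjugate_cj: "conjugate x (cj g x)" "conjugate (cj g x) x"
  unfolding conjugate_def by (blast, rule exI[of _ "- g"], simp)

lemma conjugate_sym: "conjugate x y \<Longrightarrow> conjugate y x"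
  unfolding conjugate_def by (metis cj_eq_iff)

lemma conjugate_trans [trans]: "conjugate x y \<Longrightarrow> conjugate y z \<Longrightarrow> conjugate x z"
  unfolding conjugate_def by (metis cj_simps(3))

lemma conjugate_map: "ghom f \<Longrightarrow> conjugate x y \<Longrightarrow> conjugate (f x) (f y)"
  unfolding conjugate_def by (metis ghom_cj_map)

lemma conjugate_oeq: "f \<approx> g \<Longrightarrow> conjugate (f x) (g x)"
  by (auto simp: oeq_def conjugate_cj)

lemma conjugate_rotation: "conjugate (ev (p @ q)) (ev (q @ p))"
proof -
  have "ev (q @ p) = cj (- ev p) (ev (p @ q))" by (simp add: cj_def add.assoc)
  then show ?thesis unfolding conjugate_def by blast
qed

lemma cred_rotation: "cred (p @ q) \<Longrightarrow> cred (q @ p)"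
  by (cases "p = []"; cases "q = []") (auto simp: cred_def reduced_append)

text \<open>Induction on the conjugator: if its last letter cancels at one end of \<open>u\<close>,
  conjugating by that letter only rotates \<open>u\<close>.\<close>

theorem cred_conjugate:
  assumes "cred u" "cred v" "conjugate (ev u) (ev v)"
  shows "\<exists>p q. u = p @ q \<and> v = q @ p"
proof -
  obtain g where "ev v = cj g (ev u)" using assms(3) by (auto simp: conjugate_def)
  then show ?thesis using assms(1)
  proof (induction "len g" arbitrary: g u rule: less_induct)
    case less
    have ru: "reduced u" and rv: "reduced v" using less.prems assms(2) cred_reduced by auto
    show ?case
    proof (cases "u = [] \<or> g = 0")
      case True
      then have "ev v = ev u" using less.prems by auto
      then have "v = u" using ru rv ev_inject by blast
      then show ?thesis by (metis append_Nil append_Nil2)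
    next
      case False
      then obtain w l where w: "rw g = w @ [l]"
        by (metis ev_rw ev_simps(1) rev_exhaust)
      then have rwl: "reduced (w @ [l])" by (metis reduced_rw)
      then have "reduced w" by (simp add: reduced_append)
      have g: "g = ev w + lt l"
        using w by (metis add.right_neutral ev_rw ev_simps(1,2,3))
      have lg: "len (ev w) < len g"
        using w len_ev_le[of w] by (simp add: len_def)
      have IH: "\<exists>p q. u' = p @ q \<and> v = q @ p" if "ev u' = cj (lt l) (ev u)" "cred u'" for u'
        using less.hyps[OF lg _ that(2)] less.prems(1) that(1) by (simp add: g)
      show ?thesis
      proof (cases "last u = l")
        case True
        then obtain u1 where u1: "u = u1 @ [l]" using False by (metis append_butlast_last_id)
        have "ev ([l] @ u1) = cj (lt l) (ev u)" by (simp add: u1 cj_def add.assoc)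
        moreover have "cred ([l] @ u1)" using less.prems(2) u1 cred_rotation by blast
        ultimately obtain p q where pq: "[l] @ u1 = p @ q" "v = q @ p" using IH by blast
        show ?thesis
        proof (cases p)
          case Nil
          then show ?thesis using pq u1 by (intro exI[of _ u1] exI[of _ "[l]"]) simp
        next
          case (Cons x p')
          then have "u = p' @ (q @ [l])" "v = (q @ [l]) @ p'" using pq u1 by simp_all
          then show ?thesis by blast
        qed
      next
        case nl: False
        show ?thesis
        proof (cases "hd u = inv_letter l")
          case True
          then obtain u1 where u1: "u = [inv_letter l] @ u1" using False by (cases u) auto
          have "ev (u1 @ [inv_letter l]) = cj (lt l) (ev u)"
            by (simp add: u1 cj_def add.assoc)
          moreover have "cred (u1 @ [inv_letter l])" using less.prems(2) u1 cred_rotation by blast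
          ultimately obtain p q where pq: "u1 @ [inv_letter l] = p @ q" "v = q @ p" using IH by blast
          show ?thesis
          proof (cases q rule: rev_cases)
            case Nil
            then show ?thesis using pq u1 by (intro exI[of _ "[inv_letter l]"] exI[of _ u1]) simp
          next
            case (snoc q' x)
            then have "u = (inv_letter l # p) @ q'" "v = q' @ (inv_letter l # p)"
              using pq u1 by simp_all
            then show ?thesis by blast
          qed
        next
          case nh: False
          \<comment> \<open>Here neither end of \<open>u\<close> absorbs \<open>l\<close>, so the
            conjugate is reduced as written; its first and last letters are mutually inverse,
            against \<open>cred v\<close>.\<close>
          have "reduced (u @ inv_word (w @ [l]))"
            using reduced_append[of u "inv_word (w @ [l])"] ru nl rwl False
              reduced_inv_word[of "w @ [l]"] by simp
          then have "reduced ((w @ [l]) @ (u @ inv_word (w @ [l])))"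
            using reduced_append[of "w @ [l]" "u @ inv_word (w @ [l])"] rwl nh False
            by (simp add: hd_append)
          then have "reduced (w @ [l] @ u @ inv_word (w @ [l]))" by simp
          moreover have "ev v = ev (w @ [l] @ u @ inv_word (w @ [l]))"
            using less.prems(1) by (simp add: g cj_def grp)
          ultimately have v: "v = w @ [l] @ u @ inv_word (w @ [l])"
            using rv ev_inject by blast
          have "hd v = hd (w @ [l])" by (simp add: v hd_append)
          moreover have "last v = inv_letter (hd (w @ [l]))"
            using last_inv_word[of "w @ [l]"] by (simp add: v last_append)
          ultimately have "\<not> cred v" by (simp add: cred_iff v)
          then show ?thesis using assms(2) by blast
        qed
      qed
    qed
  qed
qed

fun psum :: "('a \<Rightarrow> 'a \<Rightarrow> int) \<Rightarrow> 'a list \<Rightarrow> int" where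
  "psum f (x # y # zs) = f x y + psum f (y # zs)"
| "psum f _ = 0"

lemma psum_append: "psum f (xs @ x # ys) = psum f (xs @ [x]) + psum f (x # ys)"
proof (induction xs)
  case (Cons z zs)
  then show ?case by (cases zs) auto
qed simp

text \<open>Closing up with the first letter makes this a function of the cyclic word. For the empty
  list \<open>hd []\<close> is harmless, since \<open>psum\<close> vanishes on singletons.\<close>

definition csum :: "('a \<Rightarrow> 'a \<Rightarrow> int) \<Rightarrow> 'a list \<Rightarrow> int" where
  "csum f u = psum f (u @ [hd u])"

lemma csum_rotation: "csum f (p @ q) = csum f (q @ p)"
proof (cases p)
  case p: (Cons x p')
  show ?thesis
  proof (cases q)
    case (Cons y q')
    have "csum f (p @ q) = psum f (p @ [y]) + psum f (q @ [x])"
      using psum_append[of f p y "q' @ [x]"] by (simp add: csum_def p Cons)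
    moreover have "csum f (q @ p) = psum f (q @ [x]) + psum f (p @ [y])"
      using psum_append[of f q x "p' @ [y]"] by (simp add: csum_def p Cons)
    ultimately show ?thesis by simp
  qed simp
qed simp

lemma csum_conjugate: "cred u \<Longrightarrow> cred v \<Longrightarrow> conjugate (ev u) (ev v) \<Longrightarrow> csum f u = csum f v"
  using cred_conjugate csum_rotation by metis

lemma length_conjugate: "cred u \<Longrightarrow> cred v \<Longrightarrow> conjugate (ev u) (ev v) \<Longrightarrow> length u = length v"
  using cred_conjugate by (metis add.commute length_append)

definition sg :: "bool \<Rightarrow> int" where
  "sg e = (if e then -1 else 1)"

text \<open>Signed corners. A positive twist tends to lengthen corners of value 1, such as a b, and
  to shorten those of value -1, such as a b^-1; around a cyclic word every corner accounts for half
  a letter of the change of length.\<close>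

definition mixed :: "letter \<Rightarrow> letter \<Rightarrow> int" where
  "mixed l m = (if fst l = fst m then 0 else sg (snd l) * sg (snd m))"

definition dbl :: "gen \<Rightarrow> letter \<Rightarrow> letter \<Rightarrow> int" where
  "dbl g l m = (if fst l = g \<and> m = l then 1 else 0)"

subsection \<open>Gap form\<close>

definition bz :: "int \<Rightarrow> letter list" where
  "bz k = replicate (nat \<bar>k\<bar>) (Gen_B, k < 0)"

lemma bz_0 [simp]: "bz 0 = []"
  by (simp add: bz_def)

lemma bz_eq_Nil [simp]: "bz k = [] \<longleftrightarrow> k = 0"
  by (simp add: bz_def)

lemma length_bz [simp]: "length (bz k) = nat \<bar>k\<bar>"
  by (simp add: bz_def)

lemma ev_bz_Suc: "ev (bz (k + 1)) = ev (bz k) + gen_b"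
proof (cases "k \<ge> 0")
  case True
  then have "nat \<bar>k + 1\<bar> = nat \<bar>k\<bar> + 1" by simp
  then have "bz (k + 1) = bz k @ [(Gen_B, False)]"
    using True unfolding bz_def by (simp only: replicate_add) simp
  then show ?thesis by (simp add: lt_gen)
next
  case False
  then have "nat \<bar>k\<bar> = nat \<bar>k + 1\<bar> + 1" by simp
  then have "bz k = replicate (nat \<bar>k + 1\<bar>) (Gen_B, True) @ [(Gen_B, True)]"
    using False unfolding bz_def by (simp only: replicate_add) simp
  moreover have "replicate (nat \<bar>k + 1\<bar>) (Gen_B, True) = bz (k + 1)"
    using False by (cases "k + 1 = 0") (simp_all add: bz_def)
  ultimately have "bz k = bz (k + 1) @ [(Gen_B, True)]" by simp
  then show ?thesis by (simp add: add.assoc gen_lt)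
qed

lemma ev_bz_add: "ev (bz (j + k)) = ev (bz j) + ev (bz k)"
proof (induction k rule: int_induct[where k = 0])
  case base
  show ?case by simp
next
  case (step1 i)
  then show ?case using ev_bz_Suc[of "j + i"] ev_bz_Suc[of i] by (simp add: add.assoc)
next
  case (step2 i)
  have "ev (bz (j + (i - 1))) + gen_b = ev (bz j) + (ev (bz (i - 1)) + gen_b)"
    using step2 ev_bz_Suc[of "j + (i - 1)"] ev_bz_Suc[of "i - 1"] by simp
  then show ?case by (metis add.assoc add_right_cancel)
qed

lemma ev_bz_minus: "ev (bz (- k)) = - ev (bz k)"
  using ev_bz_add[of "- k" k] by (simp add: eq_neg_iff_add_eq_0)

lemma reduced_bz [simp]: "reduced (bz k)"
proof -
  have "reduced (replicate n (Gen_B, e))" for n e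
    by (induction n) (auto simp: reduced_Cons inv_letter_def)
  then show ?thesis by (simp add: bz_def)
qed

lemma hd_bz: "k \<noteq> 0 \<Longrightarrow> hd (bz k) = (Gen_B, k < 0)" "k \<noteq> 0 \<Longrightarrow> last (bz k) = (Gen_B, k < 0)"
  by (simp_all add: bz_def)

text \<open>
  The list \<open>[(e\<^sub>1, k\<^sub>1), \<dots>, (e\<^sub>n, k\<^sub>n)]\<close> stands for
  \<open>a\<^bsup>\<plusminus>1\<^esup> b\<^bsup>k\<^sub>1\<^esup> \<dots> a\<^bsup>\<plusminus>1\<^esup> b\<^bsup>k\<^sub>n\<^esup>\<close>. The exponent \<open>k\<^sub>i\<close> is the gap between two
  consecutive occurrences of the first generator, and a twist only shifts these gaps. The extra
  argument \<open>z\<close> of the functions below is the sign of the occurrence that follows the last gap.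
\<close>

type_synonym gaps = "(bool \<times> int) list"

fun flat :: "gaps \<Rightarrow> letter list" where
  "flat [] = []"
| "flat ((e, k) # gs) = (Gen_A, e) # bz k @ flat gs"

lemma flat_append [simp]: "flat (gs @ hs) = flat gs @ flat hs"
  by (induction gs rule: flat.induct) auto

lemma flat_eq_Nil [simp]: "flat gs = [] \<longleftrightarrow> gs = []"
  by (cases gs) auto

definition nx :: "gaps \<Rightarrow> bool \<Rightarrow> bool" where
  "nx gs z = (if gs = [] then z else fst (hd gs))"

lemma nx_simps [simp]: "nx [] z = z" "nx (g # gs) z = fst g"
  by (simp_all add: nx_def)

lemma hd_flat: "hd (flat gs @ [(Gen_A, z)]) = (Gen_A, nx gs z)"
  by (cases gs) auto

fun good :: "gaps \<Rightarrow> bool \<Rightarrow> bool" where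
  "good [] z = True"
| "good ((e, k) # gs) z \<longleftrightarrow> (e \<noteq> nx gs z \<longrightarrow> k \<noteq> 0) \<and> good gs z"

lemma reduced_flat_iff: "reduced (flat gs @ [(Gen_A, z)]) \<longleftrightarrow> good gs z"
proof (induction gs)
  case Nil
  show ?case by (simp add: reduced_Cons)
next
  case (Cons g gs)
  obtain e k where g: "g = (e, k)" by fastforce
  let ?v = "flat gs @ [(Gen_A, z)]"
  have hv: "hd ?v = (Gen_A, nx gs z)" by (rule hd_flat)
  show ?case
  proof (cases "k = 0")
    case True
    then show ?thesis using Cons hv by (auto simp: g reduced_Cons inv_letter_def)
  next
    case False
    have "reduced (bz k @ ?v) \<longleftrightarrow> reduced ?v"
      using False hd_bz[OF False] hv by (auto simp: reduced_append[of "bz k"] inv_letter_def)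
    moreover have "hd (bz k @ ?v) = (Gen_B, k < 0)" using False hd_bz[OF False] by simp
    ultimately show ?thesis using Cons False by (auto simp: g reduced_Cons inv_letter_def)
  qed
qed

lemma good_reduced: "good gs z \<Longrightarrow> reduced (flat gs)"
  using reduced_flat_iff[of gs z] by (simp add: reduced_append)

lemma cred_flat: "gs \<noteq> [] \<Longrightarrow> cred (flat gs) \<longleftrightarrow> good gs (fst (hd gs))"
proof -
  assume gs: "gs \<noteq> []"
  then have h: "hd (flat gs) = (Gen_A, fst (hd gs))" by (cases gs) auto
  have "cred (flat gs) \<longleftrightarrow> reduced (flat gs @ [hd (flat gs)])"
    using gs by (auto simp: cred_iff reduced_append reduced_Cons)
  then show ?thesis by (simp add: h reduced_flat_iff)
qed

lemma parse_flat:
  assumes "reduced u" "u = [] \<or> fst (hd u) = Gen_A"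
  shows "\<exists>gs. u = flat gs"
  using assms
proof (induction u rule: rev_induct)
  case Nil
  show ?case by (rule exI[of _ "[]"]) simp
next
  case (snoc l u)
  show ?case
  proof (cases "u = []")
    case True
    then have "u @ [l] = flat [(snd l, 0)]" using snoc.prems(2) by (cases l) simp
    then show ?thesis by blast
  next
    case False
    then obtain gs where gs: "u = flat gs"
      using snoc by (auto simp: reduced_append)
    show ?thesis
    proof (cases "fst l")
      case Gen_A
      then have "u @ [l] = flat (gs @ [(snd l, 0)])" using gs by (cases l) simp
      then show ?thesis by blast
    next
      case Gen_B
      then obtain s where l: "l = (Gen_B, s)" by (cases l) auto
      obtain hs e k where hs: "gs = hs @ [(e, k)]"
        using gs False by (metis flat.simps(1) rev_exhaust surj_pair)
      have "reduced (bz k @ [(Gen_B, s)])"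
        using snoc.prems(1) reduced_append[of "flat hs" "(Gen_A, e) # bz k @ [(Gen_B, s)]"]
        by (simp add: gs hs l reduced_Cons)
      then have "k \<noteq> 0 \<longrightarrow> (k < 0) = s"
        using hd_bz(2)[of k] reduced_append[of "bz k" "[(Gen_B, s)]"]
        by (auto simp: inv_letter_def)
      then have "nat \<bar>k + sg s\<bar> = Suc (nat \<bar>k\<bar>)" "k + sg s < 0 \<longleftrightarrow> s"
        "k \<noteq> 0 \<longrightarrow> (k < 0 \<longleftrightarrow> s)"
        by (cases s; cases "k = 0"; simp add: sg_def)+
      then have "bz k @ [(Gen_B, s)] = bz (k + sg s)"
        by (cases "k = 0") (simp_all add: bz_def replicate_append_same)
      then have "u @ [l] = flat (hs @ [(e, k + sg s)])" by (simp add: gs hs l)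
      then show ?thesis by blast
    qed
  qed
qed

fun gsum :: "(bool \<Rightarrow> int \<Rightarrow> bool \<Rightarrow> int) \<Rightarrow> gaps \<Rightarrow> bool \<Rightarrow> int" where
  "gsum f [] z = 0"
| "gsum f ((e, k) # gs) z = f e k (nx gs z) + gsum f gs z"

lemma psum_flat:
  assumes F: "\<And>e k e'. psum f ((Gen_A, e) # bz k @ [(Gen_A, e')]) = F e k e'"
  shows "psum f (flat gs @ [(Gen_A, z)]) = gsum F gs z"
proof (induction gs)
  case (Cons g gs)
  obtain e k where g: "g = (e, k)" by fastforce
  have "flat gs @ [(Gen_A, z)] = (Gen_A, nx gs z) # tl (flat gs @ [(Gen_A, z)])"
    using hd_flat[of gs z] by (metis append_is_Nil_conv list.collapse not_Cons_self2)
  then show ?case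
    using psum_append[of f "(Gen_A, e) # bz k" "(Gen_A, nx gs z)" "tl (flat gs @ [(Gen_A, z)])"]
      Cons F by (simp add: g)
qed simp

lemma psum_replicate: "psum f (replicate (Suc n) x) = int n * f x x"
  by (induction n) (simp_all add: algebra_simps)

lemma psum_block:
  "psum f ((Gen_A, e) # bz k @ [(Gen_A, e')]) = (if k = 0 then f (Gen_A, e) (Gen_A, e')
     else f (Gen_A, e) (Gen_B, k < 0) + (\<bar>k\<bar> - 1) * f (Gen_B, k < 0) (Gen_B, k < 0)
       + f (Gen_B, k < 0) (Gen_A, e'))"
proof (cases "k = 0")
  case False
  let ?x = "(Gen_B, k < 0)"
  obtain n where n: "nat \<bar>k\<bar> = Suc n" using False by (metis gr0_implies_Suc zero_less_abs_iff zero_less_nat_eq)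
  then have bz: "bz k = replicate n ?x @ [?x]"
    by (simp add: bz_def replicate_append_same)
  have "psum f ((Gen_A, e) # bz k @ [(Gen_A, e')]) = psum f ((Gen_A, e) # bz k) + f ?x (Gen_A, e')"
    using psum_append[of f "(Gen_A, e) # replicate n ?x" ?x "[(Gen_A, e')]"] by (simp add: bz)
  also have "psum f ((Gen_A, e) # bz k) = f (Gen_A, e) ?x + psum f (bz k)"
    by (simp add: bz_def n)
  also have "psum f (bz k) = int n * f ?x ?x"
    using psum_replicate[of f n ?x] by (simp add: bz_def n del: replicate_Suc)
  finally show ?thesis using False n by auto
qed simp

text \<open>Half of \<open>sg e + sg e'\<close>, which is the shift that \<open>sigma\<close> gives
  to a gap between occurrences of signs \<open>e\<close> and \<open>e'\<close>.\<close>

definition csgn :: "bool \<Rightarrow> bool \<Rightarrow> int" where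
  "csgn e e' = (if e \<noteq> e' then 0 else sg e)"

lemma csum_flat:
  assumes "gs \<noteq> []"
  defines "z \<equiv> fst (hd gs)"
  shows "csum mixed (flat gs) = 2 * gsum (\<lambda>e k e'. csgn e e' * sgn k) gs z"
    "good gs z \<Longrightarrow> csum (dbl Gen_A) (flat gs) = gsum (\<lambda>e k e'. if k = 0 then 1 else 0) gs z"
    "csum (dbl Gen_B) (flat gs) = gsum (\<lambda>e k e'. if k = 0 then 0 else \<bar>k\<bar> - 1) gs z"
    "int (length (flat gs)) = gsum (\<lambda>e k e'. 1 + \<bar>k\<bar>) gs z"
proof -
  have h: "hd (flat gs) = (Gen_A, z)" using assms by (cases gs) auto
  have "gsum (\<lambda>e k e'. 2 * (csgn e e' * sgn k)) hs z = 2 * gsum (\<lambda>e k e'. csgn e e' * sgn k) hs z" for hs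
    by (induction hs) auto
  \<comment> \<open>A nonzero gap has a corner at each end, and together they contribute
    \<open>sgn k * (sg e + sg e')\<close>; hence the factor 2.\<close>
  moreover have "psum mixed (flat gs @ [(Gen_A, z)]) = gsum (\<lambda>e k e'. 2 * (csgn e e' * sgn k)) gs z"
    by (rule psum_flat) (auto simp: psum_block mixed_def csgn_def sg_def sgn_if)
  ultimately show "csum mixed (flat gs) = 2 * gsum (\<lambda>e k e'. csgn e e' * sgn k) gs z"
    by (simp add: csum_def h)
  have "psum (dbl Gen_B) (flat gs @ [(Gen_A, z)]) = gsum (\<lambda>e k e'. if k = 0 then 0 else \<bar>k\<bar> - 1) gs z"
    by (rule psum_flat) (auto simp: psum_block dbl_def)
  then show "csum (dbl Gen_B) (flat gs) = gsum (\<lambda>e k e'. if k = 0 then 0 else \<bar>k\<bar> - 1) gs z"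
    by (simp add: csum_def h)
  have "int (length (flat hs)) = gsum (\<lambda>e k e'. 1 + \<bar>k\<bar>) hs z" for hs
    by (induction hs) auto
  then show "int (length (flat gs)) = gsum (\<lambda>e k e'. 1 + \<bar>k\<bar>) gs z" .
  have "psum (dbl Gen_A) (flat gs @ [(Gen_A, z)])
      = gsum (\<lambda>e k e'. if k = 0 \<and> e = e' then 1 else 0) gs z"
    by (rule psum_flat) (auto simp: psum_block dbl_def)
  moreover have "good hs z \<Longrightarrow> gsum (\<lambda>e k e'. if k = 0 \<and> e = e' then 1 else 0) hs z
      = gsum (\<lambda>e k e'. if k = 0 then 1 else 0) hs z" for hs
    by (induction hs) auto
  ultimately show "good gs z \<Longrightarrow> csum (dbl Gen_A) (flat gs) = gsum (\<lambda>e k e'. if k = 0 then 1 else 0) gs z"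
    by (simp add: csum_def h)
qed

subsection \<open>Twists in gap form\<close>

definition Tw :: "int \<Rightarrow> int \<Rightarrow> free2 \<Rightarrow> free2" where
  "Tw i m = endo (ev (bz i) + gen_a + ev (bz m)) gen_b"

definition pre :: "int \<Rightarrow> int \<Rightarrow> bool \<Rightarrow> int" where
  "pre i m e = (if e then - m else i)"

definition post :: "int \<Rightarrow> int \<Rightarrow> bool \<Rightarrow> int" where
  "post i m e = (if e then - i else m)"

text \<open>\<open>r\<close> is what the next occurrence of the first generator adds to the last
  gap: \<open>pre i m z\<close> when the word is read cyclically, 0 when nothing follows.\<close>

fun shift :: "int \<Rightarrow> int \<Rightarrow> gaps \<Rightarrow> int \<Rightarrow> gaps" where
  "shift i m [] r = []"
| "shift i m ((e, k) # gs) r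
     = (e, k + post i m e + (if gs = [] then r else pre i m (fst (hd gs)))) # shift i m gs r"

lemma shift_eq_Nil [simp]: "shift i m gs r = [] \<longleftrightarrow> gs = []"
  by (cases gs) auto

lemma hd_shift: "gs \<noteq> [] \<Longrightarrow> fst (hd (shift i m gs r)) = fst (hd gs)"
  by (cases gs) auto

lemma nx_shift [simp]: "nx (shift i m gs r) z = nx gs z"
  by (cases gs) auto

lemma ghom_Tw [simp]: "ghom (Tw i m)"
  by (simp add: Tw_def)

lemma Tw_bz [simp]: "Tw i m (ev (bz k)) = ev (bz k)"
proof -
  have "Tw i m (ev u) = ev u" if "set u \<subseteq> {(Gen_B, False), (Gen_B, True)}" for u
  proof -
    have "Tw i m (lt (Gen_B, False)) = lt (Gen_B, False)" by (simp add: Tw_def flip: gen_lt)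
    then show ?thesis
      using that by (induction u) (auto simp: ghom_simps)
  qed
  moreover have "set (bz k) \<subseteq> {(Gen_B, False), (Gen_B, True)}"
    by (auto simp: bz_def)
  ultimately show ?thesis by blast
qed

lemma Tw_lt_A: "Tw i m (lt (Gen_A, e)) = ev (bz (pre i m e)) + lt (Gen_A, e) + ev (bz (post i m e))"
  by (simp add: Tw_def lt_gen pre_def post_def ev_bz_minus grp)

lemma Tw_flat:
  assumes "gs \<noteq> []"
  shows "Tw i m (ev (flat gs)) + ev (bz r)
    = ev (bz (pre i m (fst (hd gs)))) + ev (flat (shift i m gs r))"
  using assms
proof (induction gs)
  case (Cons g gs)
  obtain e k where g: "g = (e, k)" by fastforce
  have T: "Tw i m (ev (flat (g # gs))) + ev (bz r) = ev (bz (pre i m e)) + lt (Gen_A, e)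
      + ev (bz (k + post i m e)) + (Tw i m (ev (flat gs)) + ev (bz r))"
    by (simp add: g ghom_add Tw_lt_A add.assoc ev_bz_add add.commute[of k])
  show ?case
  proof (cases "gs = []")
    case True
    then show ?thesis using T by (simp add: g ev_bz_add add.assoc ghom_0)
  next
    case False
    then show ?thesis
      unfolding T Cons.IH[OF False] by (simp add: g ev_bz_add add.assoc)
  qed
qed simp

text \<open>Between occurrences of opposite signs the two contributions cancel. These are the gaps
  that must be nonzero for reducedness, so twists preserve \<open>good\<close>.\<close>

lemma pre_post: "e \<noteq> e' \<Longrightarrow> post i m e + pre i m e' = 0"
  by (auto simp: pre_def post_def)

lemma good_shift: "good gs z \<Longrightarrow> good (shift i m gs (pre i m z)) z"
proof (induction gs)
  case (Cons g gs)
  obtain e k where g: "g = (e, k)" by fastforce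
  have "shift i m (g # gs) (pre i m z)
      = (e, k + post i m e + pre i m (nx gs z)) # shift i m gs (pre i m z)"
    by (simp add: g nx_def)
  then show ?case using Cons pre_post[of e "nx gs z" i m] by (auto simp: g)
qed simp

lemma gsum_shift:
  "gsum f (shift i m gs (pre i m z)) z = gsum (\<lambda>e k e'. f e (k + post i m e + pre i m e') e') gs z"
proof (induction gs)
  case (Cons g gs)
  then show ?case by (cases g; cases gs) auto
qed simp

lemma Tw_conjugate:
  assumes "gs \<noteq> []"
  shows "conjugate (ev (flat (shift i m gs (pre i m (fst (hd gs)))))) (Tw i m (ev (flat gs)))"
proof -
  let ?p = "ev (bz (pre i m (fst (hd gs))))"
  have "Tw i m (ev (flat gs)) = (Tw i m (ev (flat gs)) + ?p) + - ?p" by (simp add: add.assoc)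
  also have "\<dots> = cj ?p (ev (flat (shift i m gs (pre i m (fst (hd gs))))))"
    by (simp only: Tw_flat[OF assms] cj_def)
  finally have "Tw i m (ev (flat gs)) = cj ?p (ev (flat (shift i m gs (pre i m (fst (hd gs))))))" .
  then show ?thesis by (simp add: conjugate_cj)
qed

section \<open>Classes fixed by positive words in both twists\<close>

definition cyc :: "'a list \<Rightarrow> nat \<Rightarrow> 'a" where
  "cyc u i = u ! (i mod length u)"

text \<open>When this holds for both generators, the cyclic word has period four and spells out a
  commutator of two letters.\<close>

definition alternates :: "gen \<Rightarrow> letter list \<Rightarrow> bool" where
  "alternates g u \<longleftrightarrow> (\<forall>i. fst (cyc u i) = g \<longrightarrow>
     fst (cyc u (i + 1)) \<noteq> g \<and> cyc u (i + 2) = inv_letter (cyc u i))"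

lemma cyc_rotation:
  assumes "p @ q \<noteq> []"
  shows "cyc (q @ p) i = cyc (p @ q) (length p + i)"
proof -
  have "rotate (length p) (p @ q) ! (i mod length (p @ q))
      = (p @ q) ! ((length p + i mod length (p @ q)) mod length (p @ q))"
    using assms by (intro nth_rotate) simp
  then show ?thesis
    by (simp add: cyc_def rotate_append add.commute[of "length q"] mod_add_right_eq)
qed

lemma alternates_rotation: "alternates g (p @ q) \<Longrightarrow> alternates g (q @ p)"
  by (cases "p @ q = []") (simp_all add: alternates_def cyc_rotation flip: add.assoc)

fun gall :: "(bool \<Rightarrow> int \<Rightarrow> bool \<Rightarrow> bool) \<Rightarrow> gaps \<Rightarrow> bool \<Rightarrow> bool" where
  "gall P [] z = True"
| "gall P ((e, k) # gs) z \<longleftrightarrow> P e k (nx gs z) \<and> gall P gs z"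

lemma gall_mono: "gall P gs z \<Longrightarrow> (\<And>e k e'. P e k e' \<Longrightarrow> Q e k e') \<Longrightarrow> gall Q gs z"
  by (induction gs) auto

lemma gall_mono2:
  "gall P gs z \<Longrightarrow> gall Q gs z \<Longrightarrow> (\<And>e k e'. P e k e' \<Longrightarrow> Q e k e' \<Longrightarrow> R e k e') \<Longrightarrow> gall R gs z"
  by (induction gs) auto

lemma gsum_nonneg: "gall (\<lambda>e k e'. 0 \<le> f e k e') gs z \<Longrightarrow> 0 \<le> gsum f gs z"
  by (induction gs) auto

lemma gsum_0: "gall (\<lambda>e k e'. 0 \<le> f e k e') gs z \<Longrightarrow> gsum f gs z = 0 \<Longrightarrow> gall (\<lambda>e k e'. f e k e' = 0) gs z"
proof (induction gs)
  case (Cons g gs)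
  then show ?case using gsum_nonneg[of f gs z] by (cases g) auto
qed simp

lemma gall_True: "gall (\<lambda>e k e'. True) gs z"
  by (induction gs) auto

lemma gsum_uminus: "gsum (\<lambda>e k e'. - f e k e') gs z = - gsum f gs z"
  by (induction gs) auto

lemma gsum_linear: "gsum (\<lambda>e k e'. f e k e' + g e k e') gs z = gsum f gs z + gsum g gs z"
  "gsum (\<lambda>e k e'. c * f e k e') gs z = c * gsum f gs z"
  by (induction gs) (auto simp: algebra_simps)

lemma flat_alternating_nth:
  assumes "gall (\<lambda>e k e'. \<bar>k\<bar> = 1 \<and> e \<noteq> e') gs z" "i < length (flat gs)"
    "fst ((flat gs @ [(Gen_A, z)]) ! i) = Gen_A"
  shows "i + 2 \<le> length (flat gs) \<and> fst ((flat gs @ [(Gen_A, z)]) ! (i + 1)) \<noteq> Gen_A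
    \<and> (flat gs @ [(Gen_A, z)]) ! (i + 2) = inv_letter ((flat gs @ [(Gen_A, z)]) ! i)"
  using assms
proof (induction gs arbitrary: i)
  case (Cons g gs)
  obtain e k where g: "g = (e, k)" by fastforce
  have k: "\<bar>k\<bar> = 1" "e \<noteq> nx gs z" using Cons.prems(1) by (auto simp: g)
  then have bz: "bz k = [(Gen_B, k < 0)]" by (simp add: bz_def)
  have hd: "(flat gs @ [(Gen_A, z)]) ! 0 = (Gen_A, nx gs z)"
    using hd_flat[of gs z] by (simp add: hd_conv_nth)
  consider "i = 0" | "i = 1" | j where "i = Suc (Suc j)"
    by (metis One_nat_def not0_implies_Suc)
  then show ?case
  proof cases
    case 1
    then show ?thesis using hd k by (auto simp: g bz inv_letter_def)
  next
    case 2
    then show ?thesis using Cons.prems(3) by (simp add: g bz)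
  next
    case 3
    then show ?thesis using Cons.IH[of j] Cons.prems by (auto simp: g bz)
  qed
qed simp

lemma flat_alternates:
  assumes gs: "gs \<noteq> []" and g: "gall (\<lambda>e k e'. \<bar>k\<bar> = 1 \<and> e \<noteq> e') gs (fst (hd gs))"
  shows "alternates Gen_A (flat gs)"
proof -
  define u where "u = flat gs"
  define n where "n = length u"
  have n: "n > 0" using gs by (simp add: n_def u_def)
  define z where "z = fst (hd gs)"
  define w where "w = u @ [(Gen_A, z)]"
  have h: "u ! 0 = (Gen_A, z)" using gs by (cases gs) (auto simp: u_def z_def)
  have wn: "w ! j = u ! (j mod n)" if "j \<le> n" for j
    using that h n by (cases "j = n") (simp_all add: w_def n_def nth_append)
  show ?thesis
    unfolding alternates_def
  proof (intro allI impI)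
    fix i
    define j where "j = i mod n"
    have j: "j < n" using n by (simp add: j_def)
    assume "fst (cyc (flat gs) i) = Gen_A"
    then have "fst (w ! j) = Gen_A"
      using j wn[of j] by (simp add: cyc_def u_def[symmetric] n_def[symmetric] j_def)
    then have *: "j + 2 \<le> n" "fst (w ! (j + 1)) \<noteq> Gen_A" "w ! (j + 2) = inv_letter (w ! j)"
      using flat_alternating_nth[OF g, of j] j by (simp_all add: w_def u_def n_def z_def)
    have eq: "Suc i mod n = Suc j mod n" "Suc (Suc i) mod n = Suc (Suc j) mod n"
      by (metis j_def mod_Suc_eq)+
    from * show "fst (cyc (flat gs) (i + 1)) \<noteq> Gen_A \<and>
        cyc (flat gs) (i + 2) = inv_letter (cyc (flat gs) i)"
      using wn[of j] wn[of "j + 1"] wn[of "j + 2"] j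
      unfolding cyc_def u_def[symmetric] n_def[symmetric]
      by (simp add: j_def[symmetric] eq)
  qed
qed

lemma sigma_Tw: "sigma = Tw 0 1"
  by (simp add: sigma_def Tw_def bz_def gen_lt)

lemma post_pre_01: "post 0 1 e + pre 0 1 e' = csgn e e'"
  by (simp add: post_def pre_def csgn_def sg_def)

text \<open>
  Both quantities are read off the cyclic word. Along a positive word of twists \<open>mixing\<close> does
  not decrease, and while it is constant the length changes by half of it with every twist. So in a
  class that returns to itself \<open>mixing\<close> vanishes and no doubled letters occur, and the class
  consists of powers of the commutator.
\<close>

abbreviation doubles :: "gen \<Rightarrow> letter list \<Rightarrow> int" where
  "doubles g u \<equiv> csum (dbl g) u"

abbreviation mixing :: "letter list \<Rightarrow> int" where
  "mixing u \<equiv> csum mixed u"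

lemma psum_nonneg: "(\<And>x y. 0 \<le> f x y) \<Longrightarrow> 0 \<le> psum f xs"
  by (induction f xs rule: psum.induct) auto

lemma doubles_nonneg: "0 \<le> doubles g u"
  unfolding csum_def by (rule psum_nonneg) (simp add: dbl_def)

text \<open>\<open>g\<close> is the generator moved by the twist, \<open>h\<close> the fixed one.
  The equations record what a shift of the gaps does to length and mixing; the last clause describes
  the stationary case, in which the occurrences of \<open>g\<close> alternate in sign.\<close>

definition step :: "gen \<Rightarrow> gen \<Rightarrow> letter list \<Rightarrow> letter list \<Rightarrow> bool" where
  "step g h u v \<longleftrightarrow> cred v \<and> v \<noteq> []
    \<and> 2 * int (length v) = 2 * int (length u) + 2 * doubles g u + mixing u
    \<and> mixing v = mixing u + 2 * doubles g u + 2 * doubles g v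
    \<and> (doubles g u = 0 \<longrightarrow> doubles g v = 0 \<longrightarrow> mixing u = 0 \<longrightarrow>
        (doubles h u = 0 \<longrightarrow> alternates g u) \<and> (doubles h v = 0 \<longrightarrow> alternates g v))"

lemma step_flat:
  assumes gs: "gs \<noteq> []" and good: "good gs (fst (hd gs))"
  defines "hs \<equiv> shift 0 1 gs (pre 0 1 (fst (hd gs)))"
  shows "step Gen_A Gen_B (flat gs) (flat hs)"
proof -
  define z where "z = fst (hd gs)"
  have hs: "hs \<noteq> []" "fst (hd hs) = z" using gs by (simp_all add: hs_def z_def hd_shift)
  have goodh: "good hs z" using good_shift[OF good] by (simp add: hs_def z_def)
  have sh: "gsum f hs z = gsum (\<lambda>e k e'. f e (k + csgn e e') e') gs z" for f
    unfolding hs_def z_def gsum_shift by (simp add: add.assoc post_pre_01)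
  have shA: "gall P hs z \<longleftrightarrow> gall (\<lambda>e k e'. P e (k + csgn e e') e') gs z" for P
  proof -
    have "gall P (shift 0 1 gs (pre 0 1 z)) z \<longleftrightarrow> gall (\<lambda>e k e'. P e (k + csgn e e') e') gs z" for gs
    proof (induction gs)
      case (Cons g gs)
      obtain e k where g: "g = (e, k)" by fastforce
      have eq: "shift 0 1 (g # gs) (pre 0 1 z) = (e, k + csgn e (nx gs z)) # shift 0 1 gs (pre 0 1 z)"
        by (simp add: g nx_def add.assoc post_pre_01)
      show ?case unfolding eq using Cons by (simp add: g)
    qed simp
    then show ?thesis by (simp add: hs_def z_def)
  qed
  note cg = csum_flat[OF gs, folded z_def]
  note ch = csum_flat[OF hs(1), unfolded hs(2)]
  have Ag: "doubles Gen_A (flat gs) = gsum (\<lambda>e k e'. if k = 0 then 1 else 0) gs z"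
    using cg(2) good by (simp add: z_def)
  have Ah: "doubles Gen_A (flat hs) = gsum (\<lambda>e k e'. if k + csgn e e' = 0 then 1 else 0) gs z"
    using ch(2)[OF goodh] sh by simp
  have c1: "csgn e e' = 0 \<or> csgn e e' = 1 \<or> csgn e e' = - 1" for e e'
    by (simp add: csgn_def sg_def)
  define \<epsilon> where "\<epsilon> = gsum (\<lambda>e k e'. csgn e e' * sgn k) gs z"
  have mg: "mixing (flat gs) = 2 * \<epsilon>" using cg(1) by (simp add: \<epsilon>_def)
  have goodall: "gall (\<lambda>e k e'. e \<noteq> e' \<longrightarrow> k \<noteq> 0) gs z"
  proof -
    have "good gs z \<Longrightarrow> gall (\<lambda>e k e'. e \<noteq> e' \<longrightarrow> k \<noteq> 0) gs z" for gs
      by (induction gs) auto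
    then show ?thesis using good by (simp add: z_def)
  qed
  have cong: "gsum f gs z = gsum g gs z" if "\<And>e k e'. (e \<noteq> e' \<longrightarrow> k \<noteq> 0) \<Longrightarrow> f e k e' = g e k e'" for f g
  proof -
    have "gall (\<lambda>e k e'. e \<noteq> e' \<longrightarrow> k \<noteq> 0) gs z \<Longrightarrow> gsum f gs z = gsum g gs z" for gs
      by (induction gs) (auto simp: that)
    then show ?thesis using goodall by blast
  qed
  \<comment> \<open>For a shift c the difference of absolute values of k + c and k is
    \<open>c * sgn k\<close> if k is nonzero, and 1 if k = 0, where goodness forces c to be 1 or
    -1.\<close>
  have 1: "int (length (flat hs)) = int (length (flat gs)) + doubles Gen_A (flat gs) + \<epsilon>"
  proof -
    have "int (length (flat hs)) = gsum (\<lambda>e k e'. 1 + \<bar>k + csgn e e'\<bar>) gs z"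
      using ch(4) sh by simp
    also have "\<dots> = gsum (\<lambda>e k e'. (1 + \<bar>k\<bar>) + ((if k = 0 then 1 else 0) + csgn e e' * sgn k)) gs z"
      by (rule cong) (auto simp: csgn_def sg_def sgn_if)
    finally show ?thesis
      unfolding gsum_linear Ag cg(4) \<epsilon>_def by simp
  qed
  \<comment> \<open>\<open>c * sgn (k + c)\<close> exceeds \<open>c * sgn k\<close> by 1 exactly
    when the gap vanishes before or after the shift.\<close>
  have 2: "mixing (flat hs) = mixing (flat gs) + 2 * doubles Gen_A (flat gs) + 2 * doubles Gen_A (flat hs)"
  proof -
    have "mixing (flat hs) = 2 * gsum (\<lambda>e k e'. csgn e e' * sgn (k + csgn e e')) gs z"
      using ch(1) sh by simp
    also have "gsum (\<lambda>e k e'. csgn e e' * sgn (k + csgn e e')) gs z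
        = gsum (\<lambda>e k e'. csgn e e' * sgn k + ((if k = 0 then 1 else 0) + (if k + csgn e e' = 0 then 1 else 0))) gs z"
      by (rule cong) (auto simp: csgn_def sg_def sgn_if)
    finally show ?thesis
      unfolding gsum_linear Ag Ah mg \<epsilon>_def by simp
  qed
  have 3: "(doubles Gen_B (flat gs) = 0 \<longrightarrow> alternates Gen_A (flat gs)) \<and>
      (doubles Gen_B (flat hs) = 0 \<longrightarrow> alternates Gen_A (flat hs))"
    if z0: "doubles Gen_A (flat gs) = 0" "doubles Gen_A (flat hs) = 0" "mixing (flat gs) = 0"
  proof -
    have k0: "gall (\<lambda>e k e'. k \<noteq> 0 \<and> k + csgn e e' \<noteq> 0) gs z"
    proof -
      have "gall (\<lambda>e k e'. (if k = 0 then 1 else 0) = (0::int)) gs z"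
        using z0(1) unfolding Ag by (intro gsum_0) (auto intro: gall_mono[OF gall_True])
      moreover have "gall (\<lambda>e k e'. (if k + csgn e e' = 0 then 1 else 0) = (0::int)) gs z"
        using z0(2) unfolding Ah by (intro gsum_0) (auto intro: gall_mono[OF gall_True])
      ultimately show ?thesis
        by (rule gall_mono2) (auto split: if_splits)
    qed
    have e0: "gsum (\<lambda>e k e'. csgn e e' * sgn k) gs z = 0" using z0(3) mg by (simp add: \<epsilon>_def)
    have e0': "gsum (\<lambda>e k e'. csgn e e' * sgn (k + csgn e e')) gs z = 0"
      using 2 z0 ch(1) sh by simp
    \<comment> \<open>All gaps are 1 or -1 and none closes under the shift, so the summands of the
      mixing are nonnegative. A vanishing sum forces every \<open>csgn e e'\<close> to be 0.\<close>
    have A: "alternates Gen_A (flat gs)" if b: "doubles Gen_B (flat gs) = 0"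
    proof -
      have "gall (\<lambda>e k e'. (if k = 0 then 0 else \<bar>k\<bar> - 1) = 0) gs z"
        using b unfolding cg(3) by (intro gsum_0) (auto intro: gall_mono[OF gall_True])
      then have k1: "gall (\<lambda>e k e'. \<bar>k\<bar> = 1 \<and> k + csgn e e' \<noteq> 0) gs z"
        using k0 by (rule gall_mono2) (auto split: if_splits)
      then have "gall (\<lambda>e k e'. 0 \<le> csgn e e' * sgn k) gs z"
        by (rule gall_mono) (auto simp: csgn_def sg_def sgn_if split: if_splits)
      from gsum_0[OF this e0] k1 have "gall (\<lambda>e k e'. \<bar>k\<bar> = 1 \<and> e \<noteq> e') gs z"
        by (rule gall_mono2) (auto simp: csgn_def sg_def sgn_if split: if_splits)
      then show ?thesis using flat_alternates[OF gs] by (simp add: z_def)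
    qed
    \<comment> \<open>The mirror image: the shifted gaps are 1 or -1 and none was zero before, so
      the summands are at most 0.\<close>
    have B: "alternates Gen_A (flat hs)" if b: "doubles Gen_B (flat hs) = 0"
    proof -
      have "gall (\<lambda>e k e'. (if k + csgn e e' = 0 then 0 else \<bar>k + csgn e e'\<bar> - 1) = 0) gs z"
        using b unfolding ch(3) sh by (intro gsum_0) (auto intro: gall_mono[OF gall_True])
      then have k1: "gall (\<lambda>e k e'. k \<noteq> 0 \<and> \<bar>k + csgn e e'\<bar> = 1) gs z"
        using k0 by (rule gall_mono2) (auto split: if_splits)
      then have "gall (\<lambda>e k e'. 0 \<le> - (csgn e e' * sgn (k + csgn e e'))) gs z"
        by (rule gall_mono) (auto simp: csgn_def sg_def sgn_if split: if_splits)
      then have "gall (\<lambda>e k e'. - (csgn e e' * sgn (k + csgn e e')) = 0) gs z"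
        by (rule gsum_0) (simp only: gsum_uminus e0')
      then have "gall (\<lambda>e k e'. \<bar>k + csgn e e'\<bar> = 1 \<and> e \<noteq> e') gs z"
        using k1 by (rule gall_mono2) (auto simp: csgn_def sg_def sgn_if split: if_splits)
      then have "gall (\<lambda>e k e'. \<bar>k\<bar> = 1 \<and> e \<noteq> e') hs z"
        unfolding shA .
      then show ?thesis using flat_alternates[OF hs(1)] hs(2) by simp
    qed
    show ?thesis using A B by blast
  qed
  show ?thesis
    unfolding step_def using 1 2 3 mg hs goodh cred_flat[OF hs(1)] by simp
qed

text \<open>Words in the second generator alone have no gap form; \<open>sigma\<close> fixes them
  and every clause of \<open>step\<close> is trivial.\<close>

lemma step_no_A:
  assumes "cred u" "u \<noteq> []" "\<forall>l \<in> set u. fst l = Gen_B"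
  shows "step Gen_A Gen_B u u"
proof -
  have 1: "psum mixed xs = 0 \<and> psum (dbl Gen_A) xs = 0" if "\<forall>l \<in> set xs. fst l = Gen_B" for xs
    using that by (induction mixed xs rule: psum.induct) (auto simp: mixed_def dbl_def)
  have "\<forall>l \<in> set (u @ [hd u]). fst l = Gen_B" using assms by auto
  from 1[OF this] have "mixing u = 0" "doubles Gen_A u = 0" by (simp_all add: csum_def)
  moreover have "alternates Gen_A u"
    using assms by (auto simp: alternates_def cyc_def)
  ultimately show ?thesis using assms by (simp add: step_def)
qed

lemma sigma_step:
  assumes u: "cred u" "u \<noteq> []"
  shows "\<exists>v. step Gen_A Gen_B u v \<and> conjugate (sigma (ev u)) (ev v)"
proof (cases "\<forall>l \<in> set u. fst l = Gen_B")
  case True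
  have "sigma (ev w) = ev w" if "\<forall>l \<in> set w. fst l = Gen_B" for w
    using that
  proof (induction w)
    case (Cons l w)
    then have "sigma (lt l) = lt l"
      by (cases l; cases "snd l") (auto simp: lt_gen ghom_simps simp del: lt_True)
    then show ?case using Cons by (simp add: ghom_simps)
  qed (simp add: ghom_simps)
  then show ?thesis using step_no_A[OF u True] True by (intro exI[of _ u]) simp
next
  case False
  then obtain p l q where u': "u = p @ l # q" "fst l = Gen_A"
    by (metis gen.exhaust split_list)
  have c: "cred ((l # q) @ p)" using cred_rotation u(1) unfolding u'(1) by blast
  then obtain gs where gs: "(l # q) @ p = flat gs"
    using parse_flat[of "(l # q) @ p"] cred_reduced u'(2) by auto
  then have gs0: "gs \<noteq> []" by auto
  have good: "good gs (fst (hd gs))" using c cred_flat[OF gs0] gs by simp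
  define v where "v = flat (shift 0 1 gs (pre 0 1 (fst (hd gs))))"
  have s: "step Gen_A Gen_B ((l # q) @ p) v"
    unfolding gs v_def by (rule step_flat[OF gs0 good])
  have "conjugate (sigma (ev u)) (sigma (ev ((l # q) @ p)))"
    unfolding u'(1) by (rule conjugate_map[OF ghom_twists(1) conjugate_rotation])
  also have "conjugate (sigma (ev ((l # q) @ p))) (ev v)"
    unfolding gs sigma_Tw v_def by (rule conjugate_sym[OF Tw_conjugate[OF gs0]])
  finally have "conjugate (sigma (ev u)) (ev v)" .
  moreover have "step Gen_A Gen_B u v"
  proof -
    have "length (p @ l # q) = length ((l # q) @ p)" by simp
    then show ?thesis
      using s alternates_rotation[of Gen_A "l # q" p]
      unfolding step_def u'(1) csum_rotation[of _ p "l # q"] by presburger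
  qed
  ultimately show ?thesis by blast
qed

section \<open>Exchanging the generators, which carries the analysis of \<open>sigma\<close> over to
  \<open>tau\<close>\<close>

fun swg :: "gen \<Rightarrow> gen" where
  "swg Gen_A = Gen_B" | "swg Gen_B = Gen_A"

definition swl :: "letter \<Rightarrow> letter" where
  "swl l = (swg (fst l), snd l)"

lemma swg_simps [simp]: "swg (swg g) = g" "swg g = swg h \<longleftrightarrow> g = h"
  by (cases g; cases h; simp)+

lemma swl_simps [simp]: "swl (swl l) = l" "swl l = swl m \<longleftrightarrow> l = m" "fst (swl l) = swg (fst l)"
  "snd (swl l) = snd l" "swl (inv_letter l) = inv_letter (swl l)" "swl \<circ> swl = id"
  by (auto simp: swl_def inv_letter_def prod_eq_iff)

lemma auS_lt: "auS (lt l) = lt (swl l)"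
  by (cases l; cases "fst l"; cases "snd l") (auto simp: swl_def lt_gen ghom_simps simp del: lt_True)

lemma auS_ev: "auS (ev u) = ev (map swl u)"
  by (induction u) (simp_all add: ghom_simps auS_lt)

lemma reduced_map_swl [simp]: "reduced (map swl u) \<longleftrightarrow> reduced u"
  by (simp add: reduced_def successively_map flip: swl_simps(5))

lemma cred_map_swl [simp]: "cred (map swl u) \<longleftrightarrow> cred u"
  using reduced_map_swl[of "u @ u"] by (simp add: cred_def)

lemma csum_map: "u \<noteq> [] \<Longrightarrow> csum f (map h u) = csum (\<lambda>x y. f (h x) (h y)) u"
proof -
  assume "u \<noteq> []"
  moreover have "psum f (map h xs) = psum (\<lambda>x y. f (h x) (h y)) xs" for xs
    by (induction xs rule: induct_list012) simp_all
  from this[of "u @ [hd u]"] show ?thesis using \<open>u \<noteq> []\<close> by (simp add: csum_def hd_map)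
qed

lemma csum_swl: "u \<noteq> [] \<Longrightarrow> mixing (map swl u) = mixing u"
  "u \<noteq> [] \<Longrightarrow> doubles g (map swl u) = doubles (swg g) u"
proof -
  have "mixed (swl x) (swl y) = mixed x y" for x y by (simp add: mixed_def)
  then show "u \<noteq> [] \<Longrightarrow> mixing (map swl u) = mixing u" by (simp add: csum_map)
  have "dbl g (swl x) (swl y) = dbl (swg g) x y" for x y
    by (cases g; cases "fst x") (auto simp: dbl_def)
  then show "u \<noteq> [] \<Longrightarrow> doubles g (map swl u) = doubles (swg g) u" by (simp add: csum_map)
qed

lemma alternates_swl: "u \<noteq> [] \<Longrightarrow> alternates g (map swl u) \<longleftrightarrow> alternates (swg g) u"
proof -
  assume "u \<noteq> []"
  then have c: "cyc (map swl u) i = swl (cyc u i)" for i by (simp add: cyc_def)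
  have s: "swg h = g \<longleftrightarrow> h = swg g" for h by (metis swg_simps(1))
  show ?thesis unfolding alternates_def c by (simp add: s flip: swl_simps(5))
qed

lemma tau_step:
  assumes u: "cred u" "u \<noteq> []"
  shows "\<exists>v. step Gen_B Gen_A u v \<and> conjugate (tau (ev u)) (ev v)"
proof -
  obtain v where v: "step Gen_A Gen_B (map swl u) v" "conjugate (sigma (ev (map swl u))) (ev v)"
    using sigma_step[of "map swl u"] u by auto
  have v0: "v \<noteq> []" using v(1) by (simp add: step_def)
  have "step Gen_B Gen_A u (map swl v)"
    using v(1) v0 u csum_swl[of v] csum_swl[of u] alternates_swl[of v] alternates_swl[of u]
    by (simp add: step_def)
  moreover have "conjugate (auS (sigma (auS (ev u)))) (auS (ev v))"
    using conjugate_map[OF ghom_letters(2) v(2)] by (simp add: auS_ev)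
  moreover have "auS \<circ> sigma \<circ> auS = tau"
    by (rule ghom_eqI) (simp_all add: ghom_comp ghom_simps)
  then have "auS (sigma (auS (ev u))) = tau (ev u)" by (metis comp_apply)
  ultimately show ?thesis by (intro exI[of _ "map swl v"]) (simp add: auS_ev)
qed

definition stepgen :: "bool \<Rightarrow> gen" where
  "stepgen x = (if x then Gen_A else Gen_B)"

lemma tw_step:
  assumes "cred u" "u \<noteq> []"
  shows "\<exists>v. step (stepgen x) (stepgen (\<not> x)) u v \<and> conjugate (tw x (ev u)) (ev v)"
  using sigma_step[OF assms] tau_step[OF assms] by (cases x) (auto simp: stepgen_def)

lemma chain_steps:
  assumes "cred u" "u \<noteq> []"
  shows "\<exists>v. cred v \<and> v \<noteq> [] \<and> conjugate (pch zs (ev u)) (ev v) \<and> mixing u \<le> mixing v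
    \<and> (mixing v = mixing u \<longrightarrow> 2 * int (length v) = 2 * int (length u) + int (length zs) * mixing u)"
proof (induction zs)
  case Nil
  then show ?case using assms by (intro exI[of _ u]) simp
next
  case (Cons x zs)
  then obtain v where v: "cred v" "v \<noteq> []" "conjugate (pch zs (ev u)) (ev v)" "mixing u \<le> mixing v"
    "mixing v = mixing u \<longrightarrow> 2 * int (length v) = 2 * int (length u) + int (length zs) * mixing u"
    by blast
  obtain w where w: "step (stepgen x) (stepgen (\<not> x)) v w" "conjugate (tw x (ev v)) (ev w)"
    using tw_step[OF v(1,2)] by blast
  have "conjugate (pch (x # zs) (ev u)) (tw x (ev v))"
    using conjugate_map[OF _ v(3), of "tw x"] by simp
  then have c: "conjugate (pch (x # zs) (ev u)) (ev w)"
    using w(2) conjugate_trans by blast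
  show ?case
    using v w c doubles_nonneg[of "stepgen x" v] doubles_nonneg[of "stepgen x" w]
    by (intro exI[of _ w]) (auto simp: step_def algebra_simps)
qed

subsection \<open>The commutator\<close>

definition cc :: free2 where
  "cc = gen_a + gen_b + - gen_a + - gen_b"

lemma commutator_letters:
  assumes "fst l \<noteq> fst m"
  shows "conjugate cc (lt l + lt m + - lt l + - lt m) \<or> conjugate (- cc) (lt l + lt m + - lt l + - lt m)"
proof -
  have 1: "conjugate x y" if "y = cj g x" for x y g
    using that by (auto simp: conjugate_def)
  obtain g e where l: "l = (g, e)" by fastforce
  obtain h d where m: "m = (h, d)" by fastforce
  show ?thesis
  proof (cases g)
    case A: Gen_A
    then have h: "h = Gen_B" using assms l m by (cases h) auto
    show ?thesis
      using 1[of _ 0 cc] 1[of _ "- gen_b" "- cc"] 1[of _ "- gen_a" "- cc"] 1[of _ "- (gen_b + gen_a)" cc]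
      unfolding l m A h
      by (cases e; cases d) (simp_all add: lt_gen cc_def cj_def grp del: lt_True)
  next
    case B: Gen_B
    then have h: "h = Gen_A" using assms l m by (cases h) auto
    show ?thesis
      using 1[of _ 0 "- cc"] 1[of _ "- gen_a" cc] 1[of _ "- gen_b" cc] 1[of _ "- (gen_a + gen_b)" "- cc"]
      unfolding l m B h
      by (cases e; cases d) (simp_all add: lt_gen cc_def cj_def grp del: lt_True)
  qed
qed

text \<open>Every letter is inverse to the next but one, so the letters have period 4. Position 0
  differs from positions 1, 2 and 3, so the length of the cyclic word is a multiple of 4.\<close>

lemma alternating_commutator:
  assumes x: "x \<noteq> []" and alt: "alternates Gen_A x" "alternates Gen_B x"
  shows "\<exists>n>0. conjugate (nsc n cc) (ev x) \<or> conjugate (- nsc n cc) (ev x)"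
proof -
  let ?U = "cyc x"
  have U: "fst (?U (i + 1)) \<noteq> fst (?U i)" "?U (i + 2) = inv_letter (?U i)" for i
    using alt unfolding alternates_def by (metis gen.exhaust)+
  have U4: "?U (i + 4) = ?U i" for i
    using U(2)[of i] U(2)[of "i + 2"] by (simp add: eval_nat_numeral)
  have U4k: "?U (i + 4 * k) = ?U i" for i k
  proof (induction k)
    case (Suc k)
    then show ?case using U4[of "i + 4 * k"] by (simp add: algebra_simps)
  qed simp
  have U23: "?U 2 = inv_letter (?U 0)" "?U 3 = inv_letter (?U 1)"
    using U(2)[of 0] U(2)[of 1] by (simp_all add: numeral_2_eq_2 numeral_3_eq_3)
  define n where "n = length x"
  have "?U n = ?U 0" by (simp add: cyc_def n_def)
  moreover have "?U n = ?U (n mod 4)"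
    using U4k[of "n mod 4" "n div 4"] by simp
  moreover have "fst (?U 1) \<noteq> fst (?U 0)" "?U 2 \<noteq> ?U 0" "fst (?U 3) \<noteq> fst (?U 0)"
    unfolding U23 using U(1)[of 0] by (simp_all, simp add: inv_letter_def)
  moreover have "n mod 4 = 0 \<or> n mod 4 = 1 \<or> n mod 4 = 2 \<or> n mod 4 = 3" by presburger
  ultimately have "n mod 4 = 0" by metis
  then have "n = 4 * (n div 4)" by presburger
  then obtain k where k: "n = 4 * k" ..
  have "ev (map ?U [0..<4 * j]) = nsc j (lt (?U 0) + lt (?U 1) + - lt (?U 0) + - lt (?U 1))" for j
  proof (induction j)
    case (Suc j)
    have four: "[m..<m + 4] = [m, m + 1, m + 2, m + 3]" for m :: nat
      by (simp add: upt_conv_Cons)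
    have "[0..<4 * Suc j] = [0..<4 * j] @ [4 * j, 4 * j + 1, 4 * j + 2, 4 * j + 3]"
      using upt_add_eq_append[of 0 "4 * j" 4] four[of "4 * j"] by (simp add: add.commute)
    moreover have "?U (4 * j) = ?U 0" "?U (4 * j + 1) = ?U 1" "?U (4 * j + 2) = inv_letter (?U 0)"
      "?U (4 * j + 3) = inv_letter (?U 1)"
      using U4k[of 0 j] U4k[of 1 j] U4k[of 2 j] U4k[of 3 j]
      unfolding U23[symmetric] by (simp_all add: add.commute)
    ultimately have "ev (map ?U [0..<4 * Suc j])
        = nsc j (lt (?U 0) + lt (?U 1) + - lt (?U 0) + - lt (?U 1))
          + (lt (?U 0) + lt (?U 1) + - lt (?U 0) + - lt (?U 1))"
      using Suc by (simp add: add.assoc)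
    then show ?case by (simp only: nsc_Suc_right)
  qed simp
  moreover have "map ?U [0..<n] = x"
    by (rule nth_equalityI) (simp_all add: n_def cyc_def)
  ultimately have ev: "ev x = nsc k (lt (?U 0) + lt (?U 1) + - lt (?U 0) + - lt (?U 1))"
    using k by metis
  have "k > 0" using k x by (cases k) (auto simp: n_def)
  moreover have "conjugate (nsc k y) (nsc k z)" if "conjugate y z" for y z :: free2
    using that unfolding conjugate_def by (metis cj_nsc)
  ultimately show ?thesis
    using commutator_letters[of "?U 0" "?U 1"] U(1)[of 0] unfolding ev nsc_minus[symmetric]
    by auto
qed

lemma twists_fix_cc: "tw x cc = cc"
  by (cases x) (simp_all add: cc_def ghom_simps grp)

lemma pch_fix_cc: "pch zs cc = cc"
  by (induction zs) (simp_all add: twists_fix_cc)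

text \<open>The infix \<open>[False, True]\<close> is \<open>tau\<close> after \<open>sigma\<close>:
  the word \<open>u2\<close> between them is the output of a \<open>sigma\<close> step and the input
  of a \<open>tau\<close> step, so the stationary case controls both generators in it.\<close>

theorem positive_fixed_class:
  assumes v: "v \<noteq> 0" and c: "conjugate (pch (p @ [False, True] @ q) v) v"
  shows "\<exists>n>0. conjugate (nsc n cc) v \<or> conjugate (- nsc n cc) v"
proof -
  obtain g u where "v = cj g (ev u)" and u: "cred u"
    using cyclic_decomp by blast
  then have vu: "conjugate v (ev u)" and u0: "u \<noteq> []" using v by (auto simp: conjugate_cj)
  obtain u1 where u1: "cred u1" "u1 \<noteq> []" "conjugate (pch q (ev u)) (ev u1)" "mixing u \<le> mixing u1"
    "mixing u1 = mixing u \<longrightarrow> 2 * int (length u1) = 2 * int (length u) + int (length q) * mixing u"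
    using chain_steps[OF u u0] by blast
  obtain u2 where u2: "step Gen_A Gen_B u1 u2" "conjugate (sigma (ev u1)) (ev u2)"
    using sigma_step[OF u1(1,2)] by blast
  have c2: "cred u2" "u2 \<noteq> []" using u2(1) by (auto simp: step_def)
  obtain u3 where u3: "step Gen_B Gen_A u2 u3" "conjugate (tau (ev u2)) (ev u3)"
    using tau_step[OF c2] by blast
  have c3: "cred u3" "u3 \<noteq> []" using u3(1) by (auto simp: step_def)
  obtain u4 where u4: "cred u4" "u4 \<noteq> []" "conjugate (pch p (ev u3)) (ev u4)" "mixing u3 \<le> mixing u4"
    "mixing u4 = mixing u3 \<longrightarrow> 2 * int (length u4) = 2 * int (length u3) + int (length p) * mixing u3"
    using chain_steps[OF c3] by blast
  have k1: "conjugate (pch q v) (ev u1)"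
    by (rule conjugate_trans[OF conjugate_map[OF aut_pch(2) vu] u1(3)])
  have k2: "conjugate (pch ([True] @ q) v) (ev u2)"
    using conjugate_trans[OF conjugate_map[OF ghom_twists(1) k1] u2(2)] by simp
  have k3: "conjugate (pch ([False, True] @ q) v) (ev u3)"
    using conjugate_trans[OF conjugate_map[OF ghom_twists(3) k2] u3(2)] by simp
  have "conjugate (pch (p @ [False, True] @ q) v) (ev u4)"
    using conjugate_trans[OF conjugate_map[OF aut_pch(2)[of p] k3] u4(3)]
    unfolding pch_append comp_apply .
  then have "conjugate (ev u) (ev u4)"
    using c vu conjugate_sym conjugate_trans by blast
  then have e: "mixing u4 = mixing u" "length u4 = length u"
    using csum_conjugate length_conjugate u u4(1) by (metis, metis)
  have nn: "doubles Gen_A u1 \<ge> 0" "doubles Gen_A u2 \<ge> 0" "doubles Gen_B u2 \<ge> 0" "doubles Gen_B u3 \<ge> 0"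
    by (simp_all add: doubles_nonneg)
  have m: "mixing u2 = mixing u1 + 2 * doubles Gen_A u1 + 2 * doubles Gen_A u2"
    "mixing u3 = mixing u2 + 2 * doubles Gen_B u2 + 2 * doubles Gen_B u3"
    using u2(1) u3(1) by (auto simp: step_def)
  have d: "doubles Gen_A u1 = 0" "doubles Gen_A u2 = 0" "doubles Gen_B u2 = 0" "doubles Gen_B u3 = 0"
    "mixing u1 = mixing u" "mixing u2 = mixing u" "mixing u3 = mixing u" "mixing u4 = mixing u"
    using nn m e(1) u1(4) u4(4) by linarith+
  have "2 * int (length u4) = 2 * int (length u) + (int (length p) + int (length q) + 2) * mixing u"
    using u1(5) u4(5) u2(1) u3(1) d by (simp add: step_def algebra_simps)
  \<comment> \<open>The length grows by half the mixing with each twist and returns to its start;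
    the number of twists is at least two, so the mixing is 0.\<close>
  then have "(int (length p) + int (length q) + 2) * mixing u = 0" using e(2) by simp
  then have "mixing u = 0" by auto
  then have "alternates Gen_A u2" "alternates Gen_B u2"
    using u2(1) u3(1) d by (simp_all add: step_def)
  then obtain n where n: "n > 0" "conjugate (nsc n cc) (ev u2) \<or> conjugate (- nsc n cc) (ev u2)"
    using alternating_commutator[OF c2(2)] by blast
  define zs where "zs = [True] @ q"
  \<comment> \<open>The commutator was found in the class of \<open>u2\<close>, not of
    \<open>v\<close>. It is carried back because \<open>pch zs\<close> is bijective and fixes
    \<open>cc\<close>.\<close>
  have pullback: "conjugate y v" if "conjugate y (ev u2)" "pch zs y = y" for y
  proof -
    have "conjugate y (pch zs v)"
      using that(1) k2 conjugate_sym conjugate_trans unfolding zs_def by blast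
    then obtain h where h: "pch zs v = cj h y" by (auto simp: conjugate_def)
    obtain h' where h': "h = pch zs h'" using aut_pch(1)[of zs] by (metis aut_def bij_pointE)
    have "pch zs v = pch zs (cj h' y)" using h h' that(2) by (simp add: ghom_cj_map)
    then have "v = cj h' y" by (simp add: aut_inject)
    then show ?thesis by (simp add: conjugate_cj)
  qed
  show ?thesis
    using n pullback[of "nsc n cc"] pullback[of "- nsc n cc"] by (auto simp: ghom_simps ghom_nsc pch_fix_cc)
qed

section \<open>Exponent sums and the signed area\<close>

definition lw :: "gen \<Rightarrow> letter \<Rightarrow> int" where
  "lw g l = (if fst l = g then sg (snd l) else 0)"

definition lws :: "gen \<Rightarrow> letter list \<Rightarrow> int" where
  "lws g u = sum_list (map (lw g) u)"

definition ab :: "gen \<Rightarrow> free2 \<Rightarrow> int" where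
  "ab g x = lws g (rw x)"

lemma lws_simps [simp]: "lws g [] = 0" "lws g (l # u) = lw g l + lws g u"
  "lws g (u @ v) = lws g u + lws g v"
  by (simp_all add: lws_def)

lemma lw_inv [simp]: "lw g (inv_letter l) = - lw g l"
  by (simp add: lw_def inv_letter_def sg_def)

lemma lws_push: "lws g (push l w) = lw g l + lws g w"
  by (cases w) (auto simp: push_def)

lemma lws_foldr_push: "lws g (foldr push u w) = lws g u + lws g w"
  by (induction u) (simp_all add: lws_push)

lemma ab_add [simp]: "ab g (x + y) = ab g x + ab g y"
  by (simp add: ab_def rw_add lws_foldr_push)

lemma ab_0 [simp]: "ab g 0 = 0"
  by (simp add: ab_def)

lemma ab_minus [simp]: "ab g (- x) = - ab g x"
  using ab_add[of g "- x" x] by simp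

lemma ab_cj [simp]: "ab g (cj h x) = ab g x"
  by (simp add: cj_def)

lemma ab_nsc [simp]: "ab g (nsc n x) = int n * ab g x"
  by (induction n) (simp_all add: algebra_simps)

lemma ab_gens [simp]: "ab Gen_A gen_a = 1" "ab Gen_B gen_a = 0" "ab Gen_A gen_b = 0" "ab Gen_B gen_b = 1"
  by (simp_all add: gen_lt ab_def lw_def sg_def)

lemma zhom_expand:
  fixes h :: "free2 \<Rightarrow> int"
  assumes "\<And>x y. h (x + y) = h x + h y"
  shows "h x = ab Gen_A x * h gen_a + ab Gen_B x * h gen_b"
proof -
  have h0: "h 0 = 0" using assms[of 0 0] by simp
  have hm: "h (- y) = - h y" for y using assms[of y "- y"] h0 by simp
  have "h (ev u) = ab Gen_A (ev u) * h gen_a + ab Gen_B (ev u) * h gen_b" for u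
  proof (induction u)
    case (Cons l u)
    have "h (lt l) = ab Gen_A (lt l) * h gen_a + ab Gen_B (lt l) * h gen_b"
      by (cases l; cases "fst l"; cases "snd l") (auto simp: lt_gen hm simp del: lt_True)
    then show ?case using Cons by (simp add: assms algebra_simps)
  qed (simp add: h0)
  from this[of "rw x"] show ?thesis by simp
qed

lemma ab_map: "ghom f \<Longrightarrow> ab g (f x) = ab Gen_A x * ab g (f gen_a) + ab Gen_B x * ab g (f gen_b)"
  by (rule zhom_expand) (simp add: ghom_simps)

fun qfl :: "letter list \<Rightarrow> int" where
  "qfl [] = 0"
| "qfl (l # u) = qfl u + lw Gen_A l * lws Gen_B u - lw Gen_B l * lws Gen_A u"

text \<open>For null-homologous words, twice the signed area enclosed by the path in the square grid.\<close>

definition qf :: "free2 \<Rightarrow> int" where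
  "qf x = qfl (rw x)"

lemma qfl_push: "qfl (push l w) = qfl (l # w)"
  by (cases w) (auto simp: push_def algebra_simps)

lemma qfl_foldr_push: "qfl (foldr push u w) = qfl (u @ w)"
  by (induction u) (simp_all add: qfl_push lws_foldr_push)

lemma qfl_append: "qfl (u @ v) = qfl u + qfl v + lws Gen_A u * lws Gen_B v - lws Gen_B u * lws Gen_A v"
  by (induction u) (simp_all add: algebra_simps)

text \<open>Signed area is additive up to the determinant of the two homology classes, hence a
  homomorphism on null-homologous elements.\<close>

lemma qf_add: "qf (x + y) = qf x + qf y + ab Gen_A x * ab Gen_B y - ab Gen_B x * ab Gen_A y"
  by (simp add: qf_def rw_add qfl_foldr_push qfl_append ab_def)

lemma qf_0 [simp]: "qf 0 = 0"
  by (simp add: qf_def)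

lemma qf_minus [simp]: "qf (- x) = - qf x"
  using qf_add[of "- x" x] by (simp add: algebra_simps)

lemma qf_nsc [simp]: "qf (nsc n x) = int n * qf x"
  by (induction n) (simp_all add: qf_add algebra_simps)

lemma qf_cj: "ab Gen_A x = 0 \<Longrightarrow> ab Gen_B x = 0 \<Longrightarrow> qf (cj g x) = qf x"
  by (simp add: cj_def qf_add)

lemma ab_cc [simp]: "ab g cc = 0"
  by (simp add: cc_def)

lemma qf_cc [simp]: "qf cc = 2"
proof -
  have "qf gen_a = 0" "qf gen_b = 0" by (simp_all add: qf_def gen_lt)
  then show ?thesis by (simp add: cc_def qf_add)
qed

definition detf :: "(free2 \<Rightarrow> free2) \<Rightarrow> int" where
  "detf f = ab Gen_A (f gen_a) * ab Gen_B (f gen_b) - ab Gen_B (f gen_a) * ab Gen_A (f gen_b)"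

text \<open>In the difference \<open>h\<close> the determinant terms cancel, so \<open>h\<close> is
  a homomorphism to the integers and vanishes on null-homologous elements.\<close>

lemma qf_map:
  assumes f: "ghom f" and x: "ab Gen_A x = 0" "ab Gen_B x = 0"
  shows "qf (f x) = detf f * qf x"
proof -
  define h where "h y = qf (f y) - detf f * qf y" for y
  have "h (y + z) = h y + h z" for y z
  proof -
    have "ab Gen_A (f y) * ab Gen_B (f z) - ab Gen_B (f y) * ab Gen_A (f z)
      = detf f * (ab Gen_A y * ab Gen_B z - ab Gen_B y * ab Gen_A z)"
      unfolding ab_map[OF f, of _ y] ab_map[OF f, of _ z] detf_def by (simp add: algebra_simps)
    then show ?thesis using f by (simp add: h_def qf_add ghom_simps algebra_simps)
  qed
  from zhom_expand[OF this, of x] x have "h x = 0" by simp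
  then show ?thesis by (simp add: h_def)
qed

section \<open>Automorphisms fixing only conjugates of powers of the commutator\<close>

definition cpow :: "free2 \<Rightarrow> bool" where
  "cpow v \<longleftrightarrow> (\<exists>n>0. conjugate (nsc n cc) v \<or> conjugate (- nsc n cc) v)"

lemma cpow_qf: "cpow v \<Longrightarrow> qf v \<noteq> 0"
  by (auto simp: cpow_def conjugate_def qf_cj)

lemma cpow_ab: "cpow v \<Longrightarrow> ab g v = 0"
  by (auto simp: cpow_def conjugate_def)

lemma cc_word: "cc = ev [(Gen_A, False), (Gen_B, False), (Gen_A, True), (Gen_B, True)]"
  by (simp add: cc_def lt_gen add.assoc gen_lt[symmetric] del: lt_True)

lemma take_concat_replicate:
  assumes "m \<le> n * length C" "C \<noteq> []"
  shows "\<exists>j r. r < length C \<and> take m (concat (replicate n C)) = concat (replicate j C) @ take r C"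
  using assms(1)
proof (induction n arbitrary: m)
  case 0
  then show ?case using assms(2) by (intro exI[of _ 0]) simp
next
  case (Suc n)
  show ?case
  proof (cases "m < length C")
    case True
    then show ?thesis by (intro exI[of _ 0] exI[of _ m]) simp
  next
    case False
    then have "m - length C \<le> n * length C" using Suc.prems by simp
    then obtain j r where "r < length C"
      "take (m - length C) (concat (replicate n C)) = concat (replicate j C) @ take r C"
      using Suc.IH by blast
    then show ?thesis using False by (intro exI[of _ "Suc j"] exI[of _ r]) simp
  qed
qed

lemma short_conjugator:
  assumes "n > 0" "conjugate (nsc n cc) v"
  shows "\<exists>g. v = cj g (nsc n cc) \<and> len g < len v"
proof -
  define C where "C = [(Gen_A, False), (Gen_B, False), (Gen_A, True), (Gen_B, True)]"
  have C: "cred C" "ev C = cc" "length C = 4" "C \<noteq> []"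
    unfolding cc_word by (simp_all add: C_def cred_def reduced_Cons inv_letter_def)
  define W where "W = concat (replicate n C)"
  have W: "reduced W" "ev W = nsc n cc" "length W = 4 * n"
    using C reduced_concat_replicate[of C n]
    by (simp_all add: W_def ev_concat_replicate length_concat sum_list_replicate)
  have "W @ W = concat (replicate (n + n) C)" by (simp add: W_def replicate_add)
  then have cW: "cred W" using reduced_concat_replicate[OF C(1), of "n + n"] by (simp add: cred_def)
  obtain h u where hu: "v = cj h (ev u)" "cred u" "len v = 2 * len h + length u"
    using cyclic_decomp by blast
  have "conjugate (ev W) (ev u)"
    using assms(2) hu(1) W(2) conjugate_cj(2) conjugate_trans by metis
  then obtain p q where pq: "W = p @ q" "u = q @ p" using cred_conjugate[OF cW hu(2)] by blast
  have "p = take (length p) W" by (simp add: pq)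
  then obtain j r where r: "r < 4" "p = concat (replicate j C) @ take r C"
    using take_concat_replicate[of "length p" n C] C W pq unfolding W_def[symmetric]
    by (metis length_append le_add1 mult.commute)
  define t where "t = ev (take r C)"
  have "ev u = cj (- ev p) (ev W)" by (simp add: pq cj_def add.assoc)
  also have "ev p = nsc j cc + t" by (simp add: r(2) t_def ev_concat_replicate C)
  also have "cj (- (nsc j cc + t)) (ev W) = cj (- t) (cj (- nsc j cc) (nsc n cc))"
    by (simp add: minus_add W)
  also have "cj (- nsc j cc) (nsc n cc) = nsc n cc"
    unfolding cj_comm_iff by (simp add: comm_nsc comm_sym)
  finally have "v = cj (h + - t) (nsc n cc)" using hu(1) by simp
  moreover have "len t \<le> 3" using len_ev_le[of "take r C"] r(1) by (simp add: t_def)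
  then have "len (h + - t) \<le> len h + 3" using len_add_le[of h "- t"] by simp
  then have "len (h + - t) < len v" using hu(3) pq W(3) assms(1) by simp
  ultimately show ?thesis by blast
qed

lemma cpow_conjugator:
  assumes "cpow v"
  obtains g n where "n > 0" "len g < len v" "v = cj g (nsc n cc) \<or> v = - cj g (nsc n cc)"
proof -
  obtain n where n: "n > 0" "conjugate (nsc n cc) v \<or> conjugate (nsc n cc) (- v)"
    using assms unfolding cpow_def conjugate_def by (metis cj_simps(4) minus_minus)
  then show ?thesis
    using short_conjugator[of n v] short_conjugator[of n "- v"] that by (metis len_minus minus_minus)
qed

lemma fixes_conjugate_cc:
  assumes "ghom f" "n > 0" "v = cj g (nsc n cc) \<or> v = - cj g (nsc n cc)" "f v = v"
  shows "f (cj g cc) = cj g cc"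
proof -
  have "f (nsc n (cj g cc)) = nsc n (cj g cc)"
    using assms by (auto simp: cj_nsc ghom_simps)
  then show ?thesis using fixes_root assms(1,2) by blast
qed

text \<open>The third assumption says that 0 is the only homology class fixed by \<open>f\<close>.
  After a conjugation \<open>cc\<close> itself is fixed. A shortest fixed element \<open>v\<close>
  not commuting with \<open>cc\<close> is a conjugate of a power of \<open>cc\<close> by a shorter
  \<open>g\<close>, and homology together with area shows that \<open>g\<close> is fixed as
  well.\<close>

theorem cpow_fixed_commute:
  assumes f: "aut f" and det: "detf f = 1"
    and ab: "\<And>x. (\<And>g. ab g (f x) = ab g x) \<Longrightarrow> (\<And>g. ab g x = 0)"
    and fix_cpow: "\<And>v. f v = v \<Longrightarrow> v \<noteq> 0 \<Longrightarrow> cpow v"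
    and xy: "f x = x" "f y = y"
  shows "comm x y"
proof (rule ccontr)
  assume nc: "\<not> comm x y"
  then have "x \<noteq> 0" by auto
  then obtain g0 n0 where g0: "n0 > 0" "x = cj g0 (nsc n0 cc) \<or> x = - cj g0 (nsc n0 cc)"
    using fix_cpow[OF xy(1)] cpow_conjugator by metis
  define F where "F = cj (- g0) \<circ> f \<circ> cj g0"
  have F: "aut F" using f by (simp add: F_def aut_comp)
  have hF: "ghom F" using F by (rule aut_ghom)
  have hf: "ghom f" using f by (rule aut_ghom)
  have Ffix: "F v = v \<longleftrightarrow> f (cj g0 v) = cj g0 v" for v
    unfolding F_def by (simp add: cj_eq_iff)
  have Fcc: "F cc = cc"
    unfolding Ffix using fixes_conjugate_cc[OF hf g0 xy(1)] .
  have detF: "detf F = 1" using det hf by (simp add: F_def detf_def ghom_cj_map)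
  have abF: "ab g (F v) = ab g (f v)" for g v using hf by (simp add: F_def ghom_cj_map)
  have noncomm: "\<not> comm v cc" if "v = cj (- g0) y" for v
  proof
    assume "comm v cc"
    then have "comm v (nsc n0 cc)" using comm_nsc comm_sym by metis
    then have "comm y (cj g0 (nsc n0 cc))" using that
      by (metis add.right_inverse cj_simps(1,3) comm_cj_iff)
    then have "comm y x" using g0(2) by auto
    then show False using nc comm_sym by blast
  qed
  define Y where "Y = {v. F v = v \<and> \<not> comm v cc}"
  have "cj (- g0) y \<in> Y" using xy(2) noncomm by (simp add: Y_def Ffix)
  \<comment> \<open>A counterexample of minimal length.\<close>
  then obtain v where v: "v \<in> Y" "\<And>w. w \<in> Y \<Longrightarrow> len v \<le> len w"
    using exists_least_iff[of "\<lambda>n. \<exists>w \<in> Y. len w = n"] by (metis not_less)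
  have Fv: "F v = v" and ncv: "\<not> comm v cc" using v(1) by (auto simp: Y_def)
  then have "cj g0 v \<noteq> 0" by auto
  then have "cpow (cj g0 v)" using fix_cpow Ffix Fv by blast
  then have "cpow v" unfolding cpow_def using conjugate_cj(2) conjugate_trans by blast
  then obtain g n where g: "n > 0" "len g < len v" "v = cj g (nsc n cc) \<or> v = - cj g (nsc n cc)"
    by (rule cpow_conjugator)
  have "F (cj g cc) = cj g cc" using fixes_conjugate_cc[OF hF g(1,3) Fv] .
  then have "cj (F g) cc = cj g cc" using hF Fcc by (simp add: ghom_cj_map)
  then have "cj (- g + F g) cc = cc" by (metis add.left_inverse cj_simps(1,3))
  \<comment> \<open>\<open>F\<close> moves \<open>g\<close> by an element \<open>z\<close> of the
    centralizer of \<open>cc\<close>. So \<open>z\<close> is null-homologous, the class of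
    \<open>g\<close> is fixed and therefore 0, and preservation of area gives
    \<open>qf z = 0\<close>. Since some positive power of \<open>z\<close> is a power of
    \<open>cc\<close>, whose area is not 0, \<open>z\<close> vanishes.\<close>
  define z where "z = - g + F g"
  have z: "comm z cc" using \<open>cj (- g + F g) cc = cc\<close> by (simp add: z_def cj_comm_iff)
  have Fg: "F g = g + z" by (simp add: z_def)
  have cc0: "cc \<noteq> 0" using qf_cc by (metis qf_0 zero_neq_numeral)
  obtain m k where mk: "m > 0" "nsc m z = nsc k cc \<or> nsc m z = - nsc k cc"
    using comm_common_power[OF z cc0] by blast
  have "int m * ab h z = 0" for h using mk(2) by (metis ab_cc ab_minus ab_nsc minus_zero mult_zero_right)
  then have abz: "ab h z = 0" for h using mk(1) by simp
  have "ab h (f g) = ab h g" for h using abF[of h g] Fg abz by simp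
  then have abg: "ab h g = 0" for h using ab by blast
  have "qf (F g) = qf g" using qf_map[OF hF] abg detF by simp
  then have "qf z = 0" using Fg abg abz by (simp add: qf_add)
  then have "int k * qf cc = 0" using mk(2) by (metis mult_zero_right neg_equal_0_iff_equal qf_minus qf_nsc)
  then have "nsc m z = 0" using mk(2) by auto
  then have "z = 0" using torsion_free mk(1) by blast
  then have "F g = g" using Fg by simp
  moreover have "\<not> comm g cc"
  proof
    assume "comm g cc"
    then have "cj g (nsc n cc) = nsc n cc"
      unfolding cj_comm_iff using comm_nsc comm_sym by metis
    then have "comm v cc" using g(3) by (auto simp: comm_nsc)
    then show False using ncv by blast
  qed
  ultimately have "g \<in> Y" by (simp add: Y_def)
  then show False using v(2)[of g] g(2) by simp
qed

section \<open>Positive words in both twists, with sign and swap\<close>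

lemma bool_infix:
  assumes "True \<in> set zs" "False \<in> set zs"
  shows "\<exists>p q. zs @ zs = p @ [False, True] @ q"
proof -
  have 1: "\<exists>p q. False # t = p @ [False, True] @ q" if "True \<in> set t" for t
    using that
  proof (induction t)
    case (Cons b t)
    show ?case
    proof (cases b)
      case True
      then show ?thesis by (intro exI[of _ "[]"] exI[of _ t]) simp
    next
      case False
      then obtain p q where "False # t = p @ [False, True] @ q" using Cons by auto
      then show ?thesis using False by (intro exI[of _ "False # p"] exI[of _ q]) simp
    qed
  qed simp
  obtain r s where rs: "zs = r @ False # s" using assms(2) by (meson split_list)
  then obtain p q where "False # (s @ zs) = p @ [False, True] @ q" using 1[of "s @ zs"] assms(1) by auto
  then have "zs @ zs = (r @ p) @ [False, True] @ q" by (simp add: rs)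
  then show ?thesis by blast
qed

lemma pch_fixed_cpow:
  assumes "True \<in> set zs" "False \<in> set zs" "v \<noteq> 0" "conjugate (pch zs v) v"
  shows "cpow v"
proof -
  obtain p q where pq: "zs @ zs = p @ [False, True] @ q" using bool_infix assms by blast
  have "conjugate (pch zs (pch zs v)) (pch zs v)"
    by (rule conjugate_map[OF aut_pch(2) assms(4)])
  then have "conjugate (pch (zs @ zs) v) v"
    unfolding pch_append comp_apply using assms(4) conjugate_trans by blast
  then show ?thesis
    unfolding cpow_def pq using positive_fixed_class[OF assms(3)] by blast
qed

lemma pch_auJ: "auJ \<circ> pch xs \<approx> pch xs \<circ> auJ"
proof (induction xs)
  case (Cons x xs)
  have "(auJ \<circ> tw x) \<circ> pch xs \<approx> (tw x \<circ> auJ) \<circ> pch xs" by (rule oeq_right[OF tw_auJ])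
  also have "\<dots> \<approx> tw x \<circ> (auJ \<circ> pch xs)" by (intro oeq_eq) (simp add: comp_assoc)
  also have "\<dots> \<approx> tw x \<circ> (pch xs \<circ> auJ)" by (rule oeq_left[OF Cons]) simp
  finally show ?case by (simp only: pch.simps list.map comp_assoc)
qed simp

lemma pch_auS: "pch xs \<circ> auS \<approx> auS \<circ> pch (map Not xs)"
proof (induction xs)
  case (Cons x xs)
  have "tw x \<circ> (pch xs \<circ> auS) \<approx> tw x \<circ> (auS \<circ> pch (map Not xs))" by (rule oeq_left[OF Cons]) simp
  also have "\<dots> \<approx> (tw x \<circ> auS) \<circ> pch (map Not xs)" by (intro oeq_eq) (simp add: comp_assoc)
  also have "\<dots> \<approx> (auS \<circ> tw (\<not> x)) \<circ> pch (map Not xs)" by (rule oeq_right[OF tw_auS])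
  finally show ?case by (simp only: pch.simps list.map comp_assoc)
qed simp

lemma pch_jpow: "jpow j \<circ> pch xs \<approx> pch xs \<circ> jpow j"
  using pch_auJ by (simp add: jpow_def)

lemma jpow_auS: "jpow j \<circ> auS = auS \<circ> jpow j"
  using letter_relations(3) by (simp add: jpow_def)

lemma jpow_twice: "jpow j (jpow j x) = x"
  using jpow_jpow[of j j] by (simp add: fun_eq_iff jpow_def[of False])

lemma fixed_conjugate_square:
  assumes "ghom f" "conjugate (f v) v" "f \<circ> f \<approx> h"
  shows "conjugate (h v) v"
proof -
  have "conjugate (h v) (f (f v))" using conjugate_oeq[OF assms(3), of v] conjugate_sym by simp
  also have "conjugate (f (f v)) (f v)" by (rule conjugate_map[OF assms(1,2)])
  also have "conjugate (f v) v" by (rule assms(2))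
  finally show ?thesis .
qed

lemma jpow_pch_square: "(jpow j \<circ> pch xs) \<circ> (jpow j \<circ> pch xs) \<approx> pch (xs @ xs)"
proof -
  have "(jpow j \<circ> pch xs) \<circ> (jpow j \<circ> pch xs) \<approx> (pch xs \<circ> jpow j) \<circ> (jpow j \<circ> pch xs)"
    by (rule oeq_right[OF pch_jpow])
  also have "\<dots> \<approx> pch (xs @ xs)" by (intro oeq_eq) (simp add: fun_eq_iff jpow_twice pch_append)
  finally show ?thesis .
qed

text \<open>Squaring removes the swap, and \<open>map Not xs @ xs\<close> contains both twists as
  soon as \<open>xs\<close> is nonempty.\<close>

lemma jpow_auS_pch_square:
  "(jpow j \<circ> auS \<circ> pch xs) \<circ> (jpow j \<circ> auS \<circ> pch xs) \<approx> pch (map Not xs @ xs)"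
proof -
  have "(jpow j \<circ> auS \<circ> pch xs) \<circ> (jpow j \<circ> auS \<circ> pch xs)
      \<approx> (jpow j \<circ> auS) \<circ> ((pch xs \<circ> jpow j) \<circ> (auS \<circ> pch xs))"
    by (intro oeq_eq) (simp add: comp_assoc)
  also have "\<dots> \<approx> (jpow j \<circ> auS) \<circ> ((jpow j \<circ> pch xs) \<circ> (auS \<circ> pch xs))"
    by (intro oeq_left oeq_right oeq_sym[OF pch_jpow]) (simp add: ghom_comp)
  also have "\<dots> \<approx> (jpow j \<circ> auS \<circ> jpow j) \<circ> ((pch xs \<circ> auS) \<circ> pch xs)"
    by (intro oeq_eq) (simp add: comp_assoc)
  also have "\<dots> \<approx> (jpow j \<circ> auS \<circ> jpow j) \<circ> ((auS \<circ> pch (map Not xs)) \<circ> pch xs)"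
    by (intro oeq_left oeq_right pch_auS) (simp add: ghom_comp)
  also have "\<dots> \<approx> pch (map Not xs @ xs)"
  proof (intro oeq_eq)
    have "auS (auS x) = x" for x using letter_squares(2) by (metis comp_apply id_apply)
    moreover have "jpow j (auS x) = auS (jpow j x)" for x using jpow_auS by (metis comp_apply)
    ultimately show "(jpow j \<circ> auS \<circ> jpow j) \<circ> ((auS \<circ> pch (map Not xs)) \<circ> pch xs) = pch (map Not xs @ xs)"
      by (simp add: fun_eq_iff jpow_twice pch_append)
  qed
  finally show ?thesis .
qed

lemma ab_twists: "ab Gen_A (sigma y) = ab Gen_A y" "ab Gen_B (sigma y) = ab Gen_A y + ab Gen_B y"
  "ab Gen_A (tau y) = ab Gen_A y + ab Gen_B y" "ab Gen_B (tau y) = ab Gen_B y"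
  using ab_map[of sigma _ y] ab_map[of tau _ y] by simp_all

lemma pch_matrix:
  defines "p xs \<equiv> ab Gen_A (pch xs gen_a)" and "q xs \<equiv> ab Gen_B (pch xs gen_a)"
    and "r xs \<equiv> ab Gen_A (pch xs gen_b)" and "s xs \<equiv> ab Gen_B (pch xs gen_b)"
  shows "1 \<le> p xs \<and> 0 \<le> q xs \<and> 0 \<le> r xs \<and> 1 \<le> s xs \<and> p xs * s xs - q xs * r xs = 1
    \<and> (True \<in> set xs \<longrightarrow> 1 \<le> q xs) \<and> (False \<in> set xs \<longrightarrow> 1 \<le> r xs)"
proof (induction xs)
  case Nil
  then show ?case by (simp add: p_def q_def r_def s_def)
next
  case (Cons x xs)
  then show ?case
    by (cases x) (auto simp: p_def q_def r_def s_def ab_twists algebra_simps)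
qed

lemma ab_jpow: "ab g (jpow j x) = sg j * ab g x"
  using ab_map[of "jpow j" g x] by (cases g) (auto simp: jpow_def sg_def)

text \<open>The homology matrix has determinant 1 and trace of absolute value at least 3, so 1 is
  not an eigenvalue. Squaring removes the sign, so fixed elements are conjugates of powers of
  \<open>cc\<close> and \<open>cpow_fixed_commute\<close> applies.\<close>

theorem positive_mixed_fixed_commute:
  assumes f: "f \<approx> jpow j \<circ> pch xs" and xs: "True \<in> set xs" "False \<in> set xs"
    and xy: "f x = x" "f y = y"
  shows "comm x y"
proof -
  have h: "aut (jpow j \<circ> pch xs)" by (simp add: aut_comp)
  then have "aut f" using aut_oeq f by blast
  obtain w where w: "f = cj w \<circ> (jpow j \<circ> pch xs)" using f by (auto simp: oeq_def)
  define p q r s where pq: "p = ab Gen_A (pch xs gen_a)" "q = ab Gen_B (pch xs gen_a)"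
    "r = ab Gen_A (pch xs gen_b)" "s = ab Gen_B (pch xs gen_b)"
  have m: "1 \<le> p" "1 \<le> q" "1 \<le> r" "1 \<le> s" "p * s - q * r = 1"
    using pch_matrix[of xs] xs by (simp_all add: pq)
  have e2: "sg j * sg j = 1" by (simp add: sg_def)
  have "detf f = (sg j * sg j) * (p * s - q * r)"
    by (simp add: w detf_def ab_jpow pq algebra_simps)
  then have det: "detf f = 1" using m(5) e2 by simp
  have abf: "ab Gen_A (f v) = sg j * (ab Gen_A v * p + ab Gen_B v * r)"
    "ab Gen_B (f v) = sg j * (ab Gen_A v * q + ab Gen_B v * s)" for v
    using ab_map[of "pch xs" _ v] by (simp_all add: w ab_jpow pq)
  have ab: "ab g v = 0" if "\<And>g. ab g (f v) = ab g v" for v g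
  proof -
    define X Y where XY: "X = ab Gen_A v" "Y = ab Gen_B v"
    have 1: "sg j * (X * p + Y * r) = X" "sg j * (X * q + Y * s) = Y"
      using that[of Gen_A] that[of Gen_B] by (simp_all add: abf XY)
    have j: "sg j = 1 \<or> sg j = -1" by (simp add: sg_def)
    have ps: "p + s \<ge> 3"
    proof (rule ccontr)
      assume "\<not> ?thesis"
      then have "p = 1" "s = 1" using m by auto
      then have "q * r = 0" using m(5) by simp
      then show False using m by simp
    qed
    \<comment> \<open>Eliminating one unknown multiplies the other by the determinant of the signed
      matrix minus the identity, which is 2 minus its trace.\<close>
    have "(2 * sg j - (p + s)) * X = 0 \<and> (2 * sg j - (p + s)) * Y = 0"
    proof -
      have a: "(sg j * p - 1) * X = - (sg j * r * Y)" "(sg j * s - 1) * Y = - (sg j * q * X)"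
        using 1 by (simp_all add: algebra_simps)
      have "(sg j * s - 1) * ((sg j * p - 1) * X) = (sg j * sg j) * (q * r) * X"
        unfolding a(1) using a(2) by (metis (no_types, opaque_lifting) ab_semigroup_mult_class.mult_ac(1) minus_mult_minus mult.commute mult_minus_right)
      then have "((sg j * sg j) * (p * s - q * r) - sg j * (p + s) + 1) * X = 0"
        by (simp add: algebra_simps)
      moreover have "(sg j * p - 1) * ((sg j * s - 1) * Y) = (sg j * sg j) * (q * r) * Y"
        unfolding a(2) using a(1) by (metis (no_types, opaque_lifting) ab_semigroup_mult_class.mult_ac(1) minus_mult_minus mult.commute mult_minus_right)
      then have "((sg j * sg j) * (p * s - q * r) - sg j * (p + s) + 1) * Y = 0"
        by (simp add: algebra_simps)
      ultimately show ?thesis using j m(5) by auto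
    qed
    then have "X = 0 \<and> Y = 0" using j ps by auto
    then show ?thesis by (cases g) (simp_all add: XY)
  qed
  have "cpow v" if "f v = v" "v \<noteq> 0" for v
  proof -
    have "conjugate ((jpow j \<circ> pch xs) v) v"
      using conjugate_oeq[OF f, of v] that(1) conjugate_sym by simp
    then have "conjugate (pch (xs @ xs) v) v"
      using fixed_conjugate_square jpow_pch_square h aut_ghom by blast
    then show ?thesis using pch_fixed_cpow[of "xs @ xs"] xs that(2) by simp
  qed
  then show ?thesis
    using cpow_fixed_commute[OF \<open>aut f\<close> det ab] xy by blast
qed

text \<open>A nontrivial fixed element would be conjugate to a power of \<open>cc\<close> and so
  have nonzero area, but determinant -1 reverses the area.\<close>

theorem positive_swap_fixed:
  assumes f: "f \<approx> jpow j \<circ> auS \<circ> pch xs" and xs: "xs \<noteq> []" and v: "f v = v"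
  shows "v = 0"
proof (rule ccontr)
  assume v0: "v \<noteq> 0"
  have h: "ghom (jpow j \<circ> auS \<circ> pch xs)" by (simp add: ghom_comp)
  have "conjugate ((jpow j \<circ> auS \<circ> pch xs) v) v"
    using conjugate_oeq[OF f, of v] v conjugate_sym by simp
  then have "conjugate (pch (map Not xs @ xs) v) v"
    using fixed_conjugate_square jpow_auS_pch_square h by blast
  moreover have "True \<in> set (map Not xs @ xs)" "False \<in> set (map Not xs @ xs)"
    using xs by (cases xs; cases "hd xs"; auto)+
  ultimately have c: "cpow v" using pch_fixed_cpow v0 by blast
  obtain w where w: "f = cj w \<circ> (jpow j \<circ> auS \<circ> pch xs)" using f by (auto simp: oeq_def)
  have abS: "ab Gen_A (auS x) = ab Gen_B x" "ab Gen_B (auS x) = ab Gen_A x" for x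
    using ab_map[of auS] by simp_all
  have e2: "sg j * sg j = 1" by (simp add: sg_def)
  have "detf f = - ((sg j * sg j) * (ab Gen_A (pch xs gen_a) * ab Gen_B (pch xs gen_b)
      - ab Gen_B (pch xs gen_a) * ab Gen_A (pch xs gen_b)))"
    by (simp add: w detf_def ab_jpow abS algebra_simps)
  then have "detf f = -1" using pch_matrix[of xs] e2 by simp
  moreover have "ghom f" using w h by (simp add: ghom_comp)
  ultimately have "qf v = - qf v" using qf_map[of f v] cpow_ab[OF c] v by simp
  then show False using cpow_qf[OF c] by simp
qed

section \<open>Twists with nonabelian fixed subgroup\<close>

lemma normal_form:
  assumes "reduced u"
  obtains k gs where "u = bz k @ flat gs"
proof -
  define e where "e = snd (hd u)"
  have "hd u \<noteq> inv_letter (Gen_A, e)" by (simp add: e_def inv_letter_def prod_eq_iff)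
  then have "reduced ((Gen_A, e) # u)" using assms by (simp add: reduced_Cons)
  then obtain gs where gs: "(Gen_A, e) # u = flat gs"
    using parse_flat[of "(Gen_A, e) # u"] by auto
  then obtain d k hs where "gs = (d, k) # hs" by (cases gs) auto
  then have "u = bz k @ flat hs" using gs by simp
  then show ?thesis by (rule that)
qed

lemma takeWhile_bz_flat: "takeWhile (\<lambda>l. fst l = Gen_B) (bz k @ flat gs) = bz k"
proof -
  have "\<forall>l \<in> set (bz k). fst l = Gen_B" by (simp add: bz_def)
  then have "takeWhile (\<lambda>l. fst l = Gen_B) (bz k @ flat gs)
      = bz k @ takeWhile (\<lambda>l. fst l = Gen_B) (flat gs)"
    by (simp add: takeWhile_append2)
  then show ?thesis by (cases gs rule: flat.cases) simp_all
qed

lemma bz_inject: "bz j = bz k \<longleftrightarrow> j = k"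
proof
  assume eq: "bz j = bz k"
  then have "nat \<bar>j\<bar> = nat \<bar>k\<bar>" by (metis length_bz)
  moreover have "j \<noteq> 0 \<Longrightarrow> (j < 0) = (k < 0)"
    using hd_bz[of j] hd_bz[of k] eq by (metis bz_eq_Nil prod.inject)
  ultimately show "j = k" by (cases "j = 0"; cases "j < 0") auto
qed simp

lemma bz_flat_inject: "bz j @ flat gs = bz k @ flat hs \<longleftrightarrow> j = k \<and> gs = hs"
proof -
  have 1: "j = k" if "bz j @ flat gs = bz k @ flat hs" for j k gs hs
    using that takeWhile_bz_flat bz_inject by metis
  have "flat gs = flat hs \<Longrightarrow> gs = hs"
  proof (induction gs arbitrary: hs rule: flat.induct)
    case (1 hs)
    then show ?case by (cases hs) auto
  next
    case (2 e k gs)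
    then obtain e' k' hs' where hs: "hs = (e', k') # hs'" by (cases hs rule: flat.cases) auto
    then have "bz k @ flat gs = bz k' @ flat hs'" "e = e'" using 2(2) by auto
    moreover from this have "k = k'" using 1 by blast
    ultimately show ?case using 2(1) hs by simp
  qed
  then show ?thesis using 1[of j gs k hs] by auto
qed

lemma reduced_bz_flat: "reduced (flat gs) \<Longrightarrow> reduced (bz k @ flat gs)"
  by (cases gs rule: flat.cases; cases "k = 0") (auto simp: reduced_append hd_bz inv_letter_def)

lemma good_last:
  assumes "reduced (flat gs)" "gs \<noteq> []"
  shows "good gs (fst (last gs))"
proof -
  obtain hs e k where gs: "gs = hs @ [(e, k)]" using assms(2) by (metis rev_exhaust surj_pair)
  have "last (flat gs) = (if k = 0 then (Gen_A, e) else (Gen_B, k < 0))"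
    by (simp add: gs last_append hd_bz)
  then have "reduced (flat gs @ [(Gen_A, e)])"
    using assms by (auto simp: reduced_append reduced_Cons inv_letter_def split: if_splits)
  then show ?thesis unfolding reduced_flat_iff by (simp add: gs)
qed

lemma good_shift_last: "good gs (fst (last gs)) \<Longrightarrow> good (shift i m gs r) (fst (last gs))"
proof (induction gs)
  case (Cons g gs)
  obtain e k where g: "g = (e, k)" by fastforce
  show ?case
  proof (cases "gs = []")
    case False
    have "nx gs z = fst (hd gs)" for z using False by (simp add: nx_def)
    then show ?thesis using Cons False pre_post[of e "fst (hd gs)" i m]
      by (auto simp: g add.assoc)
  qed (simp add: g)
qed simp

text \<open>The image is already in normal form, so fixed elements can be read off by comparing
  exponents.\<close>

lemma rw_Tw:
  assumes "rw v = bz k @ flat gs" "gs \<noteq> []"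
  shows "rw (Tw i m v) = bz (k + pre i m (fst (hd gs))) @ flat (shift i m gs 0)"
proof -
  have "v = ev (bz k) + ev (flat gs)" using assms(1) by (metis ev_rw ev_simps(3))
  then have "Tw i m v = ev (bz (k + pre i m (fst (hd gs))) @ flat (shift i m gs 0))"
    using Tw_flat[OF assms(2), of i m 0] by (simp add: ghom_add ev_bz_add add.assoc)
  moreover have "reduced (flat gs)"
    using reduced_rw[of v] unfolding assms(1) by (simp add: reduced_append)
  then have "reduced (flat (shift i m gs 0))"
    using good_shift_last[OF good_last[OF _ assms(2)]] good_reduced by blast
  then have "reduced (bz (k + pre i m (fst (hd gs))) @ flat (shift i m gs 0))"
    by (rule reduced_bz_flat)
  ultimately show ?thesis by (simp only: rw_ev_reduced)
qed

text \<open>If the first generator occurs in \<open>v\<close>, the exponent in front of its first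
  occurrence changes by \<open>i\<close> or by \<open>- m\<close>.\<close>

lemma Tw_fixed_cases:
  assumes "Tw i m v = v"
  shows "(\<exists>k. v = ev (bz k)) \<or> i = 0 \<or> m = 0"
proof -
  obtain k gs where v: "rw v = bz k @ flat gs" using normal_form[OF reduced_rw] by blast
  show ?thesis
  proof (cases "gs = []")
    case True
    then have "v = ev (bz k)" using v by (metis append_Nil2 ev_rw flat.simps(1))
    then show ?thesis by blast
  next
    case False
    then have "pre i m (fst (hd gs)) = 0"
      using rw_Tw[OF v False, of i m] assms v by (simp add: bz_flat_inject)
    then show ?thesis by (auto simp: pre_def split: if_splits)
  qed
qed

lemma shift_0_scale:
  "shift 0 m gs 0 = gs \<Longrightarrow> m \<noteq> 0 \<Longrightarrow> shift 0 n gs 0 = gs"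
proof (induction gs)
  case (Cons g gs)
  obtain e k where g: "g = (e, k)" by fastforce
  have "post 0 m e + (if gs = [] then 0 else pre 0 m (fst (hd gs))) = 0" using Cons.prems by (simp add: g)
  then have "post 0 n e + (if gs = [] then 0 else pre 0 n (fst (hd gs))) = 0"
    using Cons.prems(2) by (auto simp: post_def pre_def split: if_splits)
  then show ?case using Cons by (simp add: g)
qed simp

text \<open>All exponents are displaced by multiples of \<open>m\<close>, so being fixed does not
  depend on which nonzero exponent is used.\<close>

lemma Tw_fixed_scale:
  assumes "Tw 0 m v = v" "m \<noteq> 0"
  shows "Tw 0 n v = v"
proof -
  obtain k gs where v: "rw v = bz k @ flat gs" using normal_form[OF reduced_rw] by blast
  show ?thesis
  proof (cases "gs = []")
    case True
    then have "v = ev (bz k)" using v by (metis append_Nil2 ev_rw flat.simps(1))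
    then show ?thesis by simp
  next
    case False
    have "pre 0 m (fst (hd gs)) = 0" "shift 0 m gs 0 = gs"
      using rw_Tw[OF v False, of 0 m] assms(1) v by (simp_all add: bz_flat_inject)
    then have "pre 0 n (fst (hd gs)) = 0" "shift 0 n gs 0 = gs"
      using shift_0_scale assms(2) by (auto simp: pre_def split: if_splits)
    then have "rw (Tw 0 n v) = rw v" using rw_Tw[OF v False, of 0 n] v by simp
    then show ?thesis by (simp only: reduced_word_inject)
  qed
qed

lemma Tw_comp: "Tw 0 m (Tw 0 n v) = Tw 0 (m + n) v"
proof -
  have "Tw 0 m \<circ> Tw 0 n = Tw 0 (m + n)"
  proof (rule ghom_eqI)
    have "Tw 0 m gen_b = gen_b" for m by (simp add: Tw_def)
    moreover have "Tw 0 m gen_a = gen_a + ev (bz m)" for m by (simp add: Tw_def)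
    ultimately show "(Tw 0 m \<circ> Tw 0 n) gen_a = Tw 0 (m + n) gen_a"
      "(Tw 0 m \<circ> Tw 0 n) gen_b = Tw 0 (m + n) gen_b"
      by (simp_all add: ghom_add ev_bz_add add.assoc)
  qed (simp_all add: ghom_comp)
  then show ?thesis by (metis comp_apply)
qed

lemma Tw_0_0: "Tw 0 0 v = v"
proof -
  have "Tw 0 0 = id" by (rule ghom_eqI) (simp_all add: Tw_def)
  then show ?thesis by simp
qed

lemma Tw_gens [simp]: "Tw i m gen_a = ev (bz i) + gen_a + ev (bz m)" "Tw i m gen_b = gen_b"
  by (simp_all add: Tw_def)

lemma bz_1: "ev (bz 1) = gen_b"
  by (simp add: bz_def gen_lt)

lemma comm_bz: "comm (ev (bz j)) (ev (bz k))"
  by (metis add.commute comm_def ev_bz_add)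

lemma Tw_split: "Tw i m = cj (ev (bz i)) \<circ> Tw 0 (i + m)"
proof (rule ghom_eqI)
  have "ev (bz (i + m)) = ev (bz m) + ev (bz i)" by (metis add.commute ev_bz_add)
  then show "Tw i m gen_a = (cj (ev (bz i)) \<circ> Tw 0 (i + m)) gen_a"
    by (simp add: cj_def add.assoc)
  have "cj (ev (bz i)) gen_b = gen_b"
    unfolding cj_comm_iff using comm_bz[of i 1] by (simp add: bz_1)
  then show "Tw i m gen_b = (cj (ev (bz i)) \<circ> Tw 0 (i + m)) gen_b" by simp
qed (simp_all add: ghom_comp)

lemma Tw_B_word: "\<forall>l \<in> set u. fst l = Gen_B \<Longrightarrow> Tw i m (ev u) = ev u"
proof (induction u)
  case (Cons l u)
  then have "Tw i m (lt l) = lt l"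
    by (cases l; cases "snd l") (auto simp: lt_gen ghom_simps Tw_def simp del: lt_True)
  then show ?case using Cons by (simp add: ghom_simps)
qed (simp add: ghom_simps)

lemma gsum_term: "gall (\<lambda>e k e'. 0 \<le> f e k e') gs z \<Longrightarrow> gall (\<lambda>e k e'. f e k e' \<le> gsum f gs z) gs z"
proof (induction gs)
  case (Cons g gs)
  obtain e k where g: "g = (e, k)" by fastforce
  have "gall (\<lambda>e k e'. f e k e' \<le> gsum f gs z) gs z" "0 \<le> gsum f gs z" "0 \<le> f e k (nx gs z)"
    using Cons gsum_nonneg[of f gs z] by (auto simp: g)
  then show ?case by (auto simp: g elim!: gall_mono)
qed simp

lemma post_pre_0: "post 0 m e + pre 0 m e' = m * csgn e e'"
  by (simp add: post_def pre_def csgn_def sg_def)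

text \<open>All iterates stay in one class and keep its cyclic length, while a gap between
  occurrences of equal sign would grow linearly. So the signs alternate, no gap is shifted, and the
  cyclic word itself is fixed.\<close>

lemma twist_fixed_conjugate:
  assumes m: "m > 0" and c: "conjugate (Tw 0 m u) u"
  shows "\<exists>g. Tw 0 1 (cj g u) = cj g u"
proof -
  have cn: "conjugate (Tw 0 (int n * m) u) u" for n
  proof (induction n)
    case (Suc n)
    have "conjugate (Tw 0 m (Tw 0 (int n * m) u)) (Tw 0 m u)"
      by (rule conjugate_map[OF ghom_Tw Suc])
    then show ?case using c conjugate_trans by (simp add: Tw_comp algebra_simps)
  qed (simp add: Tw_0_0)
  have finish: ?thesis if "conjugate u x" "Tw 0 1 x = x" for x
    using that unfolding conjugate_def by blast
  obtain g0 u0 where u0: "u = cj g0 (ev u0)" "cred u0" using cyclic_decomp by blast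
  then have uu0: "conjugate u (ev u0)" by (simp add: conjugate_cj)
  show ?thesis
  proof (cases "\<forall>l \<in> set u0. fst l = Gen_B")
    case True
    then show ?thesis using finish[OF uu0] Tw_B_word by blast
  next
    case False
    then obtain p l q where pq: "u0 = p @ l # q" "fst l = Gen_A" by (metis gen.exhaust split_list)
    have cr: "cred ((l # q) @ p)" using cred_rotation u0(2) unfolding pq(1) by blast
    then obtain gs where gs: "(l # q) @ p = flat gs"
      using parse_flat[of "(l # q) @ p"] cred_reduced pq(2) by auto
    then have gs0: "gs \<noteq> []" by auto
    define z where "z = fst (hd gs)"
    have good: "good gs z" using cr cred_flat[OF gs0] gs by (simp add: z_def)
    have ux: "conjugate u (ev (flat gs))"
      using uu0 conjugate_rotation[of p "l # q"] conjugate_trans unfolding pq(1) gs by blast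
    define L where "L = int (length (flat gs))"
    \<comment> \<open>Enough iterations for one shift to exceed twice the cyclic length, which
      bounds both the old and the new gaps.\<close>
    define n where "n = Suc (2 * length (flat gs))"
    define N where "N = int n * m"
    have N: "N > 2 * L"
    proof -
      have "int n * 1 \<le> int n * m" using m by (intro mult_left_mono) auto
      moreover have "int n = 2 * L + 1" by (simp add: L_def n_def)
      ultimately show ?thesis unfolding N_def by linarith
    qed
    define hs where "hs = shift 0 N gs (pre 0 N z)"
    have hs: "hs \<noteq> []" "fst (hd hs) = z" using gs0 by (simp_all add: hs_def z_def hd_shift)
    have "cred (flat hs)" using good_shift[OF good] cred_flat[OF hs(1)] hs(2) by (simp add: hs_def)
    moreover have "conjugate (ev (flat hs)) (ev (flat gs))"
    proof -
      have "conjugate (ev (flat hs)) (Tw 0 N (ev (flat gs)))"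
        using Tw_conjugate[OF gs0, of 0 N] by (simp add: hs_def z_def)
      also have "conjugate \<dots> (Tw 0 N u)"
        by (rule conjugate_map[OF ghom_Tw conjugate_sym[OF ux]])
      also have "conjugate \<dots> u" using cn[of n] by (simp add: N_def)
      also note ux
      finally show ?thesis .
    qed
    moreover have "cred (flat gs)" using cr gs by simp
    ultimately have "int (length (flat hs)) = L"
      unfolding L_def using length_conjugate by metis
    then have "gsum (\<lambda>e k e'. 1 + \<bar>k\<bar>) hs z = L"
      using csum_flat(4)[OF hs(1)] unfolding hs(2) by simp
    then have "gsum (\<lambda>e k e'. 1 + \<bar>k + N * csgn e e'\<bar>) gs z = L"
      unfolding hs_def gsum_shift by (simp add: add.assoc post_pre_0)
    then have 1: "gall (\<lambda>e k e'. 1 + \<bar>k + N * csgn e e'\<bar> \<le> L) gs z"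
      using gsum_term[of "\<lambda>e k e'. 1 + \<bar>k + N * csgn e e'\<bar>" gs z] by (auto intro: gall_mono[OF gall_True])
    have "gsum (\<lambda>e k e'. 1 + \<bar>k\<bar>) gs z = L"
      using csum_flat(4)[OF gs0] by (simp add: L_def z_def)
    then have 2: "gall (\<lambda>e k e'. 1 + \<bar>k\<bar> \<le> L) gs z"
      using gsum_term[of "\<lambda>e k e'. 1 + \<bar>k\<bar>" gs z] by (auto intro: gall_mono[OF gall_True])
    have c0: "gall (\<lambda>e k e'. csgn e e' = 0) gs z"
      using 1 2 by (rule gall_mono2) (use N in \<open>auto simp: csgn_def sg_def split: if_splits\<close>)
    have "gall (\<lambda>e k e'. csgn e e' = 0) gs z \<Longrightarrow> shift 0 1 gs (pre 0 1 z) = gs" for gs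
    proof (induction gs)
      case (Cons g gs)
      obtain e k where g: "g = (e, k)" by fastforce
      have "shift 0 1 (g # gs) (pre 0 1 z) = (e, k + csgn e (nx gs z)) # shift 0 1 gs (pre 0 1 z)"
        by (simp add: g nx_def add.assoc post_pre_01)
      then show ?case using Cons by (simp add: g)
    qed simp
    then have "shift 0 1 gs (pre 0 1 z) = gs" using c0 by blast
    then have T: "Tw 0 1 (ev (flat gs)) + ev (bz (pre 0 1 z)) = ev (bz (pre 0 1 z)) + ev (flat gs)"
      using Tw_flat[OF gs0, of 0 1 "pre 0 1 z"] by (simp add: z_def)
    show ?thesis
    \<comment> \<open>A word starting with the positive letter is fixed as it stands. If it starts
      with the inverse, the twist conjugates it by \<open>- gen_b\<close>, and conjugating the word
      by \<open>gen_a\<close> makes it fixed.\<close>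
    proof (cases z)
      case False
      then have "Tw 0 1 (ev (flat gs)) = ev (flat gs)" using T by (simp add: pre_def)
      then show ?thesis by (rule finish[OF ux])
    next
      case True
      have b: "bz (- 1) = [(Gen_B, True)]" by (simp add: bz_def)
      have "Tw 0 1 (ev (flat gs)) + - gen_b = - gen_b + ev (flat gs)"
        using T True by (simp add: pre_def b lt_gen del: lt_True)
      then have "Tw 0 1 (ev (flat gs)) + - gen_b + gen_b = - gen_b + ev (flat gs) + gen_b" by simp
      then have "Tw 0 1 (ev (flat gs)) = - gen_b + ev (flat gs) + gen_b" by (simp add: add.assoc)
      then have "Tw 0 1 (cj gen_a (ev (flat gs))) = cj gen_a (ev (flat gs))"
        by (simp add: cj_def ghom_simps bz_1 grp)
      moreover have "conjugate u (cj gen_a (ev (flat gs)))" using ux conjugate_cj(1) conjugate_trans by blast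
      ultimately show ?thesis using finish by blast
    qed
  qed
qed

subsection \<open>Counting one generator\<close>

definition nal :: "letter list \<Rightarrow> nat" where
  "nal u = length (filter (\<lambda>l. fst l = Gen_A) u)"

definition na :: "free2 \<Rightarrow> nat" where
  "na x = nal (rw x)"

lemma nal_simps [simp]: "nal [] = 0" "nal (l # u) = (if fst l = Gen_A then 1 else 0) + nal u"
  "nal (u @ v) = nal u + nal v"
  by (simp_all add: nal_def)

lemma nal_push: "nal (push l w) \<le> nal (l # w)"
  by (cases w) (auto simp: push_def)

lemma nal_foldr_push: "nal (foldr push u w) \<le> nal u + nal w"
proof (induction u)
  case (Cons l u)
  then show ?case using nal_push[of l "foldr push u w"] by simp
qed simp

lemma na_add: "na (x + y) \<le> na x + na y"
  by (simp add: na_def rw_add nal_foldr_push)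

lemma nal_inv_word [simp]: "nal (inv_word u) = nal u"
  by (induction u) (simp_all add: inv_letter_def)

lemma na_minus [simp]: "na (- x) = na x"
  by (simp add: na_def rw_minus)

lemma na_cj: "na (cj g x) \<le> 2 * na g + na x"
  using na_add[of "g + x" "- g"] na_add[of g x] by (simp add: cj_def)

lemma na_ev: "na (ev u) \<le> nal u"
  using nal_foldr_push[of u "[]"] by (simp add: na_def rw_ev)

lemma na_bz [simp]: "na (ev (bz k)) = 0"
proof -
  have "nal (bz k) = 0" by (simp add: nal_def bz_def)
  then show ?thesis using na_ev[of "bz k"] by simp
qed

text \<open>Twists change only powers of the second generator, so the count of the first stays
  bounded along an orbit whose lengths may be unbounded.\<close>

lemma na_Tw_le: "na (Tw i m x) \<le> na x"
proof -
  have "na (Tw i m (ev u)) \<le> nal u" for u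
  proof (induction u)
    case Nil
    then show ?case by (simp add: ghom_0 na_def)
  next
    case (Cons l u)
    have "na (Tw i m (lt l)) \<le> (if fst l = Gen_A then 1 else 0)"
    proof (cases "fst l")
      case Gen_A
      then obtain e where l: "l = (Gen_A, e)" by (cases l) auto
      have "na (lt (Gen_A, e)) = 1" by (simp add: na_def)
      then show ?thesis
        using na_add[of "ev (bz (pre i m e)) + lt (Gen_A, e)" "ev (bz (post i m e))"]
          na_add[of "ev (bz (pre i m e))" "lt (Gen_A, e)"] by (simp add: l Tw_lt_A del: lt_True)
    next
      case Gen_B
      then have "Tw i m (lt l) = lt l" using Tw_B_word[of "[l]" i m] by simp
      then show ?thesis using Gen_B by (simp add: na_def)
    qed
    then show ?case using Cons na_add[of "Tw i m (lt l)" "Tw i m (ev u)"] by (simp add: ghom_add)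
  qed
  from this[of "rw x"] show ?thesis by (simp add: na_def)
qed

subsection \<open>Overlapping periods\<close>

text \<open>Multiplicatively, v = Y X^-1 for two prefixes \<open>X\<close> and \<open>Y\<close> of a
  power of \<open>w\<close>. A long overlap makes both conjugate \<open>w\<close> to the same
  rotation of \<open>w\<close>, so their quotient \<open>v\<close> centralizes
  \<open>w\<close>.\<close>

lemma overlap_commute:
  assumes w: "cred w" and c: "length (lcp (concat (replicate n w)) (rw (v + nsc n (ev w)))) \<ge> len v + length w"
  shows "comm v (ev w)"
proof -
  define P where "P = concat (replicate n w)"
  define W where "W = ev w"
  have P: "reduced P" "ev P = nsc n W"
    using reduced_concat_replicate[OF w] by (simp_all add: P_def W_def ev_concat_replicate)
  have lP: "length P = n * length w" by (simp add: P_def length_concat sum_list_replicate)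
  define s where "s = lcp (rw (- v)) P"
  obtain u t where ut: "rw (- v) = s @ u" "P = s @ t" "u = [] \<or> t = [] \<or> hd u \<noteq> hd t"
    using lcp_decomp unfolding s_def by blast
  have rP: "rw (ev P) = P" using P(1) by simp
  have Q: "rw (v + ev P) = inv_word u @ t"
    using rw_cancel[of "- v" s u "ev P" t] ut rP by simp
  define k d where kd: "k = length s" "d = length u"
  have lv: "k + d = len v"
    using ut(1) by (metis kd len_def len_minus length_append)
  define C where "C = lcp P (inv_word u @ t)"
  have C: "length C \<ge> len v + length w"
    using c Q P(2) unfolding C_def P_def[symmetric] W_def[symmetric] by simp
  have Cle: "length C \<le> length P"
    using lcp_decomp[of P "inv_word u @ t"] unfolding C_def by (metis le_add1 length_append)
  have nth: "P ! i = (inv_word u @ t) ! i" if "i < length C" for i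
    using lcp_nth that unfolding C_def by blast
  have kP: "k + length w \<le> length P" "d + length w \<le> length P" using lv C Cle by simp_all
  have s: "s = take k P" using ut(2) by (simp add: kd)
  have u: "inv_word u = take d P"
  proof (rule nth_equalityI)
    show "length (inv_word u) = length (take d P)" using kP kd by simp
    fix i assume "i < length (inv_word u)"
    then show "inv_word u ! i = take d P ! i"
      using nth[of i] lv C kd by (simp add: nth_append)
  qed
  \<comment> \<open>The block of length \<open>length w\<close> at offset \<open>j\<close> is
    \<open>w\<close> rotated by \<open>j\<close>.\<close>
  have period: "ev (take j P) + ev (take (length w) (drop j P)) = W + ev (take j P)"
    if j: "j + length w \<le> length P" for j
  proof (cases n)
    case 0
    then have "w = []" "P = []" using lP j by (auto simp: P_def)
    then show ?thesis by (simp add: W_def)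
  next
    case (Suc n')
    have P1: "P = w @ concat (replicate n' w)" by (simp add: P_def Suc)
    have P2: "P = concat (replicate n' w) @ w"
      unfolding P_def Suc by (induction n') auto
    have "j \<le> length (concat (replicate n' w))" using j P1 by simp
    then have "take (length w + j) P = w @ take j P"
      by (simp add: P1, metis P1 P2 diff_is_0_eq' append_Nil2 take0 take_append)
    moreover have "take (length w + j) P = take j P @ take (length w) (drop j P)"
      by (simp add: add.commute take_add)
    ultimately show ?thesis by (metis W_def ev_simps(3))
  qed
  \<comment> \<open>After the cancellation, position \<open>d + i\<close> of the product is position
    \<open>k + i\<close> of \<open>P\<close>; by the overlap it is also position
    \<open>d + i\<close> of \<open>P\<close>.\<close>
  have drops: "take (length w) (drop d P) = take (length w) (drop k P)"
  proof (rule nth_equalityI)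
    show "length (take (length w) (drop d P)) = length (take (length w) (drop k P))"
      using kP by simp
    fix i assume "i < length (take (length w) (drop d P))"
    then have i: "i < length w" by simp
    have "P ! (d + i) = (inv_word u @ t) ! (d + i)" using nth lv C i by simp
    also have "\<dots> = t ! i" by (simp add: kd nth_append)
    also have "\<dots> = P ! (k + i)" by (simp add: ut(2) kd nth_append)
    finally show "take (length w) (drop d P) ! i = take (length w) (drop k P) ! i"
      using i kP by simp
  qed
  define X Y Z where XYZ: "X = ev (take k P)" "Y = ev (take d P)" "Z = ev (take (length w) (drop k P))"
  have X: "X + Z = W + X" using period[of k] kP by (simp add: XYZ)
  have Y: "Y + Z = W + Y" using period[of d] kP drops by (simp add: XYZ)
  have "- v = X + ev u" using ut(1) s by (metis XYZ(1) ev_rw ev_simps(3))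
  then have "- v = X + - Y" by (metis XYZ(2) ev_inv_word minus_minus u)
  then have v: "v = Y + - X" by (metis minus_add minus_minus)
  have "W = X + Z + - X" using X by (simp add: add.assoc)
  then have "v + W = Y + Z + - X" by (simp add: v add.assoc)
  also have "\<dots> = W + v" using Y by (simp add: v add.assoc)
  finally show ?thesis by (simp add: comm_def W_def)
qed

text \<open>The \<open>n\<close>-th power of \<open>w\<close> contains the first generator at least
  \<open>n\<close> times, and at most \<open>D\<close> of these lie outside its common prefix with
  \<open>v + nsc n (ev w)\<close>. For large \<open>n\<close> this prefix is long enough for
  \<open>overlap_commute\<close>.\<close>

lemma bounded_na_commute:
  assumes w: "cred w" "nal w > 0" and D: "\<And>n. na (cj (- nsc n (ev w)) v) \<le> D"
  shows "comm v (ev w)"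
proof -
  define n where "n = D + len v + length w"
  define P where "P = concat (replicate n w)"
  have P: "rw (nsc n (ev w)) = P"
    using reduced_concat_replicate[OF w(1)] by (simp add: P_def flip: ev_concat_replicate)
  define Q where "Q = rw (v + nsc n (ev w))"
  obtain t u where tu: "P = lcp P Q @ t" "Q = lcp P Q @ u" "t = [] \<or> u = [] \<or> hd t \<noteq> hd u"
    using lcp_decomp by blast
  have "rw (- nsc n (ev w) + (v + nsc n (ev w))) = inv_word t @ u"
  proof (rule rw_cancel[OF _ _ tu(3)])
    show "rw (nsc n (ev w)) = lcp P Q @ t" using P tu(1) by (rule trans)
    show "rw (v + nsc n (ev w)) = lcp P Q @ u" using Q_def[symmetric] tu(2) by (rule trans)
  qed
  then have "nal t + nal u \<le> D" using D[of n] by (simp add: cj_def na_def add.assoc)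
  moreover have "nal P = n * nal w" by (simp add: P_def) (induction n, simp_all)
  then have "n \<le> nal P" using w(2) by simp
  moreover have "nal P = nal (lcp P Q) + nal t" using tu(1) by (metis nal_simps(3))
  ultimately have "n \<le> nal (lcp P Q) + D" by simp
  moreover have "nal (lcp P Q) \<le> length (lcp P Q)" by (simp add: nal_def)
  ultimately have "length (lcp P Q) \<ge> len v + length w" by (simp add: n_def)
  then show ?thesis using overlap_commute[OF w(1)] by (simp add: P_def Q_def)
qed

lemma centralizer_b:
  assumes "comm x gen_b"
  shows "\<exists>k. x = ev (bz k)"
proof -
  have "cred [(Gen_B, False)]" by (simp add: cred_def reduced_Cons inv_letter_def)
  moreover have "comm x (ev [(Gen_B, False)])" using assms by (simp add: gen_lt)
  ultimately obtain X where X: "X @ [(Gen_B, False)] = [(Gen_B, False)] @ X" "x = ev X \<or> x = - ev X"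
    using comm_cred by blast
  have "\<forall>y \<in> set X. y = l" if "X @ [l] = l # X" for X and l :: letter
    using that by (induction X) auto
  then have "replicate (length X) (Gen_B, False) = X"
    using X(1) by (intro replicate_length_same) auto
  then have "X = bz (int (length X))" unfolding bz_def by simp
  then show ?thesis using X(2) ev_bz_minus by metis
qed

text \<open>After a conjugation the twist fixes \<open>p\<close>, and F is the twist followed by
  conjugation with \<open>w\<close>. Then \<open>w\<close> commutes with \<open>p\<close>, so the
  twist fixes \<open>w\<close> too. Either \<open>w\<close> is 0, or its core involves the first
  generator and the second fixed element \<open>q\<close> would commute with \<open>w\<close>, or
  \<open>w\<close> is conjugate to a power of \<open>gen_b\<close>.\<close>

theorem twist_nonabelian:
  assumes m: "m > 0" and f: "f \<approx> Tw 0 m" and xy: "f x = x" "f y = y" "\<not> comm x y"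
  shows "\<exists>g. f = cj g \<circ> Tw 0 m \<circ> cj (- g)"
proof -
  have conj: "\<exists>g. f' = cj g \<circ> Tw 0 m \<circ> cj (- g)"
    if "cj (- h) \<circ> f' \<circ> cj h = cj g \<circ> Tw 0 m \<circ> cj (- g)" for f' h g
  proof -
    have "f' = cj h \<circ> (cj (- h) \<circ> f' \<circ> cj h) \<circ> cj (- h)" by (simp add: fun_eq_iff)
    also have "\<dots> = cj (h + g) \<circ> Tw 0 m \<circ> cj (- (h + g))" unfolding that by (simp add: fun_eq_iff minus_add)
    finally show ?thesis by blast
  qed
  have "conjugate (Tw 0 m x) x" using conjugate_oeq[OF f, of x] xy(1) conjugate_sym by simp
  then obtain g where g: "Tw 0 1 (cj g x) = cj g x" using twist_fixed_conjugate[OF m] by blast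
  define p where "p = cj g x"
  define q where "q = cj g y"
  define F where "F = cj g \<circ> f \<circ> cj (- g)"
  obtain w0 where w0: "f = cj w0 \<circ> Tw 0 m" using f by (auto simp: oeq_def)
  define w where "w = g + w0 + Tw 0 m (- g)"
  have F: "F = cj w \<circ> Tw 0 m" by (simp add: F_def w0 w_def fun_eq_iff ghom_cj_map add.assoc)
  have Fpq: "F p = p" "F q = q" "\<not> comm p q" using xy by (simp_all add: F_def p_def q_def)
  have p0: "p \<noteq> 0" using Fpq(3) by auto
  have Tp: "Tw 0 k p = p" for k using Tw_fixed_scale[of 1 p k] g by (simp add: p_def)
  then have "comm w p" using Fpq(1) by (simp add: F cj_comm_iff)
  then have Tww: "Tw 0 k w = w" for k using fixes_centralizer[OF ghom_Tw Tp p0] by blast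
  have "\<exists>g. F = cj g \<circ> Tw 0 m \<circ> cj (- g)"
  proof (cases "w = 0")
    case True
    then have "F = cj 0 \<circ> Tw 0 m \<circ> cj (- 0)" by (simp add: F fun_eq_iff)
    then show ?thesis by blast
  next
    case w0: False
    \<comment> \<open>The \<open>n\<close>-th iterate of F; the inner factors multiply to
      \<open>nsc n w\<close> because the twist fixes \<open>w\<close>.\<close>
    have Fn: "cj (nsc n w) (Tw 0 (int n * m) q) = q" for n
    proof (induction n)
      case (Suc n)
      have "F (cj (nsc n w) (Tw 0 (int n * m) q)) = q" using Suc Fpq(2) by simp
      moreover have "Tw 0 m (nsc n w) = nsc n w" using Tww by (simp add: ghom_nsc)
      ultimately have "cj (w + nsc n w) (Tw 0 (m + int n * m) q) = q"
        by (simp add: F ghom_cj_map Tw_comp)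
      then show ?case by (simp add: algebra_simps)
    qed (simp add: Tw_0_0)
    obtain h v where hv: "w = cj h (ev v)" "cred v" using cyclic_decomp by blast
    show ?thesis
    proof (cases "nal v > 0")
      case True
      have "na (cj (- nsc n (ev v)) (cj (- h) q)) \<le> 2 * na h + na q" for n
      proof -
        have "cj (- nsc n w) q = Tw 0 (int n * m) q" using Fn[of n] by (metis cj_eq_iff)
        moreover have "- nsc n w = h + - nsc n (ev v) + - h"
          using hv(1) by (metis cj_def cj_nsc cj_simps(4))
        ultimately have "cj (- nsc n (ev v)) (cj (- h) q) = cj (- h) (Tw 0 (int n * m) q)"
          by (metis cj_simps(3) add.assoc add_minus_cancel'(2))
        then show ?thesis using na_cj[of "- h" "Tw 0 (int n * m) q"] na_Tw_le[of 0 "int n * m" q] by simp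
      qed
      then have "comm (cj (- h) q) (ev v)" using bounded_na_commute[OF hv(2) True] by blast
      then have "comm q w" unfolding hv(1) by (metis add.right_inverse cj_simps(1,3) comm_cj_iff)
      then have "comm p q" using \<open>comm w p\<close> comm_trans[of p w q] w0 comm_sym by blast
      then show ?thesis using Fpq(3) by blast
    next
      case False
      obtain k gs where kg: "v = bz k @ flat gs" using normal_form[OF cred_reduced[OF hv(2)]] .
      have "gs = []" using False kg by (cases gs rule: flat.cases) auto
      then have v: "v = bz k" using kg by simp
      have "ev (replicate n l) = nsc n (lt l)" for n l by (induction n) simp_all
      then have evk: "ev (bz k) = nsc (nat \<bar>k\<bar>) (if k < 0 then - gen_b else gen_b)"
        by (simp add: bz_def lt_gen del: lt_True)
      have k0: "k \<noteq> 0" using w0 hv(1) v by auto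
      define e where "e = (if k < 0 then - gen_b else gen_b)"
      \<comment> \<open>\<open>w\<close> is a multiple of a conjugate of \<open>gen_b\<close> or its
        inverse, and F fixes \<open>w\<close>; roots of fixed elements are fixed.\<close>
      have we: "w = nsc (nat \<bar>k\<bar>) (cj h e)" unfolding hv(1) v evk e_def cj_nsc ..
      have hF: "ghom F" by (simp add: F ghom_comp)
      have "F w = w" using Tww by (simp add: F)
      then have "F (nsc (nat \<bar>k\<bar>) (cj h e)) = nsc (nat \<bar>k\<bar>) (cj h e)" unfolding we .
      then have "F (cj h e) = cj h e"
        by (rule fixes_root[OF hF, rotated]) (use k0 in simp)
      then have Fb: "F (cj h gen_b) = cj h gen_b"
        using hF by (cases "k < 0") (simp_all add: e_def ghom_minus)
      define F' where "F' = cj (- h) \<circ> F \<circ> cj h"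
      define w' where "w' = - h + w + Tw 0 m h"
      have F': "F' = cj w' \<circ> Tw 0 m" by (simp add: F'_def F w'_def fun_eq_iff ghom_cj_map add.assoc)
      have "Tw 0 m gen_b = gen_b" by (simp add: Tw_def)
      moreover have "F' gen_b = gen_b" using Fb by (simp add: F'_def cj_eq_iff)
      ultimately have "comm w' gen_b" by (simp add: F' cj_comm_iff)
      then obtain i where "w' = ev (bz i)" using centralizer_b by blast
      then have F'2: "F' = Tw i (m - i)" using Tw_split[of i "m - i"] F' by simp
      define q' where "q' = cj (- h) q"
      have "F' q' = q'" using Fpq(2) by (simp add: F'_def q'_def)
      then have "(\<exists>j. q' = ev (bz j)) \<or> i = 0 \<or> m - i = 0" using Tw_fixed_cases F'2 by metis
      moreover have "q' \<noteq> ev (bz j)" for j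
      proof
        assume "q' = ev (bz j)"
        then have "comm q' (ev v)" unfolding v by (simp add: comm_bz)
        then have "comm q w" unfolding hv(1) q'_def by (metis add.right_inverse cj_simps(1,3) comm_cj_iff)
        then show False using \<open>comm w p\<close> comm_trans[of p w q] w0 comm_sym Fpq(3) by blast
      qed
      ultimately have "i = 0 \<or> i = m" by auto
      then have "\<exists>g. F' = cj g \<circ> Tw 0 m \<circ> cj (- g)"
      proof
        assume "i = 0"
        then have "F' = cj 0 \<circ> Tw 0 m \<circ> cj (- 0)" by (simp add: F'2 fun_eq_iff)
        then show ?thesis by blast
      next
        \<comment> \<open>Multiplicatively b^m a = a^-1 (a b^m) a: the left twist is the right twist
          conjugated by a.\<close>
        assume i: "i = m"
        have "cj (ev (bz m)) gen_b = gen_b"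
          unfolding cj_comm_iff using comm_bz[of m 1] by (simp add: bz_1)
        then have "ev (bz m) + (gen_b + - ev (bz m)) = gen_b" by (simp add: cj_def add.assoc)
        then have "Tw m 0 = cj (- gen_a) \<circ> Tw 0 m \<circ> cj (- (- gen_a))"
          by (intro ghom_eqI) (simp_all add: ghom_comp ghom_cj_map, simp_all add: cj_def grp)
        moreover have "F' = Tw m 0" using F'2 i by simp
        ultimately show ?thesis by metis
      qed
      then show ?thesis using conj[of h F] unfolding F'_def by blast
    qed
  qed
  then show ?thesis using conj[of "- g" f] unfolding F_def minus_minus by blast
qed

section \<open>Automorphisms of finite outer order\<close>

subsection \<open>Sanov's representation\<close>

type_synonym mat2 = "int \<times> int \<times> int \<times> int"

fun mm :: "mat2 \<Rightarrow> mat2 \<Rightarrow> mat2" where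
  "mm (p, q, r, s) (p', q', r', s') = (p * p' + q * r', p * q' + q * s', r * p' + s * r', r * q' + s * s')"

fun mneg :: "mat2 \<Rightarrow> mat2" where
  "mneg (p, q, r, s) = (- p, - q, - r, - s)"

fun mdet :: "mat2 \<Rightarrow> int" where
  "mdet (p, q, r, s) = p * s - q * r"

fun act :: "mat2 \<Rightarrow> int \<times> int \<Rightarrow> int \<times> int" where
  "act (p, q, r, s) (x, y) = (p * x + q * y, r * x + s * y)"

abbreviation m1 :: mat2 where "m1 \<equiv> (1, 0, 0, 1)"

lemma mm_assoc: "mm (mm M N) K = mm M (mm N K)"
  by (cases M; cases N; cases K) (simp add: algebra_simps)

lemma mm_1 [simp]: "mm m1 M = M" "mm M m1 = M"
  by (cases M; simp)+

lemma mm_mneg [simp]: "mm (mneg M) N = mneg (mm M N)" "mm M (mneg N) = mneg (mm M N)"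
  "mneg (mneg M) = M"
  by (cases M; cases N; simp)+

lemma mdet_mm: "mdet (mm M N) = mdet M * mdet N"
  by (cases M; cases N) (simp add: algebra_simps)

lemma act_mm: "act (mm M N) v = act M (act N v)"
  by (cases M; cases N; cases v) (simp add: algebra_simps)

text \<open>Sanov's generators of a free group of integer matrices; a quadruple lists the entries
  row by row.\<close>

fun ml :: "letter \<Rightarrow> mat2" where
  "ml (Gen_A, e) = (1, 2 * sg e, 0, 1)"
| "ml (Gen_B, e) = (1, 0, 2 * sg e, 1)"

definition mw :: "letter list \<Rightarrow> mat2" where
  "mw u = foldr (\<lambda>l. mm (ml l)) u m1"

definition mat :: "free2 \<Rightarrow> mat2" where
  "mat x = mw (rw x)"

lemma mw_simps [simp]: "mw [] = m1" "mw (l # u) = mm (ml l) (mw u)"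
  by (simp_all add: mw_def)

lemma ml_inv: "mm (ml l) (ml (inv_letter l)) = m1"
  by (cases l; cases "fst l") (auto simp: inv_letter_def sg_def)

lemma mw_push: "mw (push l w) = mm (ml l) (mw w)"
proof (cases w)
  case (Cons m w')
  then show ?thesis
    using ml_inv[of l] by (auto simp: push_def simp flip: mm_assoc)
qed (simp add: push_def)

lemma mat_add: "mat (x + y) = mm (mat x) (mat y)"
proof -
  have "mw (foldr push u w) = mm (mw u) (mw w)" for u w
    by (induction u) (simp_all add: mw_push mm_assoc)
  then show ?thesis by (simp add: mat_def rw_add)
qed

lemma mat_0 [simp]: "mat 0 = m1"
  by (simp add: mat_def)

lemma mat_inverse: "mm (mat (- x)) (mat x) = m1" "mm (mat x) (mat (- x)) = m1"
  by (simp_all flip: mat_add)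

lemma mat_gens: "mat gen_a = (1, 2, 0, 1)" "mat gen_b = (1, 0, 2, 1)"
  "mat (- gen_a) = (1, - 2, 0, 1)" "mat (- gen_b) = (1, 0, - 2, 1)"
  unfolding gen_lt lt_True[symmetric] by (simp_all add: mat_def sg_def del: lt_True)

text \<open>Four disjoint double sectors of the plane, one for each letter; none of them meets a
  coordinate axis.\<close>

fun pingpong :: "letter \<Rightarrow> int \<times> int \<Rightarrow> bool" where
  "pingpong (Gen_A, False) (x, y) \<longleftrightarrow> (y > 0 \<and> x > y) \<or> (y < 0 \<and> x < y)"
| "pingpong (Gen_A, True) (x, y) \<longleftrightarrow> (y > 0 \<and> x < - y) \<or> (y < 0 \<and> x > - y)"
| "pingpong (Gen_B, False) (x, y) \<longleftrightarrow> (x > 0 \<and> y > x) \<or> (x < 0 \<and> y < x)"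
| "pingpong (Gen_B, True) (x, y) \<longleftrightarrow> (x > 0 \<and> y < - x) \<or> (x < 0 \<and> y > - x)"

lemma pingpong_step: "pingpong m v \<Longrightarrow> m \<noteq> inv_letter l \<Longrightarrow> pingpong l (act (ml l) v)"
proof -
  obtain x y where v: "v = (x, y)" by fastforce
  obtain g e where l: "l = (g, e)" by fastforce
  obtain h d where m: "m = (h, d)" by fastforce
  assume "pingpong m v" "m \<noteq> inv_letter l"
  then show ?thesis
    unfolding v l m by (cases g; cases h; cases e; cases d; simp add: inv_letter_def sg_def; elim disjE conjE; simp)
qed

text \<open>The starting vector is the axis vector that the last letter does not fix, so this letter
  moves it into its own sector.\<close>

lemma mw_pingpong:
  assumes "reduced u" "u \<noteq> []"
  shows "pingpong (hd u) (act (mw u) (if fst (last u) = Gen_A then (0, 1) else (1, 0)))"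
  using assms
proof (induction u)
  case (Cons l u)
  show ?case
  proof (cases "u = []")
    case True
    then show ?thesis by (cases l; cases "fst l"; cases "snd l") (auto simp: sg_def)
  next
    case False
    then show ?thesis
      using Cons pingpong_step[of "hd u" _ l] by (simp add: act_mm reduced_Cons)
  qed
qed simp

text \<open>A nontrivial word moves an axis vector into a sector, which the identity and its
  negative do not. So Sanov's representation is faithful even up to sign.\<close>

lemma mat_eq_1:
  assumes "mat x = m1 \<or> mat x = mneg m1"
  shows "x = 0"
proof (rule ccontr)
  assume "x \<noteq> 0"
  then have "rw x \<noteq> []" by (metis ev_rw ev_simps(1))
  then have "pingpong (hd (rw x)) (act (mat x) (if fst (last (rw x)) = Gen_A then (0, 1) else (1, 0)))"
    using mw_pingpong[of "rw x"] by (simp add: mat_def)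
  then show False
    using assms by (cases "hd (rw x)"; cases "fst (hd (rw x))"; cases "snd (hd (rw x))")
      (auto split: if_splits)
qed

lemma mat_comm: "mm (mat x) (mat y) = mm (mat y) (mat x) \<Longrightarrow> comm x y"
proof -
  assume "mm (mat x) (mat y) = mm (mat y) (mat x)"
  then have "mat (- (y + x) + (x + y)) = m1"
    by (metis mat_add mat_inverse(1))
  then have "- (y + x) + (x + y) = 0" using mat_eq_1 by blast
  then show ?thesis by (simp add: comm_def neg_eq_iff_add_eq_0 eq_commute[of "x + y"] flip: eq_neg_iff_add_eq_0)
qed

definition nonscalar :: "mat2 \<Rightarrow> bool" where
  "nonscalar t \<longleftrightarrow> (case t of (p, q, r, s) \<Rightarrow> q \<noteq> 0 \<or> r \<noteq> 0 \<or> p \<noteq> s)"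

text \<open>For a matrix commuting with \<open>t\<close> the vector of off-diagonal entries and
  difference of diagonal entries is proportional to that of \<open>t\<close>. So any two such
  vectors are proportional, and this is what commuting means.\<close>

lemma nonscalar_centralizer:
  assumes t: "nonscalar t" and M: "mm t M = mm M t" and N: "mm t N = mm N t"
  shows "mm M N = mm N M"
proof -
  obtain p q r s where tt: "t = (p, q, r, s)" by (metis prod_cases4)
  obtain a b c d where MM: "M = (a, b, c, d)" by (metis prod_cases4)
  obtain a' b' c' d' where NN: "N = (a', b', c', d')" by (metis prod_cases4)
  have m: "q * c = b * r" "q * (d - a) = b * (s - p)" "r * (d - a) = c * (s - p)"
  proof -
    have "p * a + q * c = a * p + b * r" "p * b + q * d = a * q + b * s" "r * a + s * c = c * p + d * r"
      using M unfolding tt MM by (simp_all only: mm.simps prod.inject)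
    then show "q * c = b * r" "q * (d - a) = b * (s - p)" "r * (d - a) = c * (s - p)" by algebra+
  qed
  have n: "q * c' = b' * r" "q * (d' - a') = b' * (s - p)" "r * (d' - a') = c' * (s - p)"
  proof -
    have "p * a' + q * c' = a' * p + b' * r" "p * b' + q * d' = a' * q + b' * s"
      "r * a' + s * c' = c' * p + d' * r"
      using N unfolding tt NN by (simp_all only: mm.simps prod.inject)
    then show "q * c' = b' * r" "q * (d' - a') = b' * (s - p)" "r * (d' - a') = c' * (s - p)" by algebra+
  qed
  have k: "b * c' = b' * c \<and> b * (d' - a') = b' * (d - a) \<and> c * (d' - a') = c' * (d - a)"
  proof -
    consider "q \<noteq> 0" | "r \<noteq> 0" | "s - p \<noteq> 0" using t by (auto simp: nonscalar_def tt)
    then show ?thesis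
    proof cases
      case 1
      have "q * (b * c' - b' * c) = 0" "q * (b * (d' - a') - b' * (d - a)) = 0"
        "q * (q * (c * (d' - a') - c' * (d - a))) = 0"
        using m n by algebra+
      then show ?thesis using 1 by simp
    next
      case 2
      have "r * (b * c' - b' * c) = 0" "r * (r * (b * (d' - a') - b' * (d - a))) = 0"
        "r * (c * (d' - a') - c' * (d - a)) = 0"
        using m n by algebra+
      then show ?thesis using 2 by simp
    next
      case 3
      have "(s - p) * ((s - p) * (b * c' - b' * c)) = 0" "(s - p) * (b * (d' - a') - b' * (d - a)) = 0"
        "(s - p) * (c * (d' - a') - c' * (d - a)) = 0"
        using m n by algebra+
      then show ?thesis using 3 by simp
    qed
  qed
  have "a * a' + b * c' = a' * a + b' * c" "a * b' + b * d' = a' * b + b' * d"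
    "c * a' + d * c' = c' * a + d' * c" "c * b' + d * d' = c' * b + d' * d"
    using k by algebra+
  then show ?thesis by (simp only: MM NN mm.simps)
qed

text \<open>Matrices count up to sign, as in $PSL_2(\mathbb{Z})$.\<close>

definition implements :: "mat2 \<Rightarrow> (free2 \<Rightarrow> free2) \<Rightarrow> bool" where
  "implements t f \<longleftrightarrow> (\<forall>x. mm t (mat x) = mm (mat (f x)) t \<or> mm t (mat x) = mneg (mm (mat (f x)) t))"

lemma implementsI:
  assumes f: "ghom f"
    and a: "mm t (mat gen_a) = mm (mat (f gen_a)) t \<or> mm t (mat gen_a) = mneg (mm (mat (f gen_a)) t)"
    and b: "mm t (mat gen_b) = mm (mat (f gen_b)) t \<or> mm t (mat gen_b) = mneg (mm (mat (f gen_b)) t)"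
  shows "implements t f"
proof -
  define P where "P x \<longleftrightarrow> mm t (mat x) = mm (mat (f x)) t \<or> mm t (mat x) = mneg (mm (mat (f x)) t)" for x
  have add: "P (x + y)" if "P x" "P y" for x y
  proof -
    have "mm t (mat (x + y)) = mm (mm t (mat x)) (mat y)" by (simp add: mat_add mm_assoc)
    moreover have "mm (mat (f (x + y))) t = mm (mat (f x)) (mm (mat (f y)) t)"
      using f by (simp add: ghom_add mat_add mm_assoc)
    moreover have "mm (mm (mat (f x)) t) (mat y) = mm (mat (f x)) (mm t (mat y))" by (rule mm_assoc)
    ultimately show ?thesis using that unfolding P_def by auto
  qed
  have neg: "P (- x)" if "P x" for x
  proof -
    have 1: "mm (mat (f (- x))) (mm (mat (f x)) t) = t"
      using f mat_inverse(1)[of "f x"] by (simp add: ghom_minus flip: mm_assoc)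
    have 2: "mm (mm t (mat x)) (mat (- x)) = t"
      using mat_inverse(2)[of x] by (simp add: mm_assoc)
    have "mm (mat (f (- x))) (mm (mm t (mat x)) (mat (- x))) = mm (mat (f (- x))) t" by (simp add: 2)
    moreover have "mm (mat (f (- x))) (mm (mm (mat (f x)) t) (mat (- x))) = mm t (mat (- x))"
      using 1 by (simp flip: mm_assoc)
    ultimately show ?thesis using that unfolding P_def by (metis mm_mneg)
  qed
  have gens: "P gen_a" "P gen_b" using a b unfolding P_def by blast+
  have "P (ev u)" for u
  proof (induction u)
    case Nil
    then show ?case using add[OF gens(1) neg[OF gens(1)]] by simp
  next
    case (Cons l u)
    have "P (lt l)"
      using gens gens[THEN neg] by (cases l; cases "fst l"; cases "snd l") (auto simp: lt_gen simp del: lt_True)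
    then show ?case using add Cons by simp
  qed
  from this[of "rw x" for x] show ?thesis by (simp add: implements_def P_def)
qed

lemma implements_cj: "implements t f \<Longrightarrow> implements (mm (mat w) t) (cj w \<circ> f)"
proof -
  assume i: "implements t f"
  have "mm (mat (cj w (f x))) (mm (mat w) t) = mm (mat w) (mm (mat (f x)) t)" for x
    using mat_inverse(1)[of w] by (simp add: cj_def mat_add mm_assoc) (simp flip: mm_assoc)
  moreover have "mm (mm (mat w) t) (mat x) = mm (mat w) (mm t (mat x))" for x by (rule mm_assoc)
  ultimately show ?thesis using i unfolding implements_def comp_apply by (metis mm_mneg(2))
qed

lemma comm_double: "comm (x + x) (y + y) \<Longrightarrow> comm x (y :: free2)"
proof -
  assume c: "comm (x + x) (y + y)"
  have d: "comm z (z + z)" for z :: free2 by (simp add: comm_def add.assoc)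
  have nz: "z + z = 0 \<Longrightarrow> z = 0" for z :: free2 using torsion_free[of 2 z] by (simp add: numeral_2_eq_2)
  show ?thesis
  proof (cases "x = 0 \<or> y = 0")
    case False
    then have "comm x (y + y)" using comm_trans[OF d[of x] comm_sym[OF c]] nz by blast
    then show ?thesis using comm_trans[of x "y + y" y] d[of y] nz False by blast
  qed auto
qed

text \<open>A fixed element commutes with \<open>t\<close> only up to sign; its double commutes
  exactly, and commuting doubles force commuting elements.\<close>

lemma implements_fixed_commute:
  assumes "implements t f" "nonscalar t" "f x = x" "f y = y"
  shows "comm x y"
proof -
  have "mm t (mat (z + z)) = mm (mat (z + z)) t" if "f z = z" for z
  proof -
    have "mm t (mat (z + z)) = mm (mm t (mat z)) (mat z)" by (simp add: mat_add mm_assoc)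
    moreover have "mm (mm (mat z) t) (mat z) = mm (mat z) (mm t (mat z))" by (rule mm_assoc)
    ultimately show ?thesis using assms(1) that unfolding implements_def
      by (metis mat_add mm_assoc mm_mneg)
  qed
  then show ?thesis
    using nonscalar_centralizer[OF assms(2)] assms(3,4) mat_comm comm_double by blast
qed

lemma mat_props: "mdet (mat x) = 1 \<and> (\<exists>p q r s. mat x = (2 * p + 1, 2 * q, 2 * r, 2 * s + 1))"
proof -
  have "mdet (mw u) = 1 \<and> (\<exists>p q r s. mw u = (2 * p + 1, 2 * q, 2 * r, 2 * s + 1))" for u
  proof (induction u)
    case Nil
    show ?case by (auto intro: exI[of _ 0])
  next
    case (Cons l u)
    then obtain p q r s where mw: "mw u = (2 * p + 1, 2 * q, 2 * r, 2 * s + 1)" by blast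
    have "mdet (ml l) = 1" by (cases l; cases "fst l") auto
    moreover have "\<exists>p' q' r' s'. mw (l # u) = (2 * p' + 1, 2 * q', 2 * r', 2 * s' + 1)"
    proof (cases "fst l")
      case Gen_A
      then obtain e where l: "l = (Gen_A, e)" by (cases l) auto
      show ?thesis
        by (rule exI[of _ "p + 2 * sg e * r"], rule exI[of _ "q + sg e * (2 * s + 1)"], rule exI[of _ r], rule exI[of _ s])
          (simp add: l mw algebra_simps)
    next
      case Gen_B
      then obtain e where l: "l = (Gen_B, e)" by (cases l) auto
      show ?thesis
        by (rule exI[of _ p], rule exI[of _ q], rule exI[of _ "r + sg e * (2 * p + 1)"], rule exI[of _ "s + 2 * sg e * q"])
          (simp add: l mw algebra_simps)
    qed
    ultimately show ?case using Cons by (simp add: mdet_mm)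
  qed
  then show ?thesis by (simp add: mat_def)
qed

text \<open>The determinant of a scalar integer matrix is a square, while \<open>mat w\<close> has
  determinant 1.\<close>

lemma nonscalar_det: "mdet t = - 1 \<Longrightarrow> nonscalar (mm (mat w) t)"
proof (rule ccontr)
  assume t: "mdet t = - 1" and "\<not> nonscalar (mm (mat w) t)"
  then obtain p where p: "mm (mat w) t = (p, 0, 0, p)"
    by (auto simp: nonscalar_def split: prod.splits)
  have "mdet (mm (mat w) t) = - 1" using mat_props[of w] t by (simp add: mdet_mm)
  then have "p * p = - 1" by (simp add: p)
  then show False by (metis not_square_less_zero zero_less_one neg_less_0_iff_less)
qed

text \<open>Modulo 2 every \<open>mat w\<close> is the identity, so the upper right entry stays odd
  and cannot vanish.\<close>

lemma nonscalar_odd: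
  assumes "odd (q + 2 * k)"
  shows "nonscalar (mm (mat w) (p, q, r, s))"
proof -
  obtain a b c d where w: "mat w = (2 * a + 1, 2 * b, 2 * c, 2 * d + 1)" using mat_props[of w] by blast
  have "odd ((2 * a + 1) * q + 2 * b * s)" using assms by simp
  then have "(2 * a + 1) * q + 2 * b * s \<noteq> 0" by (metis even_zero)
  then show ?thesis by (simp add: nonscalar_def w)
qed

text \<open>A property of the whole outer class, as the normal form of an automorphism is known only
  up to inner factors.\<close>

definition elliptic :: "(free2 \<Rightarrow> free2) \<Rightarrow> bool" where
  "elliptic g \<longleftrightarrow> (\<forall>f x y. f \<approx> g \<longrightarrow> f x = x \<longrightarrow> f y = y \<longrightarrow> comm x y)"

lemma elliptic_implements:
  assumes "implements t g" "\<And>w. nonscalar (mm (mat w) t)"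
  shows "elliptic g"
  unfolding elliptic_def oeq_def
  using implements_fixed_commute[OF implements_cj[OF assms(1)] assms(2)] by blast

text \<open>The diagonal matrix with entries 1 and -1 inverts both Sanov generators.\<close>

lemma elliptic_J: "elliptic auJ"
  by (rule elliptic_implements[of "(1, 0, 0, - 1)"], rule implementsI)
    (simp_all add: mat_gens nonscalar_det)

lemma elliptic_S: "elliptic auS"
  by (rule elliptic_implements[of "(0, 1, 1, 0)"], rule implementsI)
    (simp_all add: mat_gens nonscalar_det)

lemma elliptic_JS: "elliptic (auJ \<circ> auS)"
  by (rule elliptic_implements[of "(0, 1, - 1, 0)"], rule implementsI)
    (simp_all add: mat_gens ghom_comp nonscalar_odd[of _ 0])

text \<open>The sign allowed by \<open>implements\<close> is really used here: the relation for
  \<open>gen_a\<close> holds only with a minus.\<close>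

lemma elliptic_R_sigma: "elliptic (auR \<circ> sigma)"
  by (rule elliptic_implements[of "(1, - 1, 1, 0)"], rule implementsI)
    (simp_all add: mat_gens mat_add ghom_comp ghom_simps nonscalar_odd[of _ 0])

lemma elliptic_JR_sigma: "elliptic (auJ \<circ> auR \<circ> sigma)"
  by (rule elliptic_implements[of "(1, - 1, - 1, 0)"], rule implementsI)
    (simp_all add: mat_gens mat_add ghom_comp ghom_simps nonscalar_det)

lemma elliptic_ocj:
  assumes "ocj g h" "elliptic h"
  shows "elliptic g"
  unfolding elliptic_def
proof (intro allI impI)
  fix f x y assume f: "f \<approx> g" "f x = x" "f y = y"
  obtain \<alpha> where \<alpha>: "aut \<alpha>" "\<alpha> \<circ> g \<approx> h \<circ> \<alpha>" using assms(1) by (auto simp: ocj_def)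
  obtain \<beta> where \<beta>: "\<alpha> \<circ> \<beta> = id" "\<beta> \<circ> \<alpha> = id" using aut_inverse[OF \<alpha>(1)] by metis
  have "\<alpha> \<circ> f \<circ> \<beta> \<approx> \<alpha> \<circ> g \<circ> \<beta>" using f(1) \<alpha>(1) by (intro oeq_right oeq_left) (simp_all add: aut_ghom)
  also have "\<dots> \<approx> h \<circ> \<alpha> \<circ> \<beta>" by (rule oeq_right[OF \<alpha>(2)])
  also have "\<dots> \<approx> h" by (intro oeq_eq) (simp add: comp_assoc \<beta>)
  finally have "\<alpha> \<circ> f \<circ> \<beta> \<approx> h" .
  moreover have "(\<alpha> \<circ> f \<circ> \<beta>) (\<alpha> z) = \<alpha> z" if "f z = z" for z
    using that \<beta>(2) by (metis comp_apply id_apply)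
  ultimately have "comm (\<alpha> x) (\<alpha> y)" using assms(2) f unfolding elliptic_def by blast
  then have "\<alpha> (x + y) = \<alpha> (y + x)" using aut_ghom[OF \<alpha>(1)] by (simp add: comm_def ghom_add)
  then show "comm x y" using \<alpha>(1) by (simp add: comm_def aut_inject)
qed

lemma elliptic_square:
  assumes "ghom g" "g \<circ> g \<approx> h" "elliptic h"
  shows "elliptic g"
  unfolding elliptic_def
proof (intro allI impI)
  fix f x y assume f: "f \<approx> g" "f x = x" "f y = y"
  have "f \<circ> f \<approx> g \<circ> g" using f(1) assms(1) by (intro oeq_comp)
  then have "f \<circ> f \<approx> h" using assms(2) oeq_trans by blast
  then show "comm x y" using assms(3) f unfolding elliptic_def by (metis comp_apply)
qed

lemma elliptic_R: "elliptic (jpow j \<circ> auR)"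
proof (rule elliptic_square[OF _ _ elliptic_J])
  have "(jpow j \<circ> auR) \<circ> (jpow j \<circ> auR) = auJ"
    by (rule ghom_eqI; cases j; simp add: ghom_comp ghom_simps jpow_def)
  then show "(jpow j \<circ> auR) \<circ> (jpow j \<circ> auR) \<approx> auJ" by (rule oeq_eq)
qed (simp add: ghom_comp)

lemma elliptic_R_tw: "elliptic (jpow j \<circ> auR \<circ> tw x)"
proof -
  have sig: "elliptic (jpow j \<circ> auR \<circ> sigma)" for j
    using elliptic_R_sigma elliptic_JR_sigma by (simp add: jpow_def)
  show ?thesis
  proof (cases x)
    case False
    have "auS \<circ> (jpow j \<circ> auR \<circ> tau) = (jpow (\<not> j) \<circ> auR \<circ> sigma) \<circ> auS"
      by (rule ghom_eqI; cases j; simp add: ghom_comp ghom_simps jpow_def)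
    then have "ocj (jpow j \<circ> auR \<circ> tau) (jpow (\<not> j) \<circ> auR \<circ> sigma)"
      by (intro ocjI[of auS] oeq_eq) simp_all
    then have "elliptic (jpow j \<circ> auR \<circ> tau)" by (rule elliptic_ocj[OF _ sig])
    then show ?thesis using False by simp
  qed (use sig in simp)
qed

subsection \<open>The reflection in one generator\<close>

text \<open>No invertible matrix implements \<open>auD\<close>, even up to sign:
  \<open>mat (gen_a + gen_b)\<close> has trace 6, but its image \<open>mat (- gen_a + gen_b)\<close>
  has trace -2. Hence a direct argument on words.\<close>

definition dlet :: "letter \<Rightarrow> letter" where
  "dlet l = (if fst l = Gen_A then inv_letter l else l)"

lemma dlet_simps [simp]: "dlet (dlet l) = l" "dlet (inv_letter l) = inv_letter (dlet l)"
  "fst l = Gen_A \<Longrightarrow> dlet l = inv_letter l" "dlet l = dlet m \<longleftrightarrow> l = m"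
proof -
  show *: "dlet (dlet l) = l" for l by (auto simp: dlet_def inv_letter_def prod_eq_iff)
  show "dlet (inv_letter l) = inv_letter (dlet l)" by (auto simp: dlet_def inv_letter_def)
  show "dlet l = dlet m \<longleftrightarrow> l = m" using * by metis
qed (simp add: dlet_def)

lemma auD_lt: "auD (lt l) = lt (dlet l)"
  by (cases l; cases "fst l"; cases "snd l") (auto simp: dlet_def inv_letter_def lt_gen ghom_simps simp del: lt_True)

lemma auD_ev: "auD (ev u) = ev (map dlet u)"
  by (induction u) (simp_all add: ghom_simps auD_lt)

lemma rw_auD: "rw (auD x) = map dlet (rw x)"
proof -
  have "reduced (map dlet (rw x))"
    using reduced_rw[of x] by (simp add: reduced_def successively_map flip: dlet_simps(2))
  then show ?thesis using auD_ev[of "rw x"] by (metis ev_rw rw_ev_reduced)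
qed

lemma auD_auD [simp]: "auD (auD x) = x"
  using letter_squares(3) by (metis comp_apply id_apply)

text \<open>Compare both sides as words. Without cancellation the word of \<open>v\<close> would
  start with \<open>l\<close> and then its inverse. Otherwise the word is
  \<open>l # u @ [inv_letter l]\<close>, and \<open>u\<close> satisfies the same equation with
  \<open>l\<close> inverted.\<close>

lemma reflection_shifted_fixed:
  assumes "fst l = Gen_A" "v + lt l = lt l + auD v"
  shows "v = 0"
  using assms
proof (induction "len v" arbitrary: v l rule: less_induct)
  case less
  show ?case
  proof (rule ccontr)
    assume v0: "v \<noteq> 0"
    define w where "w = rw v"
    have w: "w \<noteq> []" "reduced w" "v = ev w" using v0 by (auto simp: w_def) (metis ev_rw ev_simps(1))
    have eq: "ev (w @ [l]) = ev (l # map dlet w)"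
      using less.prems(2) w(3) by (simp add: auD_ev)
    have rd: "reduced (map dlet w)" using rw_auD[of v] reduced_rw[of "auD v"] by (simp add: w_def)
    show False
    proof (cases "l = inv_letter (last w)")
      case False
      then have r1: "reduced (w @ [l])" using w by (simp add: reduced_append reduced_Cons)
      have "reduced (l # map dlet w)"
      proof (rule ccontr)
        assume "\<not> reduced (l # map dlet w)"
        then have "len (ev ([l] @ map dlet w)) < length [l] + length (map dlet w)"
          using rd by (intro len_append_less) (simp_all add: reduced_Cons)
        then show False using eq len_ev_reduced[OF r1] by simp
      qed
      then have lists: "w @ [l] = l # map dlet w" using r1 eq ev_inject by blast
      then obtain w1 where w1: "w = l # w1" using w(1) by (cases w) auto
      then have "w1 @ [l] = inv_letter l # map dlet w1" using lists less.prems(1) by simp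
      then show False using w1 w(2) by (cases w1) (auto simp: reduced_Cons)
    next
      case True
      obtain w1 k where wk: "w = w1 @ [k]" using w(1) by (metis rev_exhaust)
      then have k: "k = inv_letter l" using True by simp
      have "len (ev (w @ [l])) < length w + 1"
        using len_append_less[of w "[l]"] w(2) True w(1) by (simp add: reduced_append reduced_Cons)
      then have "len (ev (l # map dlet w)) < length (l # map dlet w)" using eq by simp
      then have "\<not> reduced (l # map dlet w)" using len_ev_reduced by fastforce
      then have "hd (map dlet w) = inv_letter l" using rd by (simp add: reduced_Cons)
      then have "dlet (hd w) = dlet l" using w(1) less.prems(1) by (simp add: hd_map)
      then have hd: "hd w = l" by simp
      have "w1 \<noteq> []" using hd wk k by auto
      then obtain u where u: "w = l # u @ [inv_letter l]" using hd wk k by (cases w1) auto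
      define v' where "v' = ev u"
      have v: "v = lt l + v' + - lt l" using w(3) u by (simp add: v'_def add.assoc)
      have Dl: "auD (lt l) = - lt l" using less.prems(1) by (simp add: auD_lt)
      have "lt l + v' = auD v' + lt l"
        using less.prems(2) by (simp add: v ghom_simps Dl add.assoc)
      then have "auD (lt l + v') = auD (auD v' + lt l)" by simp
      then have "v' + lt (inv_letter l) = lt (inv_letter l) + auD v'" by (simp add: ghom_simps Dl)
      moreover have "len v' < len v" using len_ev_le[of u] len_ev_reduced[OF w(2)] w(3) u by (simp add: v'_def)
      moreover have "fst (inv_letter l) = Gen_A" using less.prems(1) by (simp add: inv_letter_def)
      ultimately have "v' = 0" using less.hyps by blast
      then show False using v v0 by simp
    qed
  qed
qed

text \<open>The condition on \<open>w\<close> pairs its outer letters, so w = m p D(m)^-1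
  multiplicatively, where D is \<open>auD\<close>, and conjugating by m reduces \<open>w\<close> to
  p. At the end \<open>w\<close> is empty, with fixed subgroup generated by \<open>gen_b\<close>, or
  a single letter, with trivial fixed subgroup.\<close>

lemma reflection_fixed_commute:
  assumes "auD w = - w" "cj w (auD x) = x" "cj w (auD y) = y"
  shows "comm x y"
  using assms
proof (induction "len w" arbitrary: w x y rule: less_induct)
  case less
  define u where "u = rw w"
  have u: "w = ev u" "reduced u" by (simp_all add: u_def)
  have lists: "map dlet u = inv_word u"
    using less.prems(1) by (metis rw_auD rw_minus u_def)
  consider "u = []" | l where "u = [l]" | m p k where "u = m # p @ [k]"
    by (metis append_butlast_last_id list.exhaust_sel)
  then show ?case
  proof cases
    case 1
    have "\<exists>k. z = ev (bz k)" if "auD z = z" for z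
    proof -
      obtain k gs where kg: "rw z = bz k @ flat gs" using normal_form[OF reduced_rw] .
      have "map dlet (rw z) = rw z" using that by (metis rw_auD)
      then have "\<forall>l \<in> set (rw z). dlet l = l" by (metis map_eq_conv map_ident)
      then have "gs = []" using kg by (cases gs rule: flat.cases) (auto simp: dlet_def)
      then have "z = ev (bz k)" using kg by (metis append_Nil2 ev_rw flat.simps(1))
      then show ?thesis by blast
    qed
    moreover have "auD x = x" "auD y = y" using less.prems 1 u(1) by simp_all
    ultimately show ?thesis using comm_bz by metis
  next
    case 2
    then have "dlet l = inv_letter l" using lists by simp
    then have l: "fst l = Gen_A" by (auto simp: dlet_def split: if_splits)
    have "v = 0" if "cj w (auD v) = v" for v
    proof (rule reflection_shifted_fixed[OF l])
      have w: "w = lt l" using 2 u by simp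
      have "v + w = cj w (auD v) + w" using that by simp
      then show "v + lt l = lt l + auD v" by (simp add: cj_def add.assoc w)
    qed
    from this[OF less.prems(2)] have "x = 0" .
    then show ?thesis by simp
  next
    case 3
    have dl: "dlet m = inv_letter k" "map dlet p = inv_word p"
      using lists unfolding 3 by simp_all
    have "lt k = - auD (lt m)" using dl(1) by (simp add: auD_lt)
    then have w: "w = lt m + ev p + - auD (lt m)" using u(1) 3 by (simp add: add.assoc)
    have "auD (ev p) = - ev p" using dl(2) by (simp add: auD_ev)
    moreover have "len (ev p) < len w" using len_ev_le[of p] len_ev_reduced[OF u(2)] u(1) 3 by simp
    moreover have "cj (ev p) (auD (cj (- lt m) z)) = cj (- lt m) z" if "cj w (auD z) = z" for z
    proof -
      have "cj (ev p) (auD (cj (- lt m) z)) = cj (ev p + - auD (lt m)) (auD z)"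
        by (simp add: ghom_cj_map ghom_simps)
      also have "\<dots> = cj (- lt m) (cj w (auD z))" by (simp add: w add.assoc)
      finally show ?thesis using that by simp
    qed
    ultimately have "comm (cj (- lt m) x) (cj (- lt m) y)" using less by blast
    then show ?thesis by simp
  qed
qed

text \<open>The square of \<open>f\<close> is conjugation by \<open>w + auD w\<close>. If this is
  nontrivial, its centralizer is abelian and contains all fixed elements; otherwise \<open>w\<close>
  has the symmetry needed above.\<close>

lemma elliptic_D: "elliptic auD"
  unfolding elliptic_def
proof (intro allI impI)
  fix f x y assume f: "f \<approx> auD" "f x = x" "f y = y"
  obtain w where w: "f = cj w \<circ> auD" using f(1) by (auto simp: oeq_def)
  have sq: "f (f z) = cj (w + auD w) z" for z by (simp add: w ghom_cj_map)
  then have c: "comm (w + auD w) x" "comm (w + auD w) y" 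
    unfolding cj_comm_iff[symmetric] using sq[of x] sq[of y] f by simp_all
  show "comm x y"
  proof (cases "w + auD w = 0")
    case True
    then have "auD w = - w" by (metis add.left_neutral add_minus_cancel'(2) add.right_neutral)
    then show ?thesis using reflection_fixed_commute f by (simp add: w)
  next
    case False
    then show ?thesis using comm_trans[OF comm_sym[OF c(1)] comm_sym[OF c(2)]] by blast
  qed
qed

lemma elliptic_jD: "elliptic (jpow j \<circ> auD)"
proof (cases j)
  case True
  have "auS \<circ> (auJ \<circ> auD) = auD \<circ> auS"
    by (rule ghom_eqI) (simp_all add: ghom_comp ghom_simps)
  then have "ocj (auJ \<circ> auD) auD" by (intro ocjI[of auS] oeq_eq) simp_all
  then have "elliptic (auJ \<circ> auD)" by (rule elliptic_ocj[OF _ elliptic_D])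
  then show ?thesis using True by (simp add: jpow_def)
qed (use elliptic_D in \<open>simp add: jpow_def\<close>)

section \<open>Automorphisms with nonabelian fixed subgroup\<close>

lemma pch_replicate_True: "pch (replicate n True) = Tw 0 (int n)"
proof (induction n)
  case 0
  show ?case by (simp add: fun_eq_iff Tw_0_0)
next
  case (Suc n)
  then show ?case by (simp add: fun_eq_iff sigma_Tw Tw_comp)
qed

text \<open>All normal forms are elliptic except \<open>jpow j \<circ> pch xs\<close> with at most
  one kind of twist and either no sign or a nonempty word. Of these, the signed ones are excluded
  separately, and the empty unsigned one gives the identity.\<close>

theorem nonabelian_fixed_twist:
  assumes f: "aut f" and xy: "f x = x" "f y = y" "\<not> comm x y"
  shows "f = id \<or> (\<exists>\<alpha> \<beta> m. aut \<alpha> \<and> \<alpha> \<circ> \<beta> = id \<and> \<beta> \<circ> \<alpha> = id \<and> m > 0 \<and> f = \<alpha> \<circ> Tw 0 m \<circ> \<beta>)"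
proof -
  obtain g0 where g0: "cnormal g0" "ocj f g0" using cnormal_ocj[OF f] by blast
  have not_elliptic: "\<not> elliptic g" if "ocj f g" for g
    using elliptic_ocj[OF that] xy oeq_refl unfolding elliptic_def by blast
  have pos: ?thesis if g: "ocj f (jpow j \<circ> pch xs)" "xs = replicate n True" for j xs n
  proof -
    obtain \<alpha> where \<alpha>: "aut \<alpha>" "\<alpha> \<circ> f \<approx> (jpow j \<circ> pch xs) \<circ> \<alpha>" using g(1) by (auto simp: ocj_def)
    obtain \<beta> where \<beta>: "aut \<beta>" "\<alpha> \<circ> \<beta> = id" "\<beta> \<circ> \<alpha> = id" using aut_inverse[OF \<alpha>(1)] by metis
    define F where "F = \<alpha> \<circ> f \<circ> \<beta>"
    have "F \<approx> (jpow j \<circ> pch xs) \<circ> \<alpha> \<circ> \<beta>" unfolding F_def by (rule oeq_right[OF \<alpha>(2)])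
    also have "\<dots> \<approx> jpow j \<circ> Tw 0 (int n)"
      by (intro oeq_eq) (simp add: comp_assoc \<beta>(2) g(2) pch_replicate_True)
    finally have F: "F \<approx> jpow j \<circ> Tw 0 (int n)" .
    have Ffix: "F (\<alpha> z) = \<alpha> z" if "f z = z" for z
      using that \<beta>(3) unfolding F_def by (metis comp_apply id_apply)
    have nc: "\<not> comm (\<alpha> x) (\<alpha> y)"
      using xy(3) \<alpha>(1) by (metis aut_ghom aut_inject comm_def ghom_add)
    have fF: "f = \<beta> \<circ> F \<circ> \<alpha>"
      using \<beta>(3) by (simp add: F_def fun_eq_iff)
    have transport: ?thesis if "m > 0" "F = cj h \<circ> Tw 0 m \<circ> cj (- h)" for h m
    proof -
      have "f = (\<beta> \<circ> cj h) \<circ> Tw 0 m \<circ> (cj (- h) \<circ> \<alpha>)" using fF that(2) by (simp add: comp_assoc)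
      moreover have "(\<beta> \<circ> cj h) \<circ> (cj (- h) \<circ> \<alpha>) = id" "(cj (- h) \<circ> \<alpha>) \<circ> (\<beta> \<circ> cj h) = id"
        using \<beta>(2,3) by (simp_all add: fun_eq_iff)
      ultimately show ?thesis using that(1) \<beta>(1) aut_comp[OF _ aut_cj] by blast
    qed
    consider "n = 0" "\<not> j" | "n = 0" "j" | "n > 0" "\<not> j" | "n > 0" "j" by blast
    then show ?thesis
    proof cases
      case 1
      then have "F \<approx> id" using F by (simp add: jpow_def Tw_0_0 fun_eq_iff oeq_def)
      then obtain w where "F = cj w" by (auto simp: oeq_def)
      then have c: "comm (\<alpha> x) w" "comm (\<alpha> y) w" using Ffix xy by (auto simp: cj_comm_iff comm_sym)
      then have "w = 0" using comm_trans nc by blast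
      then have "f = id" using fF \<open>F = cj w\<close> \<beta>(3) by (simp add: fun_eq_iff)
      then show ?thesis by blast
    next
      case 2
      then have "F \<approx> auJ" using F by (simp add: jpow_def Tw_0_0 fun_eq_iff oeq_def)
      then show ?thesis using elliptic_J Ffix xy nc unfolding elliptic_def by blast
    next
      case 3
      then have "F \<approx> Tw 0 (int n)" using F by (simp add: jpow_def)
      then show ?thesis using twist_nonabelian[of "int n" F "\<alpha> x" "\<alpha> y"] Ffix xy nc 3 transport[of "int n"] by auto
    next
      case 4
      \<comment> \<open>The square of a negative twist is a positive twist up to inner factors, so
        \<open>twist_nonabelian\<close> applies to it.\<close>
      have "F \<circ> F \<approx> (jpow j \<circ> Tw 0 (int n)) \<circ> (jpow j \<circ> Tw 0 (int n))"
        using F by (intro oeq_comp) (simp_all add: ghom_comp)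
      also have "\<dots> \<approx> Tw 0 (int (n + n))"
        using jpow_pch_square[of j "replicate n True"]
        by (simp only: pch_replicate_True replicate_add[symmetric])
      finally obtain h where h: "F \<circ> F = cj h \<circ> Tw 0 (int (n + n)) \<circ> cj (- h)"
        using twist_nonabelian[of "int (n + n)" "F \<circ> F" "\<alpha> x" "\<alpha> y"] Ffix xy nc 4 by auto
      \<comment> \<open>Undoing half of that square keeps the same fixed elements but leaves the
        class of \<open>auJ\<close>, which is elliptic.\<close>
      define G where "G = F \<circ> (cj h \<circ> Tw 0 (- int n) \<circ> cj (- h))"
      have "Tw 0 (- int n) (cj (- h) (\<alpha> z)) = cj (- h) (\<alpha> z)" if "f z = z" for z
      proof (rule Tw_fixed_scale)
        have "F (F (\<alpha> z)) = \<alpha> z" using Ffix that by simp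
        then have "cj h (Tw 0 (int (n + n)) (cj (- h) (\<alpha> z))) = \<alpha> z" using h by (metis comp_apply)
        then show "Tw 0 (int (n + n)) (cj (- h) (\<alpha> z)) = cj (- h) (\<alpha> z)" by (simp add: cj_eq_iff)
        show "int (n + n) \<noteq> 0" using 4 by simp
      qed
      then have Gfix: "G (\<alpha> z) = \<alpha> z" if "f z = z" for z using that Ffix by (simp add: G_def)
      have "cj h \<circ> Tw 0 (- int n) \<circ> cj (- h) = cj (h + Tw 0 (- int n) (- h)) \<circ> Tw 0 (- int n)"
        by (simp add: fun_eq_iff ghom_cj_map)
      then have "cj h \<circ> Tw 0 (- int n) \<circ> cj (- h) \<approx> Tw 0 (- int n)" by (rule oeqI)
      then have "G \<approx> (jpow j \<circ> Tw 0 (int n)) \<circ> Tw 0 (- int n)"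
        unfolding G_def using F by (intro oeq_comp) (simp_all add: ghom_comp)
      also have "\<dots> \<approx> auJ" by (intro oeq_eq) (simp add: fun_eq_iff Tw_comp Tw_0_0 jpow_def 4)
      finally show ?thesis using elliptic_J Gfix xy nc unfolding elliptic_def by blast
    qed
  qed
  have single: "xs = replicate (length xs) b" if "(\<not> b) \<notin> set xs" for xs b
    using that by (induction xs) auto
  consider j xs where "g0 = jpow j \<circ> pch xs" | j xs where "g0 = jpow j \<circ> auS \<circ> pch xs"
    | j where "g0 = jpow j \<circ> auD \<or> g0 = jpow j \<circ> auR \<or> (\<exists>x. g0 = jpow j \<circ> auR \<circ> tw x)"
    using g0(1) unfolding cnormal_def by blast
  then show ?thesis
  proof cases
    case 1
    show ?thesis
    proof (cases "True \<in> set xs \<and> False \<in> set xs")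
      case True
      then have "elliptic g0" unfolding elliptic_def 1 using positive_mixed_fixed_commute by blast
      then show ?thesis using not_elliptic g0(2) by blast
    next
      case False
      then consider "xs = replicate (length xs) True" | "xs = replicate (length xs) False"
        using single[of True xs] single[of False xs] by auto
      then show ?thesis
      proof cases
        case a: 1
        then show ?thesis using pos[of j xs "length xs"] g0(2) 1 by blast
      next
        case 2
        \<comment> \<open>A power of \<open>tau\<close> becomes a power of \<open>sigma\<close>
          under the swap.\<close>
        have "auS \<circ> (jpow j \<circ> pch xs) \<approx> jpow j \<circ> (auS \<circ> pch xs)"
          by (intro oeq_eq) (simp add: jpow_auS flip: comp_assoc)
        also have "\<dots> \<approx> jpow j \<circ> (pch (map Not xs) \<circ> auS)"
          using oeq_sym[OF pch_auS[of "map Not xs"]] by (intro oeq_left) (simp_all add: comp_def)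
        finally have "auS \<circ> (jpow j \<circ> pch xs) \<approx> (jpow j \<circ> pch (map Not xs)) \<circ> auS"
          by (simp only: comp_assoc)
        then have "ocj g0 (jpow j \<circ> pch (map Not xs))" unfolding 1 by (intro ocjI[of auS]) simp_all
        then have "ocj f (jpow j \<circ> pch (map Not xs))" using g0(2) ocj_trans by blast
        moreover have "map Not xs = replicate (length xs) True" using arg_cong[OF 2, of "map Not"] by simp
        ultimately show ?thesis using pos by blast
      qed
    qed
  next
    case 2
    have "elliptic g0"
    proof (cases "xs = []")
      case True
      then show ?thesis using 2 elliptic_S elliptic_JS by (simp add: jpow_def)
    next
      case False
      then show ?thesis unfolding elliptic_def 2 using positive_swap_fixed comm_0 by metis
    qed
    then show ?thesis using not_elliptic g0(2) by blast
  next
    case 3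
    then have "elliptic g0" using elliptic_jD elliptic_R elliptic_R_tw by auto
    then show ?thesis using not_elliptic g0(2) by blast
  qed
qed

section \<open>Simultaneous conjugators of noncommuting pairs are short\<close>

lemma conj_letter_grow:
  assumes "x \<noteq> 0" "reduced (inv_letter l # rw x @ [l])"
  shows "rw (cj (- lt l) x) = inv_letter l # rw x @ [l]"
proof -
  have "cj (- lt l) x = ev (inv_letter l # rw x @ [l])" by (simp add: cj_def add.assoc)
  then show ?thesis using assms(2) by (simp only: rw_ev_reduced)
qed

lemma conj_letter_le:
  assumes "x = 0 \<or> \<not> reduced (inv_letter l # rw x @ [l])"
  shows "len (cj (- lt l) x) \<le> len x"
proof (cases "x = 0")
  case False
  let ?w = "rw x"
  have w: "?w \<noteq> []" using False by (metis ev_rw ev_simps(1))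
  have c: "cj (- lt l) x = ev (inv_letter l # ?w @ [l])" by (simp add: cj_def add.assoc)
  have "hd ?w = l \<or> last ?w = inv_letter l"
    using assms False w by (auto simp: reduced_Cons reduced_append)
  then show ?thesis
  proof
    assume "hd ?w = l"
    then obtain t where t: "?w = l # t" using w by (cases ?w) auto
    then have "cj (- lt l) x = ev (t @ [l])" unfolding c by (simp add: add.assoc)
    then show ?thesis using len_ev_le[of "t @ [l]"] t by (simp add: len_def)
  next
    assume "last ?w = inv_letter l"
    then obtain t where t: "?w = t @ [inv_letter l]" using w by (metis append_butlast_last_id)
    then have "cj (- lt l) x = ev (inv_letter l # t)" unfolding c by (simp add: add.assoc)
    then show ?thesis using len_ev_le[of "inv_letter l # t"] t by (simp add: len_def)
  qed
qed simp

text \<open>Once conjugation by a letter is reduced as written, each further letter of the reduced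
  conjugator adds two letters.\<close>

lemma conj_word_grow:
  assumes "reduced (l # u)" "x \<noteq> 0" "reduced (inv_letter l # rw x @ [l])"
  shows "len (cj (- ev (l # u)) x) = len x + 2 * length (l # u)"
  using assms
proof (induction u arbitrary: l x)
  case Nil
  have "len (cj (- lt l) x) = length (inv_letter l # rw x @ [l])"
    using conj_letter_grow[OF Nil(2,3)] by (simp only: len_def)
  then show ?case by (simp add: len_def)
next
  case (Cons m u)
  define x' where "x' = cj (- lt l) x"
  have rw': "rw x' = inv_letter l # rw x @ [l]" unfolding x'_def by (rule conj_letter_grow[OF Cons.prems(2,3)])
  have m: "m \<noteq> inv_letter l" "reduced (m # u)" using Cons.prems(1) by (auto simp: reduced_Cons)
  have "reduced (inv_letter m # rw x' @ [m])"
  proof -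
    have "reduced ((inv_letter l # rw x @ [l]) @ [m])"
      using Cons.prems(3) m(1) reduced_append[of "inv_letter l # rw x @ [l]" "[m]"]
      by (simp add: reduced_Cons)
    then show ?thesis unfolding rw' using m(1)
      by (simp add: reduced_Cons[of "inv_letter m"])
  qed
  moreover have "x' \<noteq> 0" using Cons.prems(2) by (simp add: x'_def)
  ultimately have "len (cj (- ev (m # u)) x') = len x' + 2 * length (m # u)"
    using Cons.IH m(2) by blast
  moreover have "len x' = len x + 2" by (simp add: len_def rw')
  moreover have "cj (- ev (l # m # u)) x = cj (- ev (m # u)) x'"
    by (simp add: x'_def minus_add add.assoc)
  ultimately show ?case by simp
qed

text \<open>As long as growth has not begun the conjugate stays within \<open>h\<close>; once it has
  begun, every remaining letter adds two.\<close>

lemma conj_prefix: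
  assumes "reduced u" "len x \<le> h" "n \<le> length u"
  shows "len (cj (- ev (take n u)) x) \<le> h \<or> 2 * (length u - n) \<le> len (cj (- ev u) x)"
  using assms
proof (induction u arbitrary: x n)
  case (Cons l u)
  show ?case
  proof (cases n)
    case (Suc n')
    show ?thesis
    proof (cases "x \<noteq> 0 \<and> reduced (inv_letter l # rw x @ [l])")
      case True
      then have "len (cj (- ev (l # u)) x) = len x + 2 * length (l # u)"
        using conj_word_grow[OF Cons.prems(1)] by blast
      then have "2 * (length (l # u) - n) \<le> len (cj (- ev (l # u)) x)" by linarith
      then show ?thesis by blast
    next
      case False
      define x' where "x' = cj (- lt l) x"
      have "len x' \<le> h" using conj_letter_le[of x l] False Cons.prems(2) by (auto simp: x'_def)
      moreover have "reduced u" using Cons.prems(1) by (simp add: reduced_Cons)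
      ultimately have "len (cj (- ev (take n' u)) x') \<le> h \<or> 2 * (length u - n') \<le> len (cj (- ev u) x')"
        using Cons.IH Cons.prems(3) Suc by simp
      then show ?thesis by (simp add: Suc x'_def minus_add)
    qed
  qed (use Cons.prems in simp)
qed simp

definition lball :: "nat \<Rightarrow> free2 set" where
  "lball h = {x. len x \<le> h}"

lemma letters_UNIV: "(UNIV :: letter set) = {(Gen_A, False), (Gen_A, True), (Gen_B, False), (Gen_B, True)}"
  by (auto intro: gen.exhaust)

text \<open>All words over the four letters are counted, reduced or not; the geometric sum is at
  most twice its last term.\<close>

lemma lball_finite_card: "finite (lball h)" "card (lball h) \<le> 2 * 4 ^ h"
proof -
  let ?L = "{u :: letter list. set u \<subseteq> UNIV \<and> length u \<le> h}"
  have fin: "finite (UNIV :: letter set)" and c: "card (UNIV :: letter set) = 4"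
    unfolding letters_UNIV by simp_all
  have sub: "lball h \<subseteq> ev ` ?L"
  proof
    fix x assume "x \<in> lball h"
    then have "rw x \<in> ?L" by (simp add: lball_def len_def)
    then show "x \<in> ev ` ?L" by (rule image_eqI[rotated]) simp
  qed
  have finL: "finite ?L" using finite_lists_length_le[OF fin] .
  then show "finite (lball h)" using sub finite_subset by blast
  have "card (lball h) \<le> card (ev ` ?L)" using sub finL by (simp add: card_mono)
  also have "\<dots> \<le> card ?L" using finL by (rule card_image_le)
  also have "\<dots> = (\<Sum>i\<le>h. 4 ^ i)" using card_lists_length_le[OF fin] c by simp
  also have "\<dots> \<le> 2 * 4 ^ h" by (induction h) simp_all
  finally show "card (lball h) \<le> 2 * 4 ^ h" .
qed

theorem conjugator_bound:
  assumes nc: "\<not> comm y1 y2" and y: "len y1 \<le> h" "len y2 \<le> h"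
    and L: "len (cj (- w) y1) \<le> L" "len (cj (- w) y2) \<le> L"
  shows "2 * len w \<le> L + 2 * (2 * 4 ^ h)\<^sup>2"
proof (rule ccontr)
  define K where "K = (2 * 4 ^ h :: nat)\<^sup>2"
  assume "\<not> ?thesis"
  then have big: "L + 2 * K < 2 * len w" by (simp add: K_def)
  define W where "W = rw w"
  define p where "p n = ev (take n W)" for n
  have W: "reduced W" "w = ev W" "length W = len w" by (simp_all add: W_def len_def)
  define F where "F n = (cj (- p n) y1, cj (- p n) y2)" for n
  have F: "F n \<in> lball h \<times> lball h" if "n \<le> K" for n
  proof -
    \<comment> \<open>For the first \<open>K + 1\<close> prefixes so much of \<open>w\<close>
      remains that growth cannot have begun, so the conjugated pair lies in the ball.
      \<open>K\<close> bounds the number of such pairs, whence the collision below.\<close>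
    have n: "n \<le> length W" "L < 2 * (length W - n)" using that big W(3) by simp_all
    show ?thesis
      using conj_prefix[OF W(1) y(1) n(1)] conj_prefix[OF W(1) y(2) n(1)] L n(2)
      by (auto simp: F_def p_def lball_def W(2))
  qed
  have "F ` {..K} \<subseteq> lball h \<times> lball h" by (intro image_subsetI F) simp
  then have "card (F ` {..K}) \<le> card (lball h \<times> lball h)"
    using lball_finite_card(1) by (intro card_mono) auto
  also have "\<dots> \<le> K"
    unfolding K_def card_cartesian_product power2_eq_square using lball_finite_card(2) by (intro mult_mono) auto
  finally have "card (F ` {..K}) < card {..K}" by simp
  then have "\<not> inj_on F {..K}" by (rule pigeonhole)
  then obtain n m where nm: "n \<le> K" "m \<le> K" "n \<noteq> m" "F n = F m" by (auto simp: inj_on_def)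
  define d where "d = p m + - p n"
  have "cj d y = y" if "cj (- p n) y = cj (- p m) y" for y
    using that unfolding d_def cj_simps(3)[symmetric] by simp
  then have c: "comm y1 d" "comm y2 d" using nm(4) by (auto simp: F_def cj_comm_iff comm_sym)
  have "d \<noteq> 0"
  proof
    assume "d = 0"
    then have "p m = p n" by (simp add: d_def flip: eq_neg_iff_add_eq_0)
    moreover have "reduced (take k W)" for k
      using W(1) by (metis append_take_drop_id reduced_append)
    ultimately have "take m W = take n W" unfolding p_def using ev_inject by blast
    then have "min (length W) m = min (length W) n" by (metis length_take)
    then show False using nm big W(3) by simp
  qed
  then show False using comm_trans[OF c] nc by blast
qed

section \<open>Representing a twist in bounded form\<close>

primrec wch :: "(bool \<Rightarrow> free2 \<Rightarrow> free2) \<Rightarrow> bool list \<Rightarrow> free2 \<Rightarrow> free2" where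
  "wch g [] = id"
| "wch g (x # xs) = g x \<circ> wch g xs"

lemma wch_append: "wch g (xs @ ys) = wch g xs \<circ> wch g ys"
  by (induction xs) (simp_all add: comp_assoc)

lemma pch_wch: "pch xs = wch tw xs"
  by (induction xs) simp_all

lemma wch_props [simp]: "ghom (wch tw xs)" "ghom (wch twi xs)"
  by (induction xs) (simp_all add: ghom_comp)

lemma wch_chain: "\<exists>es. chain (g True) (g False) es = wch g zs \<and> chain_length es = length zs"
proof (induction zs rule: rev_induct)
  case Nil
  then show ?case by (intro exI[of _ "[]"]) (simp add: chain_length_def)
next
  case (snoc x zs)
  then obtain es where es: "chain (g True) (g False) es = wch g zs" "chain_length es = length zs" by blast
  show ?case
    \<comment> \<open>In \<open>chain\<close> the head of the list is applied first, so the
      innermost twist is prepended, as a pair with one exponent 1.\<close>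
    using es by (intro exI[of _ "(if x then (1, 0) else (0, 1)) # es"])
      (cases x; simp add: wch_append chain_length_def fun_eq_iff)
qed

lemma inv_twists: "inv_into UNIV sigma = sigma_inv" "inv_into UNIV tau = tau_inv"
  by (rule inv_unique_comp; simp)+

lemma wch_chains: "length zs \<le> n \<Longrightarrow> wch tw zs \<in> chains_C1 n" "length zs \<le> n \<Longrightarrow> wch twi zs \<in> chains_C2 n"
  using wch_chain[of tw zs] wch_chain[of twi zs]
  by (auto simp: chains_C1_def chains_C2_def inv_twists) (metis order_refl)+

lemma len_ghom_le:
  assumes "ghom f" "\<And>l. len (f (lt l)) \<le> c"
  shows "len (f x) \<le> c * len x"
proof -
  have "len (f (ev u)) \<le> c * length u" for u
  proof (induction u)
    case (Cons l u)
    then show ?case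
      using assms(2)[of l] len_add_le[of "f (lt l)" "f (ev u)"] by (simp add: ghom_add[OF assms(1)])
  qed (simp add: ghom_0[OF assms(1)])
  from this[of "rw x"] show ?thesis by (simp add: len_def)
qed

lemma len_tw: "len (tw x y) \<le> 2 * len y" "len (twi x y) \<le> 2 * len y"
proof -
  have g: "len gen_a = 1" "len gen_b = 1" by (simp_all add: gen_lt)
  have 2: "len (u + v) \<le> 2" if "len u = 1" "len v = 1" for u v
    using len_add_le[of u v] that by simp
  have "len (tw x (lt l)) \<le> 2" for l
    by (cases l; cases "fst l"; cases "snd l"; cases x)
      (auto simp: lt_gen ghom_simps g 2 minus_add simp del: lt_True)
  then show "len (tw x y) \<le> 2 * len y" by (intro len_ghom_le) simp_all
  have "len (twi x (lt l)) \<le> 2" for l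
    by (cases l; cases "fst l"; cases "snd l"; cases x)
      (auto simp: lt_gen ghom_simps g 2 minus_add simp del: lt_True)
  then show "len (twi x y) \<le> 2 * len y" by (intro len_ghom_le) simp_all
qed

lemma len_wch: "len (wch tw zs y) \<le> 2 ^ length zs * len y" "len (wch twi zs y) \<le> 2 ^ length zs * len y"
proof -
  have "len (wch g zs y) \<le> 2 ^ length zs * len y" if g: "\<And>x y. len (g x y) \<le> 2 * len y" for g
  proof (induction zs)
    case (Cons x zs)
    then show ?case using g[of x "wch g zs y"] by (simp add: mult.assoc)
  qed simp
  then show "len (wch tw zs y) \<le> 2 ^ length zs * len y" "len (wch twi zs y) \<le> 2 ^ length zs * len y"
    using len_tw by blast+
qed

lemma letter_auto_inverse:
  assumes "letter_auto c"
  obtains d where "letter_auto d" "c \<circ> d = id" "d \<circ> c = id"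
proof -
  have s: "auJ \<circ> auS \<circ> (auJ \<circ> auS) = id" "auJ \<circ> auD \<circ> (auJ \<circ> auD) = id"
    by (rule ghom_eqI; simp add: ghom_comp ghom_simps)+
  have "\<exists>d. letter_auto d \<and> c \<circ> d = id \<and> d \<circ> c = id"
    using letter_auto_cases[OF assms]
  proof (simp only: insert_iff empty_iff, elim disjE FalseE)
    assume "c = id" then show ?thesis using letter_auto_letters by auto
  next
    assume "c = auJ" then show ?thesis using letter_auto_letters letter_squares by blast
  next
    assume "c = auS" then show ?thesis using letter_auto_letters letter_squares by blast
  next
    assume "c = auJ \<circ> auS" then show ?thesis using s letter_auto_comp letter_auto_letters by blast
  next
    assume "c = auD" then show ?thesis using letter_auto_letters letter_squares by blast
  next
    assume "c = auJ \<circ> auD" then show ?thesis using s letter_auto_comp letter_auto_letters by blast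
  next
    assume "c = auR" then show ?thesis using auR_fourth letter_auto_comp letter_auto_letters by blast
  next
    assume "c = auJ \<circ> auR" then show ?thesis using auR_fourth letter_auto_letters by blast
  qed
  then show ?thesis using that by blast
qed

lemma letter_auto_len_le:
  assumes "letter_auto c"
  shows "len (c x) \<le> len x"
proof -
  have "len (c (lt l)) \<le> 1" for l
  proof -
    obtain m where "c (lt l) = lt m" using assms unfolding letter_auto_def by blast
    then show ?thesis by simp
  qed
  moreover have "ghom c" using assms by (simp add: letter_auto_def aut_ghom)
  ultimately show ?thesis using len_ghom_le[of c 1 x] by simp
qed

lemma letter_auto_whitehead:
  assumes "letter_auto c"
  shows "c \<in> whitehead_W1"
proof -
  let ?S = "{gen_a, gen_b, - gen_a, - gen_b}"
  have S: "?S = range lt"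
    unfolding letters_UNIV by (auto simp: lt_gen simp del: lt_True)
  have "c (lt l) \<in> range lt" for l using assms unfolding letter_auto_def by blast
  then have c: "aut c" "c ` range lt \<subseteq> range lt" using assms unfolding letter_auto_def by blast+
  have inj: "inj_on c A" for A using c(1) by (simp add: aut_def bij_def inj_on_def)
  have "finite (range lt)" unfolding S[symmetric] by simp
  then have "c ` range lt = range lt" using endo_inj_surj[OF _ c(2) inj] by blast
  then show ?thesis
    unfolding whitehead_W1_def using c(1) inj aut_iff by (simp add: S bij_betw_def)
qed

text \<open>The four maps \<open>delta1\<close> to \<open>delta4\<close> are exactly the
  conjugations by letters.\<close>

lemma cj_delta_composition: "cj (ev u) \<in> delta_compositions (length u)"
proof -
  define ds where "ds = map (\<lambda>l. cj (lt l)) u"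
  have d: "delta1 = cj (- gen_b)" "delta2 = cj gen_b" "delta3 = cj (- gen_a)" "delta4 = cj gen_a"
    unfolding delta1_def delta2_def delta3_def delta4_def
    by (rule ghom_eqI; simp add: cj_def grp)+
  have "cj (lt l) \<in> {delta1, delta2, delta3, delta4}" for l
    unfolding d by (cases l; cases "fst l"; cases "snd l") (auto simp: lt_gen simp del: lt_True)
  then have "set ds \<subseteq> {delta1, delta2, delta3, delta4}" by (auto simp: ds_def)
  moreover have "foldr (\<circ>) ds id = cj (ev u)"
    unfolding ds_def by (induction u) (simp_all add: fun_eq_iff)
  moreover have "length ds = length u" by (simp add: ds_def)
  ultimately show ?thesis unfolding delta_compositions_def by (metis (mono_tags, lifting) mem_Collect_eq order_refl)
qed

lemma delta_compositions_mono: "m \<le> n \<Longrightarrow> delta_compositions m \<subseteq> delta_compositions n"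
  unfolding delta_compositions_def using order_trans by blast

lemma cj_delta: "len w \<le> n \<Longrightarrow> cj w \<in> delta_compositions n"
  using cj_delta_composition[of "rw w"] delta_compositions_mono[of "len w" n] by (auto simp: len_def)

section \<open>Moving letter maps through chains of one sign\<close>

definition tws :: "bool \<Rightarrow> bool \<Rightarrow> free2 \<Rightarrow> free2" where
  "tws s = (if s then tw else twi)"

lemma tws_props [simp]: "ghom (tws s x)" "tws s x \<circ> tws (\<not> s) x = id"
  by (simp_all add: tws_def)

lemma oeq_invert:
  assumes "tws s x \<circ> b \<approx> b \<circ> tws t y"
  shows "tws (\<not> s) x \<circ> b \<approx> b \<circ> tws (\<not> t) y"
proof -
  have "tws (\<not> s) x \<circ> b \<approx> tws (\<not> s) x \<circ> ((b \<circ> tws t y) \<circ> tws (\<not> t) y)"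
    using tws_props(2)[of t y] by (intro oeq_eq) (simp add: comp_assoc)
  also have "\<dots> \<approx> tws (\<not> s) x \<circ> ((tws s x \<circ> b) \<circ> tws (\<not> t) y)"
    by (intro oeq_left oeq_right oeq_sym[OF assms]) simp
  also have "\<dots> \<approx> (tws (\<not> s) x \<circ> tws s x) \<circ> (b \<circ> tws (\<not> t) y)" by (intro oeq_eq) (simp add: comp_assoc)
  also have "\<dots> \<approx> b \<circ> tws (\<not> t) y" using tws_props(2)[of "\<not> s" x] by simp
  finally show ?thesis .
qed

text \<open>The flips \<open>e\<close> of the sign and \<open>n\<close> of the kind of twist depend
  on \<open>b\<close> alone, so a word of one sign stays a word of one sign when \<open>b\<close>
  moves through it.\<close>

lemma tws_letter:
  assumes "letter_auto b"
  shows "\<exists>e n. \<forall>s x. tws s x \<circ> b \<approx> b \<circ> tws (s \<noteq> e) (x \<noteq> n)"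
proof -
  have tw: "tws True x = tw x" "tws False x = twi x" for x by (simp_all add: tws_def)
  have both: "\<exists>e n. \<forall>s x. tws s x \<circ> b \<approx> b \<circ> tws (s \<noteq> e) (x \<noteq> n)"
    if "\<And>x. tws True x \<circ> b \<approx> b \<circ> tws (True \<noteq> e) (x \<noteq> n)" for b e n
  proof (intro exI allI)
    fix s x
    show "tws s x \<circ> b \<approx> b \<circ> tws (s \<noteq> e) (x \<noteq> n)"
      using that[of x] oeq_invert[OF that[of x]] by (cases s; cases e) auto
  qed
  have base: "\<exists>e n. \<forall>s x. tws s x \<circ> b \<approx> b \<circ> tws (s \<noteq> e) (x \<noteq> n)" if "b \<in> {id, auS, auD, auR}" for b
  proof -
    have "\<exists>e n. \<forall>s x. tws s x \<circ> id \<approx> id \<circ> tws (s \<noteq> e) (x \<noteq> n)"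
      by (rule both[of _ False False]) simp
    moreover have "\<exists>e n. \<forall>s x. tws s x \<circ> auS \<approx> auS \<circ> tws (s \<noteq> e) (x \<noteq> n)"
      by (rule both[of _ False True]) (simp add: tw tw_auS)
    moreover have "\<exists>e n. \<forall>s x. tws s x \<circ> auD \<approx> auD \<circ> tws (s \<noteq> e) (x \<noteq> n)"
      by (rule both[of _ True False]) (simp add: tw tw_auD)
    moreover have "\<exists>e n. \<forall>s x. tws s x \<circ> auR \<approx> auR \<circ> tws (s \<noteq> e) (x \<noteq> n)"
      by (rule both[of _ True True]) (simp add: tw tw_auR)
    ultimately show ?thesis using that by blast
  qed
  have J: "\<exists>e n. \<forall>s x. tws s x \<circ> (auJ \<circ> b) \<approx> (auJ \<circ> b) \<circ> tws (s \<noteq> e) (x \<noteq> n)"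
    if b: "\<exists>e n. \<forall>s x. tws s x \<circ> b \<approx> b \<circ> tws (s \<noteq> e) (x \<noteq> n)" for b
  proof -
    obtain e n where en: "tws s x \<circ> b \<approx> b \<circ> tws (s \<noteq> e) (x \<noteq> n)" for s x using b by blast
    have "tws True x \<circ> auJ \<approx> auJ \<circ> tws True x" for x using oeq_sym[OF tw_auJ] by (simp add: tw)
    then have j: "tws s x \<circ> auJ \<approx> auJ \<circ> tws s x" for s x
      using oeq_invert[of True x auJ True x] by (cases s) auto
    have "tws s x \<circ> (auJ \<circ> b) \<approx> (auJ \<circ> b) \<circ> tws (s \<noteq> e) (x \<noteq> n)" for s x
    proof -
      have "(tws s x \<circ> auJ) \<circ> b \<approx> (auJ \<circ> tws s x) \<circ> b" by (rule oeq_right[OF j])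
      also have "\<dots> \<approx> auJ \<circ> (tws s x \<circ> b)" by (intro oeq_eq) (simp add: comp_assoc)
      also have "\<dots> \<approx> auJ \<circ> (b \<circ> tws (s \<noteq> e) (x \<noteq> n))" by (rule oeq_left[OF en]) simp
      finally show ?thesis by (simp only: comp_assoc)
    qed
    then show ?thesis by blast
  qed
  show ?thesis
    using letter_auto_cases[OF assms] base J[OF base] J[OF base[of id]] by auto
qed

lemma wch_props_tws [simp]: "ghom (wch (tws s) xs)"
  by (cases s) (simp_all add: tws_def)

lemma wch_letter:
  assumes "letter_auto b"
  shows "\<exists>t ys. length ys = length xs \<and> wch (tws s) xs \<circ> b \<approx> b \<circ> wch (tws t) ys"
proof -
  obtain e n where en: "tws s x \<circ> b \<approx> b \<circ> tws (s \<noteq> e) (x \<noteq> n)" for s x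
    using tws_letter[OF assms] by blast
  have "wch (tws s) xs \<circ> b \<approx> b \<circ> wch (tws (s \<noteq> e)) (map (\<lambda>x. x \<noteq> n) xs)"
  proof (induction xs)
    case (Cons x xs)
    have "tws s x \<circ> (wch (tws s) xs \<circ> b) \<approx> tws s x \<circ> (b \<circ> wch (tws (s \<noteq> e)) (map (\<lambda>x. x \<noteq> n) xs))"
      by (rule oeq_left[OF Cons]) simp
    also have "\<dots> \<approx> (tws s x \<circ> b) \<circ> wch (tws (s \<noteq> e)) (map (\<lambda>x. x \<noteq> n) xs)"
      by (intro oeq_eq) (simp add: comp_assoc)
    also have "\<dots> \<approx> (b \<circ> tws (s \<noteq> e) (x \<noteq> n)) \<circ> wch (tws (s \<noteq> e)) (map (\<lambda>x. x \<noteq> n) xs)"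
      by (rule oeq_right[OF en])
    finally show ?case by (simp only: wch.simps list.map comp_assoc)
  qed simp
  then show ?thesis by (metis length_map)
qed

lemma wch_inverse: "wch (tws s) ys \<circ> wch (tws (\<not> s)) (rev ys) = id"
proof (induction ys)
  case (Cons y ys)
  have "wch (tws s) (y # ys) \<circ> wch (tws (\<not> s)) (rev (y # ys))
      = tws s y \<circ> (wch (tws s) ys \<circ> wch (tws (\<not> s)) (rev ys)) \<circ> tws (\<not> s) y"
    by (simp only: wch_append wch.simps rev.simps comp_assoc comp_id)
  then show ?case unfolding Cons by (simp only: comp_id tws_props(2))
qed simp

text \<open>
  The conjugate of a twist by a positive word is turned into a rotation followed by a negative word
  by moving the rotation \<open>R\<close> through the word: it exchanges positive and negative twists.
\<close>

lemma twist_conjugate_form: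
  "\<exists>c t zs. letter_auto c \<and> length zs \<le> max 1 (2 * length ys) \<and>
    pch ys \<circ> sigma \<circ> wch twi (rev ys) \<approx> c \<circ> wch (tws t) zs"
  if "ys = [] \<or> last ys = False"
proof (cases ys rule: rev_cases)
  case Nil
  have "pch ys \<circ> sigma \<circ> wch twi (rev ys) \<approx> id \<circ> wch (tws True) [True]"
    by (simp add: Nil tws_def)
  then show ?thesis using letter_auto_letters(1) by (metis Nil list.size(3,4) max.cobounded1 One_nat_def add_0)
next
  case (snoc zs y)
  then have y: "y = False" using that by simp
  have R: "wch (tws True) xs \<circ> auR \<approx> auR \<circ> wch (tws False) (map Not xs)" for xs
  proof (induction xs)
    case (Cons x xs)
    have "tws True x \<circ> (wch (tws True) xs \<circ> auR) \<approx> tws True x \<circ> (auR \<circ> wch (tws False) (map Not xs))"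
      by (rule oeq_left[OF Cons]) simp
    also have "\<dots> \<approx> (tw x \<circ> auR) \<circ> wch (tws False) (map Not xs)"
      by (intro oeq_eq) (simp add: comp_assoc tws_def)
    also have "\<dots> \<approx> (auR \<circ> twi (\<not> x)) \<circ> wch (tws False) (map Not xs)"
      by (rule oeq_right[OF tw_auR])
    also have "\<dots> \<approx> (auR \<circ> tws False (\<not> x)) \<circ> wch (tws False) (map Not xs)"
      by (intro oeq_eq) (simp add: tws_def)
    finally show ?case by (simp only: wch.simps list.map comp_assoc)
  qed simp
  \<comment> \<open>This is where the last letter \<open>tau\<close> of \<open>ys\<close> is used:
    its inverse stands next to \<open>sigma\<close> and merges with it and the rotation into one
    negative twist.\<close>
  have base: "(auJ \<circ> auR) \<circ> sigma \<circ> tau_inv \<approx> sigma_inv"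
    by (rule oeq_endoI[where w = "- gen_b"]) (simp_all add: ghom_comp ghom_simps cj_def grp)
  have p: "pch ys = wch (tws True) ys" by (simp add: pch_wch tws_def)
  have n: "wch twi (rev ys) = tau_inv \<circ> wch twi (rev zs)" by (simp add: snoc y)
  have "pch ys \<circ> sigma \<circ> wch twi (rev ys)
      \<approx> (wch (tws True) ys \<circ> auR) \<circ> ((auJ \<circ> auR) \<circ> sigma \<circ> tau_inv \<circ> wch twi (rev zs))"
    unfolding p n using auR_fourth(1) by (intro oeq_eq) (simp add: fun_eq_iff)
  also have "\<dots> \<approx> (auR \<circ> wch (tws False) (map Not ys)) \<circ> ((auJ \<circ> auR) \<circ> sigma \<circ> tau_inv \<circ> wch twi (rev zs))"
    by (rule oeq_right[OF R])
  also have "\<dots> \<approx> (auR \<circ> wch (tws False) (map Not ys)) \<circ> (sigma_inv \<circ> wch twi (rev zs))"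
    by (intro oeq_left oeq_right base) (simp add: ghom_comp)
  also have "\<dots> \<approx> auR \<circ> wch (tws False) (map Not ys @ True # rev zs)"
    by (intro oeq_eq) (simp add: wch_append tws_def comp_assoc)
  finally have "pch ys \<circ> sigma \<circ> wch twi (rev ys) \<approx> auR \<circ> wch (tws False) (map Not ys @ True # rev zs)" .
  moreover have "length (map Not ys @ True # rev zs) \<le> max 1 (2 * length ys)" by (simp add: snoc)
  ultimately show ?thesis using letter_auto_letters(5) by blast
qed

lemma pch_replicate_sigma:
  "sigma \<circ> pch (replicate n True) = pch (replicate n True) \<circ> sigma"
  "pch (replicate n True) gen_b = gen_b"
proof -
  have "pch (True # replicate n True) = pch (replicate n True @ [True])"
    by (simp only: replicate_append_same)
  then show "sigma \<circ> pch (replicate n True) = pch (replicate n True) \<circ> sigma"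
    by (simp only: pch_append pch.simps tw.simps comp_id)
  show "pch (replicate n True) gen_b = gen_b" by (induction n) simp_all
qed

lemma trailing_replicate: "\<exists>ys n. xs = ys @ replicate n True \<and> (ys = [] \<or> last ys = False)"
proof (induction xs rule: rev_induct)
  case Nil
  then show ?case by simp
next
  case (snoc x xs)
  then obtain ys n where ys: "xs = ys @ replicate n True" "ys = [] \<or> last ys = False" by blast
  show ?case
  proof (cases x)
    case True
    then have "xs @ [x] = ys @ replicate (Suc n) True" using ys(1) by (simp add: replicate_append_same)
    then show ?thesis using ys(2) by blast
  next
    case False
    then have "xs @ [x] = (xs @ [x]) @ replicate 0 True \<and> (xs @ [x] = [] \<or> last (xs @ [x]) = False)" by simp
    then show ?thesis by blast
  qed
qed

text \<open>The trailing powers of \<open>sigma\<close> and the reflection in the positive form of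
  \<alpha> normalize the outer class of \<open>sigma\<close>; dropping them leaves a word
  \<open>ys\<close> not ending in \<open>sigma\<close>. A reflection inverts the twist, and the sign
  \<open>e\<close> compensates. The last clause keeps track of the homology class of
  \<alpha>(b).\<close>

lemma twist_positive_conjugator:
  assumes \<alpha>: "aut \<alpha>" "\<alpha> \<circ> \<beta> = id" "\<beta> \<circ> \<alpha> = id"
  obtains b ys e v where "letter_auto b" "ys = [] \<or> last ys = False"
    "(\<alpha> \<circ> tws e True \<circ> \<beta>) \<circ> (b \<circ> pch ys) \<approx> (b \<circ> pch ys) \<circ> sigma"
    "\<alpha> gen_b = cj v (b (pch ys gen_b))"
proof -
  obtain b xs d where b: "letter_auto b" and f: "\<alpha> \<approx> b \<circ> pch xs \<circ> dpow d"
    using posform_aut[OF \<alpha>(1)] unfolding posform_def by blast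
  obtain ys n where xs: "xs = ys @ replicate n True" and ys: "ys = [] \<or> last ys = False"
    using trailing_replicate by blast
  define P where "P = pch (replicate n True)"
  define \<kappa> where "\<kappa> = P \<circ> dpow d"
  define \<theta> where "\<theta> = \<alpha> \<circ> tws (\<not> d) True \<circ> \<beta>"
  define \<gamma> where "\<gamma> = b \<circ> pch ys"
  have ab: "aut b" using b by (rule letter_auto_aut)
  have aP: "aut P" by (simp add: P_def)
  have k: "aut \<kappa>" unfolding \<kappa>_def dpow_def using aP by (auto intro: aut_comp)
  have ag: "ghom \<gamma>" using ab by (simp add: \<gamma>_def ghom_comp aut_ghom)
  obtain \<beta>' where b': "aut \<beta>'" "\<alpha> \<circ> \<beta>' = id" using aut_inverse[OF \<alpha>(1)] by blast
  have "\<beta> = \<beta> \<circ> (\<alpha> \<circ> \<beta>')" using b'(2) by simp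
  also have "\<dots> = (\<beta> \<circ> \<alpha>) \<circ> \<beta>'" by (simp only: comp_assoc)
  finally have gb: "ghom \<beta>" using \<alpha>(3) b'(1) by (simp add: aut_ghom)
  have gt: "ghom \<theta>" unfolding \<theta>_def using \<alpha>(1) gb by (simp add: ghom_comp aut_ghom)
  have f': "\<alpha> \<approx> \<gamma> \<circ> \<kappa>"
    using f unfolding xs pch_append P_def \<kappa>_def \<gamma>_def by (simp only: comp_assoc)
  have ks: "\<kappa> \<circ> tws (\<not> d) True \<approx> sigma \<circ> \<kappa>"
  proof (cases d)
    case True
    have "P \<circ> (auD \<circ> sigma_inv) \<approx> P \<circ> (sigma \<circ> auD)"
      using oeq_sym[OF tw_auD[of True]] aP by (intro oeq_left) (simp_all add: aut_ghom)
    also have "\<dots> \<approx> sigma \<circ> (P \<circ> auD)"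
      using pch_replicate_sigma(1)[of n] by (intro oeq_eq) (metis P_def comp_assoc)
    finally show ?thesis using True by (simp add: \<kappa>_def dpow_def tws_def comp_assoc)
  next
    case False
    then show ?thesis
      using pch_replicate_sigma(1)[of n] by (intro oeq_eq) (simp add: \<kappa>_def dpow_def tws_def P_def)
  qed
  have "\<theta> \<circ> (\<gamma> \<circ> \<kappa>) \<approx> \<theta> \<circ> \<alpha>" by (rule oeq_left[OF oeq_sym[OF f'] gt])
  also have "\<dots> \<approx> \<alpha> \<circ> tws (\<not> d) True"
    unfolding \<theta>_def by (intro oeq_eq) (simp only: comp_assoc \<alpha>(3) comp_id)
  also have "\<dots> \<approx> (\<gamma> \<circ> \<kappa>) \<circ> tws (\<not> d) True" by (rule oeq_right[OF f'])
  also have "\<dots> \<approx> \<gamma> \<circ> (\<kappa> \<circ> tws (\<not> d) True)" by (intro oeq_eq) (simp only: comp_assoc)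
  also have "\<dots> \<approx> \<gamma> \<circ> (sigma \<circ> \<kappa>)" by (rule oeq_left[OF ks ag])
  finally have main: "\<theta> \<circ> (\<gamma> \<circ> \<kappa>) \<approx> \<gamma> \<circ> (sigma \<circ> \<kappa>)" .
  obtain \<kappa>' where k': "\<kappa> \<circ> \<kappa>' = id" using aut_inverse[OF k] by blast
  have "\<theta> \<circ> \<gamma> \<approx> (\<theta> \<circ> (\<gamma> \<circ> \<kappa>)) \<circ> \<kappa>'" by (intro oeq_eq) (simp only: comp_assoc k' comp_id)
  also have "\<dots> \<approx> (\<gamma> \<circ> (sigma \<circ> \<kappa>)) \<circ> \<kappa>'" by (rule oeq_right[OF main])
  also have "\<dots> \<approx> \<gamma> \<circ> sigma" by (intro oeq_eq) (simp only: comp_assoc k' comp_id)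
  finally have 1: "\<theta> \<circ> \<gamma> \<approx> \<gamma> \<circ> sigma" .
  obtain v where v: "\<alpha> = cj v \<circ> (\<gamma> \<circ> \<kappa>)" using f' unfolding oeq_def by blast
  have "\<kappa> gen_b = gen_b" by (cases d) (simp_all add: \<kappa>_def dpow_def P_def pch_replicate_sigma(2))
  then have "\<alpha> gen_b = cj v (b (pch ys gen_b))" unfolding v by (simp add: \<gamma>_def)
  then show ?thesis using that[OF b ys] 1 unfolding \<theta>_def \<gamma>_def by blast
qed

text \<open>The trailing inverse of \<open>b\<close> moves left through the chain without changing
  its length, and the inner factor is then placed between letters and chain, as in
  \<open>Omega\<close>.\<close>

lemma twist_bounded_form:
  assumes b: "letter_auto b" and ys: "ys = [] \<or> last ys = False" and gt: "ghom \<theta>"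
    and th: "\<theta> \<circ> (b \<circ> pch ys) \<approx> (b \<circ> pch ys) \<circ> sigma"
  obtains c v t zs where "letter_auto c" "length zs \<le> max 1 (2 * length ys)"
    "\<theta> = c \<circ> cj v \<circ> wch (tws t) zs"
proof -
  obtain d where d: "letter_auto d" "b \<circ> d = id" "d \<circ> b = id" using letter_auto_inverse[OF b] by blast
  have ab: "ghom b" "ghom d" using b d(1) letter_auto_aut aut_ghom by blast+
  obtain c t zs where c: "letter_auto c" "length zs \<le> max 1 (2 * length ys)"
    and cz: "pch ys \<circ> sigma \<circ> wch twi (rev ys) \<approx> c \<circ> wch (tws t) zs"
    using twist_conjugate_form[OF ys] by blast
  obtain t' zs' where z: "length zs' = length zs" "wch (tws t) zs \<circ> d \<approx> d \<circ> wch (tws t') zs'"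
    using wch_letter[OF d(1)] by blast
  define W where "W = wch twi (rev ys)"
  have W: "pch ys \<circ> W = id"
    using wch_inverse[of True ys] by (simp add: W_def tws_def pch_wch)
  have gc: "ghom c" "ghom (b \<circ> c)" using c(1) ab letter_auto_aut aut_ghom ghom_comp by blast+
  have "\<theta> \<approx> (\<theta> \<circ> (b \<circ> pch ys)) \<circ> (W \<circ> d)"
  proof (rule oeq_eq)
    have "(\<theta> \<circ> (b \<circ> pch ys)) \<circ> (W \<circ> d) = \<theta> \<circ> (b \<circ> ((pch ys \<circ> W) \<circ> d))" by (simp only: comp_assoc)
    then show "\<theta> = (\<theta> \<circ> (b \<circ> pch ys)) \<circ> (W \<circ> d)" by (simp only: W d id_comp comp_id)
  qed
  also have "\<dots> \<approx> ((b \<circ> pch ys) \<circ> sigma) \<circ> (W \<circ> d)" by (rule oeq_right[OF th])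
  also have "\<dots> \<approx> b \<circ> ((pch ys \<circ> sigma \<circ> W) \<circ> d)" by (intro oeq_eq) (simp only: comp_assoc)
  also have "\<dots> \<approx> b \<circ> ((c \<circ> wch (tws t) zs) \<circ> d)"
    unfolding W_def by (intro oeq_left oeq_right cz ab)
  also have "\<dots> \<approx> (b \<circ> c) \<circ> (wch (tws t) zs \<circ> d)" by (intro oeq_eq) (simp only: comp_assoc)
  also have "\<dots> \<approx> (b \<circ> c) \<circ> (d \<circ> wch (tws t') zs')" by (rule oeq_left[OF z(2) gc(2)])
  also have "\<dots> \<approx> (b \<circ> c \<circ> d) \<circ> wch (tws t') zs'" by (intro oeq_eq) (simp only: comp_assoc)
  finally obtain w where w: "\<theta> = cj w \<circ> ((b \<circ> c \<circ> d) \<circ> wch (tws t') zs')" unfolding oeq_def by blast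
  define C where "C = b \<circ> c \<circ> d"
  have C: "letter_auto C" unfolding C_def using b c(1) d(1) by (intro letter_auto_comp)
  then obtain D where D: "C \<circ> D = id" using letter_auto_inverse by blast
  have "C \<circ> cj (D w) = cj (C (D w)) \<circ> C" using C letter_auto_aut aut_ghom ghom_comp_cj by blast
  also have "C (D w) = w" using D by (metis comp_apply id_apply)
  finally have fin: "\<theta> = C \<circ> cj (D w) \<circ> wch (tws t') zs'" using w unfolding C_def by (simp only: comp_assoc)
  show ?thesis by (rule that[OF C _ fin]) (simp only: z(1) c(2))
qed

section \<open>Homology bounds the conjugating word\<close>

definition abn :: "free2 \<Rightarrow> int" where
  "abn x = \<bar>ab Gen_A x\<bar> + \<bar>ab Gen_B x\<bar>"

lemma abn_le_len: "abn x \<le> int (len x)"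
proof -
  have "abn (ev u) \<le> int (length u)" for u
  proof (induction u)
    case (Cons l u)
    have "abn (lt l) = 1"
      by (cases l; cases "fst l"; cases "snd l") (auto simp: abn_def lt_gen simp del: lt_True)
    then show ?case using Cons unfolding abn_def by simp
  qed (simp add: abn_def)
  from this[of "rw x"] show ?thesis by (simp add: len_def)
qed

lemma abn_letter_auto:
  assumes "letter_auto c"
  shows "abn (c x) = abn x"
proof -
  have m: "ab g (auJ x) = - ab g x" "ab Gen_A (auS x) = ab Gen_B x" "ab Gen_B (auS x) = ab Gen_A x"
    "ab Gen_A (auD x) = - ab Gen_A x" "ab Gen_B (auD x) = ab Gen_B x"
    "ab Gen_A (auR x) = - ab Gen_B x" "ab Gen_B (auR x) = ab Gen_A x" for g x
    using ab_map[of auJ g x] ab_map[of auS _ x] ab_map[of auD _ x] ab_map[of auR _ x]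
    by (cases g; simp)+
  show ?thesis using letter_auto_cases[OF assms] by (auto simp: abn_def m)
qed

text \<open>The innermost \<open>tau\<close> makes both exponent sums of the image of
  \<open>gen_b\<close> positive, and each later twist adds one of them to the other.\<close>

lemma pch_abn:
  assumes "ys = [] \<or> last ys = False"
  shows "int (length ys) + 1 \<le> abn (pch ys gen_b)"
proof (cases ys rule: rev_cases)
  case Nil
  then show ?thesis by (simp add: abn_def)
next
  case (snoc zs y)
  have "1 \<le> ab Gen_A (pch zs z) \<and> 1 \<le> ab Gen_B (pch zs z)
      \<and> int (length zs) + 2 \<le> ab Gen_A (pch zs z) + ab Gen_B (pch zs z)"
    if z: "z = gen_b + gen_a" for z
  proof (induction zs)
    case Nil
    show ?case by (simp add: z)
  next
    case (Cons x zs)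
    then show ?case by (cases x) (auto simp: ab_twists)
  qed
  from this[OF refl] show ?thesis using assms by (simp add: snoc pch_append abn_def)
qed

lemma sigma_fixed_twists:
  "tws e True x = x \<longleftrightarrow> sigma x = x"
proof -
  have s: "sigma (sigma_inv z) = z" "sigma_inv (sigma z) = z" for z
    using comp_apply[of sigma sigma_inv z] comp_apply[of sigma_inv sigma z] by simp_all
  show ?thesis
  proof (cases e)
    case False
    have "sigma_inv x = x \<longleftrightarrow> sigma x = x" using s[of x] by metis
    then show ?thesis using False by (simp add: tws_def)
  qed (simp add: tws_def)
qed

lemma generate_induct_add:
  assumes "x \<in> generate F2 S" "P 0" "\<And>u. u \<in> S \<Longrightarrow> P u" "\<And>u. u \<in> S \<Longrightarrow> P (- u)"
    "\<And>u v. P u \<Longrightarrow> P v \<Longrightarrow> P (u + v)"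
  shows "P x"
  using assms(1) by induction (use assms in auto)

lemma generate_noncommuting:
  assumes "x \<in> generate F2 S" "y \<in> generate F2 S" "\<not> comm x y"
  obtains u v where "u \<in> S" "v \<in> S" "\<not> comm u v"
proof -
  have "comm x y" if c: "\<And>u v. u \<in> S \<Longrightarrow> v \<in> S \<Longrightarrow> comm u v"
  proof -
    have 1: "comm x u" if "u \<in> S" for u
      using assms(1) by (rule generate_induct_add) (use c that in \<open>auto intro: comm_add\<close>)
    have "comm y x"
      using assms(2) by (rule generate_induct_add) (use 1 in \<open>auto intro: comm_add comm_sym\<close>)
    then show ?thesis by (rule comm_sym)
  qed
  then show ?thesis using that assms(3) by blast
qed

lemma gens_norm_ge: "u \<in> set us \<Longrightarrow> len u \<le> gens_norm us"
  unfolding gens_norm_def by (intro Max_ge) auto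

lemma OmegaI:
  assumes "letter_auto c" "len v \<le> (2 ^ (4 * h + 4) + 1) * h" "length zs \<le> 4 * h + 4"
  shows "c \<circ> cj v \<circ> wch (tws t) zs \<in> Omega h"
proof -
  have "wch (tws t) zs \<in> Omega1 h"
    using wch_chains[OF assms(3)] by (cases t) (simp_all add: Omega1_def tws_def)
  moreover have "cj v \<in> Omega2 h" unfolding Omega2_def by (rule cj_delta[OF assms(2)])
  ultimately show ?thesis
    using letter_auto_whitehead[OF assms(1)] unfolding Omega_def by blast
qed

text \<open>With s = 4^h the right-hand side of the first hypothesis is at most 9 s^2 h, while the
  target contains 16 s^2 h.\<close>

lemma conjugator_arith:
  assumes "2 * l \<le> 2 ^ T * h + 2 * (2 * 4 ^ h)\<^sup>2" "T \<le> 2 * h" "1 \<le> (h::nat)"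
  shows "l \<le> (2 ^ (4 * h + 4) + 1) * h"
proof -
  define s :: nat where "s = 4 ^ h"
  have s: "1 \<le> s" by (simp add: s_def)
  have "2 ^ T \<le> (2 ^ (2 * h) :: nat)" using assms(2) by (intro power_increasing) simp_all
  also have "\<dots> = s" by (simp add: s_def power_mult)
  also have "s \<le> s\<^sup>2" using s by (simp add: power2_eq_square)
  finally have "2 ^ T * h \<le> s\<^sup>2 * h" by simp
  moreover have "s\<^sup>2 \<le> s\<^sup>2 * h" using assms(3) by simp
  moreover have "2 * (2 * 4 ^ h)\<^sup>2 = 8 * s\<^sup>2" by (simp add: s_def power2_eq_square)
  moreover have "(2 ^ (4 * h + 4) + 1) * h = 16 * (s\<^sup>2 * h) + h"
  proof -
    have "(2::nat) ^ (4 * h) = s\<^sup>2" unfolding s_def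
      by (simp add: power_mult power2_eq_square flip: power_mult_distrib)
    then show ?thesis by (simp add: power_add algebra_simps)
  qed
  ultimately show ?thesis using assms(1) by linarith
qed

theorem nonabelian_fixed_in_Omega:
  fixes us :: "free2 list"
  assumes H: "H = generate F2 (set us)" "is_fixed_point_group H \<phi>"
    and xy: "x \<in> H" "y \<in> H" "\<not> comm x y" and ni: "\<phi> \<noteq> id"
  shows "\<exists>\<psi> \<in> Omega (gens_norm us). is_fixed_point_group H \<psi>"
proof -
  define h where "h = gens_norm us"
  have ap: "aut \<phi>" and Hp: "H = {x. \<phi> x = x}"
    using H(2) by (simp_all add: is_fixed_point_group_def aut_iff)
  obtain \<alpha> \<beta> m where \<alpha>: "aut \<alpha>" "\<alpha> \<circ> \<beta> = id" "\<beta> \<circ> \<alpha> = id" and m: "m > 0" and f: "\<phi> = \<alpha> \<circ> Tw 0 m \<circ> \<beta>"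
    using nonabelian_fixed_twist[OF ap, of x y] xy ni unfolding Hp by blast
  have inv: "\<alpha> (\<beta> z) = z" "\<beta> (\<alpha> z) = z" for z using \<alpha> by (metis comp_apply id_apply)+
  \<comment> \<open>Independence of the exponent \<open>m\<close> enters here: \<beta> carries H
    onto the fixed subgroup of \<open>sigma\<close>.\<close>
  have Hs: "z \<in> H \<longleftrightarrow> sigma (\<beta> z) = \<beta> z" for z
  proof -
    have "z \<in> H \<longleftrightarrow> \<alpha> (Tw 0 m (\<beta> z)) = \<alpha> (\<beta> z)" unfolding Hp f by (simp add: inv)
    also have "\<dots> \<longleftrightarrow> Tw 0 m (\<beta> z) = \<beta> z" using \<alpha>(1) by (rule aut_inject)
    also have "\<dots> \<longleftrightarrow> Tw 0 1 (\<beta> z) = \<beta> z"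
      using Tw_fixed_scale[of m "\<beta> z" 1] Tw_fixed_scale[of 1 "\<beta> z" m] m by auto
    finally show ?thesis by (simp add: sigma_Tw)
  qed
  obtain b ys e v where b: "letter_auto b" and ys: "ys = [] \<or> last ys = False"
    and th: "(\<alpha> \<circ> tws e True \<circ> \<beta>) \<circ> (b \<circ> pch ys) \<approx> (b \<circ> pch ys) \<circ> sigma"
    and ab: "\<alpha> gen_b = cj v (b (pch ys gen_b))"
    using twist_positive_conjugator[OF \<alpha>] by blast
  define \<theta> where "\<theta> = \<alpha> \<circ> tws e True \<circ> \<beta>"
  have b': "aut \<beta>"
  proof -
    obtain \<beta>' where b': "aut \<beta>'" "\<alpha> \<circ> \<beta>' = id" using aut_inverse[OF \<alpha>(1)] by blast
    have "\<beta> = \<beta>'"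
    proof
      fix z
      have "\<alpha> (\<beta>' z) = z" using b'(2) by (metis comp_apply id_apply)
      then show "\<beta> z = \<beta>' z" by (metis inv(2))
    qed
    then show ?thesis using b'(1) by simp
  qed
  have at: "aut \<theta>" unfolding \<theta>_def using \<alpha>(1) b' by (intro aut_comp) (simp_all add: tws_def)
  have Ht: "H = {z. \<theta> z = z}"
  proof -
    have "\<theta> z = z \<longleftrightarrow> z \<in> H" for z
    proof -
      have "\<theta> z = z \<longleftrightarrow> \<alpha> (tws e True (\<beta> z)) = \<alpha> (\<beta> z)" by (simp add: \<theta>_def inv)
      also have "\<dots> \<longleftrightarrow> tws e True (\<beta> z) = \<beta> z" using \<alpha>(1) by (rule aut_inject)
      finally show ?thesis by (simp add: Hs sigma_fixed_twists)
    qed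
    then show ?thesis by blast
  qed
  have gen: "u \<in> H" if "u \<in> set us" for u unfolding H(1) using that by (rule generate.incl)
  \<comment> \<open>Elements fixed by \<open>sigma\<close> have exponent sum 0 in the first
    generator, so the homology of H lies on the line of \<alpha>(b).\<close>
  have abz: "ab g z = ab Gen_B (\<beta> z) * ab g (\<alpha> gen_b)" if "z \<in> H" for g z
  proof -
    have "ab Gen_A (\<beta> z) = 0" using ab_twists(2)[of "\<beta> z"] that by (simp add: Hs)
    then show ?thesis using ab_map[OF aut_ghom[OF \<alpha>(1)], of g "\<beta> z"] by (simp add: inv)
  qed
  have "abn (\<alpha> gen_b) = abn (b (pch ys gen_b))" unfolding ab by (simp add: abn_def)
  also have "\<dots> = abn (pch ys gen_b)" by (rule abn_letter_auto[OF b])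
  finally have ys_le: "int (length ys) + 1 \<le> abn (\<alpha> gen_b)" using pch_abn[OF ys] by simp
  \<comment> \<open>H contains \<alpha>(b), whose class is nonzero, so the given generators cannot
    all be null-homologous.\<close>
  have "\<exists>u\<in>set us. abn u \<noteq> 0"
  proof (rule ccontr)
    assume "\<not> ?thesis"
    then have z: "ab g u = 0" if "u \<in> set us" for g u using that by (cases g) (auto simp: abn_def)
    have "\<alpha> gen_b \<in> H" by (simp add: Hs inv)
    then have "ab g (\<alpha> gen_b) = 0" for g
      unfolding H(1) by (rule generate_induct_add) (simp_all add: z)
    then show False using ys_le by (simp add: abn_def)
  qed
  then obtain u where u: "u \<in> set us" "abn u \<noteq> 0" by blast
  have "abn u = \<bar>ab Gen_B (\<beta> u)\<bar> * abn (\<alpha> gen_b)"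
    unfolding abn_def abz[OF gen[OF u(1)]] by (simp add: abs_mult distrib_left)
  moreover from this have "1 \<le> \<bar>ab Gen_B (\<beta> u)\<bar>" using u(2) by (cases "ab Gen_B (\<beta> u) = 0") auto
  ultimately have "abn (\<alpha> gen_b) \<le> abn u"
    using mult_right_mono[of 1 "\<bar>ab Gen_B (\<beta> u)\<bar>" "abn (\<alpha> gen_b)"] ys_le by simp
  also have "\<dots> \<le> int h" using abn_le_len[of u] gens_norm_ge[OF u(1)] by (simp add: h_def)
  finally have h: "length ys + 1 \<le> h" using ys_le by linarith
  obtain c w t zs where c: "letter_auto c" and zs: "length zs \<le> max 1 (2 * length ys)"
    and tc: "\<theta> = c \<circ> cj w \<circ> wch (tws t) zs"
    by (rule twist_bounded_form[OF b ys aut_ghom[OF at] th[folded \<theta>_def]])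
  have T: "length zs \<le> 2 * h" using zs h by simp
  obtain d where d: "letter_auto d" "d \<circ> c = id" using letter_auto_inverse[OF c] by blast
  \<comment> \<open>On H the equation \<theta>(z) = z says that conjugation by \<open>- w\<close>
    acts, after letters, as the chain. Short generators thus go to elements of length at most
    \<open>2 ^ length zs * h\<close>, as \<open>conjugator_bound\<close> requires.\<close>
  have moved: "cj (- w) (d z) = wch (tws t) zs z" if "z \<in> H" for z
  proof -
    have "c (cj w (wch (tws t) zs z)) = z" using that tc unfolding Ht by (metis (mono_tags) comp_apply mem_Collect_eq)
    then have "d z = cj w (wch (tws t) zs z)" using d(2) by (metis comp_apply id_apply)
    then show ?thesis by simp
  qed
  have short: "len (wch (tws t) zs z) \<le> 2 ^ length zs * h" if "len z \<le> h" for z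
  proof -
    have "len (wch (tws t) zs z) \<le> 2 ^ length zs * len z"
      using len_wch[of zs z] by (cases t) (simp_all add: tws_def)
    also have "\<dots> \<le> 2 ^ length zs * h" using that by simp
    finally show ?thesis .
  qed
  obtain u1 u2 where u12: "u1 \<in> set us" "u2 \<in> set us" "\<not> comm u1 u2"
    using generate_noncommuting xy unfolding H(1) by blast
  have len12: "len u1 \<le> h" "len u2 \<le> h" using gens_norm_ge u12 by (simp_all add: h_def)
  have "\<not> comm (d u1) (d u2)"
  proof
    assume "comm (d u1) (d u2)"
    then have "d (u1 + u2) = d (u2 + u1)"
      using d(1) letter_auto_aut aut_ghom by (simp add: comm_def ghom_add)
    then show False using u12(3) aut_inject[OF letter_auto_aut[OF d(1)]] by (simp add: comm_def)
  qed
  moreover have "len (d u1) \<le> h" "len (d u2) \<le> h"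
    using letter_auto_len_le[OF d(1)] len12 le_trans by blast+
  moreover have "len (cj (- w) (d u1)) \<le> 2 ^ length zs * h" "len (cj (- w) (d u2)) \<le> 2 ^ length zs * h"
    using u12 gen by (simp_all add: moved short len12)
  ultimately have "2 * len w \<le> 2 ^ length zs * h + 2 * (2 * 4 ^ h)\<^sup>2" by (rule conjugator_bound)
  then have "len w \<le> (2 ^ (4 * h + 4) + 1) * h" using T h by (intro conjugator_arith) simp_all
  then have "\<theta> \<in> Omega h" unfolding tc using T by (intro OmegaI[OF c]) simp_all
  then show ?thesis using at Ht unfolding h_def is_fixed_point_group_def aut_iff by blast
qed

section \<open>The abelian case and the conclusion\<close>

lemma auJ_fixed: "auJ x = x \<longleftrightarrow> x = 0"
proof
  assume fx: "auJ x = x"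
  have "auJ (ev u) = ev (map inv_letter u)" for u
  proof (induction u)
    case (Cons l u)
    have "auJ (lt l) = lt (inv_letter l)"
      by (cases l; cases "fst l"; cases "snd l") (auto simp: lt_gen inv_letter_def ghom_simps simp del: lt_True)
    then show ?case using Cons by (simp add: ghom_simps)
  qed (simp add: ghom_simps)
  then have e: "ev (map inv_letter (rw x)) = ev (rw x)" using fx by (metis ev_rw)
  have "reduced (map inv_letter (rw x))"
    using reduced_inv[of "rev (rw x)"] reduced_rw[of x]
    by (simp add: reduced_def successively_map) (metis (mono_tags, lifting) inv_letter_inv_letter successively_mono)
  then have m: "map inv_letter (rw x) = rw x" using e ev_inject reduced_rw by blast
  show "x = 0"
  proof (cases "rw x")
    case Nil
    then show ?thesis by (metis ev_rw ev_simps(1))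
  next
    case (Cons l u)
    then show ?thesis using m by simp
  qed
qed (simp add: ghom_simps)

theorem abelian_fixed_in_Omega:
  fixes us :: "free2 list"
  assumes H: "H = generate F2 (set us)" and cm: "\<And>x y. x \<in> H \<Longrightarrow> y \<in> H \<Longrightarrow> comm x y"
    and fp: "is_fixed_point_group H \<phi>"
  shows "\<exists>\<psi> \<in> Omega (gens_norm us). is_fixed_point_group H \<psi>"
proof (cases "\<exists>u\<in>set us. u \<noteq> 0")
  case True
  then obtain u where u: "u \<in> set us" "u \<noteq> 0" by blast
  have uH: "u \<in> H" unfolding H using u(1) by (rule generate.incl)
  have Hp: "ghom \<phi>" "H = {x. \<phi> x = x}"
    using fp aut_ghom by (simp_all add: is_fixed_point_group_def aut_iff)
  have "x \<in> H" if "comm x u" for x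
    using fixes_centralizer[OF Hp(1) _ u(2) that] uH unfolding Hp(2) by simp
  then have "H = {x. cj u x = x}" using cm[OF uH] comm_sym by (auto simp: cj_comm_iff)
  moreover have "cj u \<in> Omega (gens_norm us)"
    using OmegaI[OF letter_auto_letters(1), of u "gens_norm us" "[]" True] gens_norm_ge[OF u(1)] by simp
  ultimately show ?thesis unfolding is_fixed_point_group_def aut_iff using aut_cj by blast
next
  case False
  have "x = 0" if "x \<in> H" for x
    using that unfolding H by (rule generate_induct_add) (use False in auto)
  moreover have "0 \<in> H" unfolding H using generate.one[of F2 "set us"] by simp
  ultimately have "H = {x. auJ x = x}" by (auto simp: auJ_fixed)
  moreover have "auJ \<in> Omega (gens_norm us)"
    using OmegaI[OF letter_auto_letters(2), of 0 "gens_norm us" "[]" True] by (simp add: comp_def)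
  ultimately show ?thesis unfolding is_fixed_point_group_def aut_iff using aut_letters(1) by blast
qed

theorem theorem4p6:
  fixes us :: "free2 list" and H :: "free2 set" and \<phi> :: "free2 \<Rightarrow> free2"
  assumes "H = generate F2 (set us)"
    and "is_fixed_point_group H \<phi>"
  shows "\<exists>\<psi> \<in> Omega (gens_norm us). is_fixed_point_group H \<psi>"
proof (cases "\<forall>x\<in>H. \<forall>y\<in>H. comm x y")
  case True
  then show ?thesis using abelian_fixed_in_Omega[OF assms(1) _ assms(2)] by blast
next
  case False
  show ?thesis
  proof (cases "\<phi> = id")
    case True
    have "id \<in> Omega (gens_norm us)"
      using OmegaI[OF letter_auto_letters(1), of 0 "gens_norm us" "[]" True] by (simp add: comp_def id_def)
    then show ?thesis using assms(2) unfolding True by blast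
  next
    case False
    then show ?thesis using nonabelian_fixed_in_Omega[OF assms] \<open>\<not> (\<forall>x\<in>H. \<forall>y\<in>H. comm x y)\<close> by blast
  qed
qed

end
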